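(* Let $k$ be an algebraically closed field (of arbitrary characteristic), and let $e,n$ be positive integers with $n\ge 4e^2$. For general points $p_1,\dots,p_n\in\mathbb{P}^2=\mathbb{P}^2_k$, and for every $d$, the linear system $\mathcal L$ of curves of degree $d$ with multiplicity at least $e$ at each $p_i$ is regular.
   Context: The linear system $\mathcal L$ is the projectivization of the space of homogeneous polynomials of degree $d$ in three variables vanishing to order at least $e$ at each $p_i$; dimension means projective dimension. $\mathcal L$ is called regular if it is empty or its dimension equals $\frac{d(d+3)}{2}-n\frac{e(e+1)}{2}$. "General points" means that $(p_1,\dots,p_n)$ varies in some nonempty Zariski-open subset of $(\mathbb{P}^2)^n$. *)

theory Defs
  imports
    "HOL-Analysis.Analysis"
    "HOL-Computational_Algebra.Computational_Algebra"
    "HOL-Library.Poly_Mapping"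
    "HOL-Library.FuncSet"
begin

text \<open>
  The ring of polynomials over \<open>'a\<close> in variables indexed by \<open>'v\<close> is the monoid algebra
  of the free commutative monoid of monomials \<open>'v \<Rightarrow>\<^sub>0 nat\<close>.
\<close>

type_synonym ('v, 'a) mpoly = "('v \<Rightarrow>\<^sub>0 nat) \<Rightarrow>\<^sub>0 'a"

definition Const :: "'a::zero \<Rightarrow> ('v, 'a) mpoly"
  where "Const c = Poly_Mapping.single 0 c"

definition Var :: "'v \<Rightarrow> ('v, 'a::zero_neq_one) mpoly"
  where "Var v = Poly_Mapping.single (Poly_Mapping.single v 1) 1"

definition mdeg :: "('v \<Rightarrow>\<^sub>0 nat) \<Rightarrow> nat"
  where "mdeg m = (\<Sum>v\<in>Poly_Mapping.keys m. Poly_Mapping.lookup m v)"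

definition homogeneous :: "nat \<Rightarrow> ('v, 'a::zero) mpoly \<Rightarrow> bool"
  where "homogeneous d F \<longleftrightarrow> (\<forall>m\<in>Poly_Mapping.keys F. mdeg m = d)"

definition mp_subst ::
  "('a::zero \<Rightarrow> 'r::comm_ring_1) \<Rightarrow> ('v \<Rightarrow> 'r) \<Rightarrow> ('v, 'a) mpoly \<Rightarrow> 'r"
  where "mp_subst \<phi> f F =
    (\<Sum>m\<in>Poly_Mapping.keys F. \<phi> (Poly_Mapping.lookup F m) *
       (\<Prod>v\<in>Poly_Mapping.keys m. f v ^ Poly_Mapping.lookup m v))"

definition mp_eval :: "('v \<Rightarrow> 'a) \<Rightarrow> ('v, 'a::comm_ring_1) mpoly \<Rightarrow> 'a"
  where "mp_eval a F = mp_subst (\<lambda>c. c) a F"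

definition mp_translate :: "('v \<Rightarrow> 'a) \<Rightarrow> ('v, 'a::comm_ring_1) mpoly \<Rightarrow> ('v, 'a) mpoly"
  where "mp_translate a F = mp_subst Const (\<lambda>v. Const (a v) + Var v) F"

text \<open>
  Order of vanishing at a point \<open>a\<close> of affine space: after moving \<open>a\<close> to the origin,
  no monomial of degree less than \<open>e\<close> occurs. No derivatives are used, since the
  characteristic is arbitrary.
\<close>

definition vanishes_to_order :: "nat \<Rightarrow> ('v, 'a::comm_ring_1) mpoly \<Rightarrow> ('v \<Rightarrow> 'a) \<Rightarrow> bool"
  where "vanishes_to_order e F a \<longleftrightarrow>
    (\<forall>m\<in>Poly_Mapping.keys (mp_translate a F). e \<le> mdeg m)"

definition mp_scale :: "'a::comm_ring_1 \<Rightarrow> ('v, 'a) mpoly \<Rightarrow> ('v, 'a) mpoly"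
  where "mp_scale c F = Const c * F"

interpretation mp: vector_space "mp_scale :: 'a::field \<Rightarrow> ('v, 'a) mpoly \<Rightarrow> ('v, 'a) mpoly"
  by unfold_locales
    (simp_all add: mp_scale_def Const_def algebra_simps single_add mult_single
      flip: mult.assoc)

context vector_space
begin

definition projectivization :: "'b set \<Rightarrow> 'b set set"
  where "projectivization V = {L. subspace L \<and> dim L = 1 \<and> L \<subseteq> V}"

definition pdim :: "'b set \<Rightarrow> int"
  where "pdim V = int (dim V) - 1"

end

text \<open>
  A point of the projective plane is a line through the origin in \<open>k\<^sup>3\<close>; its homogeneous
  coordinate vectors are the nonzero elements of that line.
\<close>

definition proj_plane :: "('k::field ^ 3) set set"
  where "proj_plane = vec.projectivization UNIV"

abbreviation plane_tuples :: "nat \<Rightarrow> (nat \<Rightarrow> ('k::field ^ 3) set) set"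
  where "plane_tuples n \<equiv> {..<n} \<rightarrow>\<^sub>E proj_plane"

text \<open>
  The variable \<open>(i, j)\<close> is the \<open>j\<close>-th homogeneous coordinate on the \<open>i\<close>-th factor.
\<close>

definition multihomogeneous :: "nat \<Rightarrow> (nat \<times> 3, 'k::zero) mpoly \<Rightarrow> bool"
  where "multihomogeneous n P \<longleftrightarrow>
    (\<exists>\<delta>. \<forall>m\<in>Poly_Mapping.keys P.
       (\<forall>(i, j)\<in>Poly_Mapping.keys m. i < n) \<and>
       (\<forall>i<n. (\<Sum>j\<in>UNIV. Poly_Mapping.lookup m (i, j)) = \<delta> i))"

definition vanishes_on_tuple ::
  "nat \<Rightarrow> (nat \<times> 3, 'k::field) mpoly \<Rightarrow> (nat \<Rightarrow> ('k ^ 3) set) \<Rightarrow> bool"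
  where "vanishes_on_tuple n P p \<longleftrightarrow>
    (\<forall>x. (\<forall>i<n. x i \<in> p i - {0}) \<longrightarrow> mp_eval (\<lambda>(i, j). x i $ j) P = 0)"

definition zariski_closed :: "nat \<Rightarrow> (nat \<Rightarrow> ('k::field ^ 3) set) set \<Rightarrow> bool"
  where "zariski_closed n Z \<longleftrightarrow>
    (\<exists>S. (\<forall>P\<in>S. multihomogeneous n P) \<and>
         Z = {p \<in> plane_tuples n. \<forall>P\<in>S. vanishes_on_tuple n P p})"

definition zariski_open :: "nat \<Rightarrow> (nat \<Rightarrow> ('k::field ^ 3) set) set \<Rightarrow> bool"
  where "zariski_open n U \<longleftrightarrow>
    U \<subseteq> plane_tuples n \<and> zariski_closed n (plane_tuples n - U)"

definition dehomogenize :: "'v \<Rightarrow> ('v, 'a::comm_ring_1) mpoly \<Rightarrow> ('v, 'a) mpoly"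
  where "dehomogenize i F = mp_subst Const (\<lambda>j. if j = i then 1 else Var j) F"

text \<open>
  The order at a point of the plane is taken in the affine charts \<open>x\<^sub>i = 1\<close> containing it.
  The variable \<open>i\<close> does not occur in \<open>dehomogenize i F\<close>, so translating by the
  homogeneous coordinate vector with \<open>i\<close>-th entry 1 is translation in the chart.
  For homogeneous \<open>F\<close> all charts give the same order.
\<close>

definition vanishes_to_order_at :: "nat \<Rightarrow> (3, 'k::field) mpoly \<Rightarrow> ('k ^ 3) set \<Rightarrow> bool"
  where "vanishes_to_order_at e F p \<longleftrightarrow>
    (\<forall>i. \<forall>x\<in>p. x $ i = 1 \<longrightarrow> vanishes_to_order e (dehomogenize i F) (\<lambda>j. x $ j))"

definition form_space ::
  "nat \<Rightarrow> nat \<Rightarrow> nat \<Rightarrow> (nat \<Rightarrow> ('k::field ^ 3) set) \<Rightarrow> (3, 'k) mpoly set"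
  where "form_space n d e p =
    {F. homogeneous d F \<and> (\<forall>i<n. vanishes_to_order_at e F (p i))}"

definition linear_system ::
  "nat \<Rightarrow> nat \<Rightarrow> nat \<Rightarrow> (nat \<Rightarrow> ('k::field ^ 3) set) \<Rightarrow> (3, 'k) mpoly set set"
  where "linear_system n d e p = mp.projectivization (form_space n d e p)"

text \<open>Both divisions by 2 are exact.\<close>

definition regular_system ::
  "nat \<Rightarrow> nat \<Rightarrow> nat \<Rightarrow> (nat \<Rightarrow> ('k::field ^ 3) set) \<Rightarrow> bool"
  where "regular_system n d e p \<longleftrightarrow>
    linear_system n d e p = {} \<or>
    mp.pdim (form_space n d e p) =
      int d * (int d + 3) div 2 - int n * (int e * (int e + 1) div 2)"

end

(*
  Regularity means that the conditions imposed by the n points are independent, or leave no curve.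
  Both are open conditions, given by the non-vanishing of a multihomogeneous polynomial (fraction-free
  elimination), and both carry over to smaller, respectively larger, degrees; so it is enough to find
  one good configuration for the last degree d with (d + 1)(d + 2) <= n e (e + 1) and one for d + 1,
  where the difference of the two numbers is filled up by a few simple points.

  Such a configuration is a degeneration onto the curve y A(x) = 1, where deg A < k and k is the
  quotient of d + 1 by e + 1. Polynomials of degree at most d are expanded as sums of c_b(x, y) (y A - 1)^b
  for b <= e + 1, the row c_b being an arbitrary jet of a fixed length in the coordinate x of the curve;
  that every jet is attained for a suitable A follows, in every characteristic, from a rigidity argument
  for polynomials whose coefficients are generic. The points (t^M \<xi>, 1 / A + t^w) approach the curve
  at the origin as t tends to 0. If the speed w of a point and the weights of the rows are chosen
  suitably, its multiplicity e turns in the limit into multiplicities on the single rows, where the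
  condition is Hermite interpolation in one variable. A point has multiplicities e, ..., 1, 0 along the
  rows in increasing or decreasing order, and the number of points of each kind is chosen such that all
  rows are exhausted exactly; for reasons of parity one point may have to be moved to infinity.
*)

theory Submission
  imports Defs
begin


text \<open>No limit of the point scheme is computed. A kernel vector is taken with entries in
  \<open>k[t]\<close>, only its value at t = 0 is shown to vanish, and repeated division by t then
  kills it. Hence each row may carry its own power of t, although the matrix at t = 0 may be
  singular.

  The distribution over the rows is governed by slopes. For 1 \<le> b \<le> e the row lengths form
  an arithmetic progression with difference -k^2, and every point contributes to these rows a
  progression of slope 1 or -1, up to corrections by one. So the number of rising minus falling
  points is prescribed, and for e > 1 the number of points must have the parity of k; this is the
  reason for the point at infinity. Rows 0 and e + 1 are served by points of their own, and one
  point at each end absorbs the remainder modulo e.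

  The constant: the counts come out nonnegative once k \<ge> 2e - 1, that is d + 1 \<ge> (2e - 1)(e
  + 1), and for d + 1 = (2e - 1)(e + 1) the number (d + 1)(d + 2) is (4e^2 - 1) e (e + 1).\<close>

section \<open>Linear systems with polynomial entries\<close>

text \<open>Columns are eliminated by multiplying with the pivot instead of dividing by it.
  \<open>\<Delta>\<close> is the product of the pivots, so it survives \<open>\<psi>\<close>, and
  under any homomorphism where it survives the same elimination runs. \<open>H\<close> is an
  abstract grading that records the degree of \<open>\<Delta>\<close>; it is trivial in one use and
  the multidegree in the other. The set \<open>J\<close> of rows may be infinite.\<close>

lemma fraction_free_elimination:
  fixes m :: "'j \<Rightarrow> 'i \<Rightarrow> 'r::comm_ring_1" and \<psi> :: "'r \<Rightarrow> 'd::idom"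
    and H :: "'g \<Rightarrow> 'r \<Rightarrow> bool" and pl :: "'g \<Rightarrow> 'g \<Rightarrow> 'g"
  assumes H1: "H z 1"
    and Hm: "\<And>a b x y. H a x \<Longrightarrow> H b y \<Longrightarrow> H (pl a b) (x * y)"
    and Hd: "\<And>a x y. H a x \<Longrightarrow> H a y \<Longrightarrow> H a (x - y)"
    and plc: "\<And>a b. pl a b = pl b a"
    and \<psi>m: "\<And>x y. \<psi> (x * y) = \<psi> x * \<psi> y"
    and \<psi>d: "\<And>x y. \<psi> (x - y) = \<psi> x - \<psi> y"
    and \<psi>1: "\<psi> 1 = 1"
  shows "finite I \<Longrightarrow> (\<And>j i. j \<in> J \<Longrightarrow> i \<in> I \<Longrightarrow> H (\<rho> j) (m j i)) \<Longrightarrow>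
     (\<And>v. (\<And>j. j \<in> J \<Longrightarrow> (\<Sum>i\<in>I. \<psi> (m j i) * v i) = 0) \<Longrightarrow> \<forall>i\<in>I. v i = 0) \<Longrightarrow>
     \<exists>\<Delta> \<gamma>. H \<gamma> \<Delta> \<and> \<psi> \<Delta> \<noteq> 0 \<and>
       (\<forall>\<phi> :: 'r \<Rightarrow> 'f::idom. (\<forall>x y. \<phi> (x * y) = \<phi> x * \<phi> y) \<longrightarrow> (\<forall>x y. \<phi> (x - y) = \<phi> x - \<phi> y) \<longrightarrow>
          \<phi> \<Delta> \<noteq> 0 \<longrightarrow>
          (\<forall>v. (\<forall>j\<in>J. (\<Sum>i\<in>I. \<phi> (m j i) * v i) = 0) \<longrightarrow> (\<forall>i\<in>I. v i = 0)))"
proof (induction I arbitrary: m \<rho> rule: finite_induct)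
  case empty
  show ?case using H1 \<psi>1 by (intro exI[of _ 1] exI[of _ z]) auto
next
  case (insert k I)
  note inj = insert.prems(2)
  have "\<exists>l\<in>J. \<psi> (m l k) \<noteq> 0"
  proof (rule ccontr)
    assume "\<not> ?thesis"
    then have z: "\<And>l. l \<in> J \<Longrightarrow> \<psi> (m l k) = 0" by auto
    have "\<forall>i\<in>insert k I. (if i = k then 1 else (0::'d)) = 0"
    proof (rule inj)
      fix j assume "j \<in> J"
      have "(\<Sum>i\<in>insert k I. \<psi> (m j i) * (if i = k then 1 else 0)) = \<psi> (m j k)"
        using insert.hyps by (subst sum.insert) (auto intro!: sum.neutral)
      then show "(\<Sum>i\<in>insert k I. \<psi> (m j i) * (if i = k then 1 else 0)) = 0"
        using z \<open>j \<in> J\<close> by simp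
    qed
    then show False by auto
  qed
  then obtain l where l: "l \<in> J" "\<psi> (m l k) \<noteq> 0" by auto
  \<comment> \<open>Row \<open>l\<close> becomes zero in \<open>m'\<close>, so it can stay in
    \<open>J\<close>. Both products have degree \<open>pl (\<rho> l) (\<rho> j)\<close>, which keeps
    the rows homogeneous.\<close>
  define m' where "m' j i = m l k * m j i - m j k * m l i" for j i
  have H': "H (pl (\<rho> l) (\<rho> j)) (m' j i)" if "j \<in> J" "i \<in> I" for j i
  proof -
    have "H (pl (\<rho> l) (\<rho> j)) (m l k * m j i)" using insert.prems(1) l that by (intro Hm) auto
    moreover have "H (pl (\<rho> l) (\<rho> j)) (m j k * m l i)"
      using insert.prems(1) l that by (subst plc, intro Hm) auto
    ultimately show ?thesis unfolding m'_def by (rule Hd)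
  qed
  have inj': "\<forall>i\<in>I. v i = 0" if v: "\<And>j. j \<in> J \<Longrightarrow> (\<Sum>i\<in>I. \<psi> (m' j i) * v i) = 0" for v
  proof -
    \<comment> \<open>The kernel vector of the reduced system is scaled by the pivot, so that the
      eliminated entry is available without division.\<close>
    define w where "w i = (if i = k then - (\<Sum>i\<in>I. \<psi> (m l i) * v i) else \<psi> (m l k) * v i)" for i
    have "\<forall>i\<in>insert k I. w i = 0"
    proof (rule inj)
      fix j assume j: "j \<in> J"
      have "(\<Sum>i\<in>insert k I. \<psi> (m j i) * w i) = \<psi> (m j k) * w k + (\<Sum>i\<in>I. \<psi> (m j i) * w i)"
        using insert.hyps by simp
      also have "(\<Sum>i\<in>I. \<psi> (m j i) * w i) = (\<Sum>i\<in>I. \<psi> (m j i) * (\<psi> (m l k) * v i))"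
        using insert.hyps by (intro sum.cong) (auto simp: w_def)
      also have "\<psi> (m j k) * w k + \<dots> = (\<Sum>i\<in>I. \<psi> (m' j i) * v i)"
        by (simp add: w_def m'_def \<psi>m \<psi>d sum_distrib_left sum_subtractf algebra_simps)
      finally show "(\<Sum>i\<in>insert k I. \<psi> (m j i) * w i) = 0" using v[OF j] by simp
    qed
    then show ?thesis using l insert.hyps by (auto simp: w_def split: if_splits)
  qed
  note IH = insert.IH[of "\<lambda>j. pl (\<rho> l) (\<rho> j)" m']
  have "\<exists>\<Delta> \<gamma>. H \<gamma> \<Delta> \<and> \<psi> \<Delta> \<noteq> 0 \<and>
       (\<forall>\<phi> :: 'r \<Rightarrow> 'f. (\<forall>x y. \<phi> (x * y) = \<phi> x * \<phi> y) \<longrightarrow> (\<forall>x y. \<phi> (x - y) = \<phi> x - \<phi> y) \<longrightarrow>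
          \<phi> \<Delta> \<noteq> 0 \<longrightarrow>
          (\<forall>v. (\<forall>j\<in>J. (\<Sum>i\<in>I. \<phi> (m' j i) * v i) = 0) \<longrightarrow> (\<forall>i\<in>I. v i = 0)))"
  proof (rule IH)
    show "H (pl (\<rho> l) (\<rho> j)) (m' j i)" if "j \<in> J" "i \<in> I" for j i by (rule H'[OF that])
    show "\<forall>i\<in>I. v i = 0" if "\<And>j. j \<in> J \<Longrightarrow> (\<Sum>i\<in>I. \<psi> (m' j i) * v i) = 0" for v
      by (rule inj') (rule that)
  qed
  then obtain \<Delta> \<gamma> where \<Delta>: "H \<gamma> \<Delta>" "\<psi> \<Delta> \<noteq> 0"
    and good: "\<forall>\<phi> :: 'r \<Rightarrow> 'f. (\<forall>x y. \<phi> (x * y) = \<phi> x * \<phi> y) \<longrightarrow> (\<forall>x y. \<phi> (x - y) = \<phi> x - \<phi> y) \<longrightarrow>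
          \<phi> \<Delta> \<noteq> 0 \<longrightarrow>
          (\<forall>v. (\<forall>j\<in>J. (\<Sum>i\<in>I. \<phi> (m' j i) * v i) = 0) \<longrightarrow> (\<forall>i\<in>I. v i = 0))"
    by (elim exE conjE)
  show ?case
  proof (intro exI conjI allI impI)
    show "H (pl (\<rho> l) \<gamma>) (m l k * \<Delta>)" using insert.prems(1) l \<Delta> by (intro Hm) auto
    show "\<psi> (m l k * \<Delta>) \<noteq> 0" using l \<Delta> by (simp add: \<psi>m)
    fix \<phi> :: "'r \<Rightarrow> 'f" and v
    assume \<phi>m: "\<forall>x y. \<phi> (x * y) = \<phi> x * \<phi> y" and \<phi>d: "\<forall>x y. \<phi> (x - y) = \<phi> x - \<phi> y"
      and nz: "\<phi> (m l k * \<Delta>) \<noteq> 0" and v: "\<forall>j\<in>J. (\<Sum>i\<in>insert k I. \<phi> (m j i) * v i) = 0"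
    have ev: "\<phi> (m j k) * v k = - (\<Sum>i\<in>I. \<phi> (m j i) * v i)" if "j \<in> J" for j
      using v[rule_format, OF that] insert.hyps by (simp add: eq_neg_iff_add_eq_0)
    have "(\<Sum>i\<in>I. \<phi> (m' j i) * v i) = 0" if "j \<in> J" for j
    proof -
      have "(\<Sum>i\<in>I. \<phi> (m' j i) * v i) =
          \<phi> (m l k) * (\<Sum>i\<in>I. \<phi> (m j i) * v i) - \<phi> (m j k) * (\<Sum>i\<in>I. \<phi> (m l i) * v i)"
        by (simp add: m'_def \<phi>m \<phi>d sum_distrib_left sum_subtractf algebra_simps)
      also have "(\<Sum>i\<in>I. \<phi> (m j i) * v i) = - (\<phi> (m j k) * v k)" using ev[OF that] by simp
      also have "(\<Sum>i\<in>I. \<phi> (m l i) * v i) = - (\<phi> (m l k) * v k)" using ev[OF l(1)] by simp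
      finally show ?thesis by (simp add: algebra_simps)
    qed
    then have z: "\<forall>i\<in>I. v i = 0" using good \<phi>m \<phi>d nz by auto
    then have "\<phi> (m l k) * v k = 0" using ev[OF l(1)] by simp
    then have "v k = 0" using nz \<phi>m by auto
    then show "\<forall>i\<in>insert k I. v i = 0" using z by auto
  qed
qed

text \<open>Injectivity with no more equations than unknowns forces surjectivity. Here the pivot row
  is removed together with the pivot column, which preserves the inequality of
  cardinalities.\<close>

lemma square_system_solvable:
  fixes m :: "'j \<Rightarrow> 'i \<Rightarrow> 'f::field"
  shows "finite I \<Longrightarrow> finite J \<Longrightarrow> card J \<le> card I \<Longrightarrow>
    (\<And>v. (\<And>j. j \<in> J \<Longrightarrow> (\<Sum>i\<in>I. m j i * v i) = 0) \<Longrightarrow> \<forall>i\<in>I. v i = 0) \<Longrightarrow>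
    \<exists>v. \<forall>j\<in>J. (\<Sum>i\<in>I. m j i * v i) = w j"
proof (induction I arbitrary: m J w rule: finite_induct)
  case empty
  then show ?case by auto
next
  case (insert k I)
  note inj = insert.prems(3)
  have "\<exists>l\<in>J. m l k \<noteq> 0"
  proof (rule ccontr)
    assume "\<not> ?thesis"
    then have z: "\<And>l. l \<in> J \<Longrightarrow> m l k = 0" by auto
    have "\<forall>i\<in>insert k I. (if i = k then 1 else (0::'f)) = 0"
    proof (rule inj)
      fix j assume "j \<in> J"
      have "(\<Sum>i\<in>insert k I. m j i * (if i = k then 1 else 0)) = m j k"
        using insert.hyps by (subst sum.insert) (auto intro!: sum.neutral)
      then show "(\<Sum>i\<in>insert k I. m j i * (if i = k then 1 else 0)) = 0"
        using z \<open>j \<in> J\<close> by simp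
    qed
    then show False by auto
  qed
  then obtain l where l: "l \<in> J" "m l k \<noteq> 0" by auto
  define m' where "m' j i = m j i - m j k / m l k * m l i" for j i
  have row: "(\<Sum>i\<in>insert k I. m j i * u i) = (\<Sum>i\<in>I. m' j i * u i) + m j k / m l k * c"
    if "(\<Sum>i\<in>insert k I. m l i * u i) = c" for j u c
    using that[symmetric] insert.hyps l(2)
    by (simp add: m'_def sum_distrib_left sum_subtractf algebra_simps)
  define ext where "ext v c i = (if i = k then (c - (\<Sum>i\<in>I. m l i * v i)) / m l k else v i)"
    for v :: "'i \<Rightarrow> 'f" and c i
  have extI: "(\<Sum>i\<in>I. x i * ext v c i) = (\<Sum>i\<in>I. x i * v i)" for x v c
    using insert.hyps by (intro sum.cong) (auto simp: ext_def)
  have extl: "(\<Sum>i\<in>insert k I. m l i * ext v c i) = c" for v c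
    using insert.hyps l(2) by (simp add: extI) (simp add: ext_def)
  have "\<forall>i\<in>I. v i = 0" if v: "\<And>j. j \<in> J - {l} \<Longrightarrow> (\<Sum>i\<in>I. m' j i * v i) = 0" for v
  proof -
    have "\<forall>i\<in>insert k I. ext v 0 i = 0"
    proof (rule inj)
      fix j assume "j \<in> J"
      then show "(\<Sum>i\<in>insert k I. m j i * ext v 0 i) = 0"
        using row[OF extl[of v 0], of j] v[of j] extl[of v 0] by (cases "j = l") (auto simp: extI)
    qed
    then show ?thesis using insert.hyps by (auto simp: ext_def split: if_splits)
  qed
  moreover have "card (J - {l}) \<le> card I"
    using insert.prems(1,2) insert.hyps l(1) by (simp add: card_Diff_singleton)
  ultimately obtain v where v: "\<forall>j\<in>J - {l}. (\<Sum>i\<in>I. m' j i * v i) = w j - m j k / m l k * w l"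
    using insert.IH[of "J - {l}" m' "\<lambda>j. w j - m j k / m l k * w l"] insert.prems(1) by auto
  have "(\<Sum>i\<in>insert k I. m j i * ext v (w l) i) = w j" if "j \<in> J" for j
    using row[OF extl[of v "w l"], of j] v that extl[of v "w l"] by (cases "j = l") (auto simp: extI)
  then show ?case by blast
qed

text \<open>A kernel vector over \<open>k[t]\<close> all of whose entries vanish at 0 is t times
  another kernel vector, so the hypothesis applies again and the vector is divisible by every power
  of t. Hence it is zero, the matrix is injective over \<open>k[t]\<close>, and elimination leaves a
  nonzero polynomial whose roots contain all bad values of t. The hypothesis speaks of kernel
  vectors over \<open>k[t]\<close>, not of the kernel of the matrix at t = 0, which may be
  larger.\<close>

lemma generic_injective:
  fixes m :: "'j \<Rightarrow> 'i \<Rightarrow> 'k::field poly"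
  assumes fin: "finite I"
    and ker: "\<And>v i. (\<And>j. j \<in> J \<Longrightarrow> (\<Sum>i\<in>I. m j i * v i) = 0) \<Longrightarrow> i \<in> I \<Longrightarrow> coeff (v i) 0 = 0"
  shows "finite {t. \<not> (\<forall>v. (\<forall>j\<in>J. (\<Sum>i\<in>I. poly (m j i) t * v i) = 0) \<longrightarrow> (\<forall>i\<in>I. v i = 0))}"
proof -
  have all: "coeff (v i) n = 0"
    if "\<And>j. j \<in> J \<Longrightarrow> (\<Sum>i\<in>I. m j i * v i) = 0" "i \<in> I" for v i n
    using that
  proof (induction n arbitrary: v)
    case 0
    then show ?case using ker by blast
  next
    case (Suc n)
    define w where "w i = poly_shift 1 (v i)" for i
    have vw: "v i = pCons 0 (w i)" if "i \<in> I" for i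
      using ker[OF Suc.prems(1) that] by (intro poly_eqI) (simp add: w_def coeff_poly_shift coeff_pCons split: nat.splits)
    have "(\<Sum>i\<in>I. m j i * w i) = 0" if "j \<in> J" for j
    proof -
      have "0 = (\<Sum>i\<in>I. m j i * v i)" using Suc.prems(1)[OF that] by simp
      also have "\<dots> = (\<Sum>i\<in>I. [:0, 1:] * (m j i * w i))"
        by (intro sum.cong refl) (simp add: vw)
      also have "\<dots> = [:0, 1:] * (\<Sum>i\<in>I. m j i * w i)" by (simp only: sum_distrib_left)
      finally show ?thesis by simp
    qed
    then have "coeff (w i) n = 0" using Suc.IH Suc.prems(2) by blast
    then show ?case using vw[OF Suc.prems(2)] by simp
  qed
  have "\<exists>\<Delta> (\<gamma>::unit). True \<and> \<Delta> \<noteq> 0 \<and>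
       (\<forall>\<phi> :: 'k poly \<Rightarrow> 'k. (\<forall>x y. \<phi> (x * y) = \<phi> x * \<phi> y) \<longrightarrow> (\<forall>x y. \<phi> (x - y) = \<phi> x - \<phi> y) \<longrightarrow>
          \<phi> \<Delta> \<noteq> 0 \<longrightarrow>
          (\<forall>v. (\<forall>j\<in>J. (\<Sum>i\<in>I. \<phi> (m j i) * v i) = 0) \<longrightarrow> (\<forall>i\<in>I. v i = 0)))"
    by (rule fraction_free_elimination[where H = "\<lambda>_ _. True" and \<psi> = "\<lambda>x. x"
          and pl = "\<lambda>_ _. ()" and J = J and I = I and m = m])
       (use fin all in \<open>auto intro!: poly_eqI\<close>)
  then obtain \<Delta> where \<Delta>: "\<Delta> \<noteq> 0" "\<And>\<phi> :: 'k poly \<Rightarrow> 'k. (\<forall>x y. \<phi> (x * y) = \<phi> x * \<phi> y) \<Longrightarrow>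
       (\<forall>x y. \<phi> (x - y) = \<phi> x - \<phi> y) \<Longrightarrow> \<phi> \<Delta> \<noteq> 0 \<Longrightarrow>
          (\<forall>v. (\<forall>j\<in>J. (\<Sum>i\<in>I. \<phi> (m j i) * v i) = 0) \<longrightarrow> (\<forall>i\<in>I. v i = 0))" by auto
  have "finite {t. poly \<Delta> t = 0}" using \<Delta>(1) by (rule poly_roots_finite)
  moreover have "{t. \<not> (\<forall>v. (\<forall>j\<in>J. (\<Sum>i\<in>I. poly (m j i) t * v i) = 0) \<longrightarrow> (\<forall>i\<in>I. v i = 0))}
      \<subseteq> {t. poly \<Delta> t = 0}"
  proof
    fix t assume "t \<in> {t. \<not> (\<forall>v. (\<forall>j\<in>J. (\<Sum>i\<in>I. poly (m j i) t * v i) = 0) \<longrightarrow> (\<forall>i\<in>I. v i = 0))}"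
    then show "t \<in> {t. poly \<Delta> t = 0}" using \<Delta>(2)[of "\<lambda>p. poly p t"] by auto
  qed
  ultimately show ?thesis by (rule finite_subset[rotated])
qed

section \<open>Rigid polynomials: absence of short relations modulo x^h\<close>

lemma map_poly_mult_hom:
  assumes "\<phi> 0 = 0" "\<And>x y. \<phi> (x + y) = \<phi> x + \<phi> y" "\<And>x y. \<phi> (x * y) = \<phi> x * \<phi> y"
  shows "map_poly \<phi> (p * q) = map_poly \<phi> p * map_poly \<phi> (q :: 'a::comm_semiring_0 poly)"
proof (rule poly_eqI)
  fix n
  have s: "\<phi> (sum f A) = (\<Sum>x\<in>A. \<phi> (f x))" for f :: "nat \<Rightarrow> 'a" and A
    by (induction A rule: infinite_finite_induct) (auto simp: assms)
  show "coeff (map_poly \<phi> (p * q)) n = coeff (map_poly \<phi> p * map_poly \<phi> q) n"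
    by (simp add: coeff_map_poly assms coeff_mult s)
qed

lemma map_poly_add_hom:
  assumes "\<phi> 0 = 0" "\<And>x y. \<phi> (x + y) = \<phi> x + \<phi> y"
  shows "map_poly \<phi> (p + q) = map_poly \<phi> p + map_poly \<phi> q"
  by (rule poly_eqI) (simp add: coeff_map_poly assms)

lemma map_poly_sum_hom:
  assumes "\<phi> 0 = 0" "\<And>x y. \<phi> (x + y) = \<phi> x + \<phi> y"
  shows "map_poly \<phi> (sum f A) = (\<Sum>x\<in>A. map_poly \<phi> (f x))"
  by (induction A rule: infinite_finite_induct) (auto simp: map_poly_add_hom[OF assms])

lemma map_poly_power_hom:
  fixes p :: "'a::comm_semiring_1 poly" and \<phi> :: "'a \<Rightarrow> 'b::comm_semiring_1"
  assumes "\<phi> 0 = 0" "\<phi> 1 = 1" "\<And>x y. \<phi> (x + y) = \<phi> x + \<phi> y" "\<And>x y. \<phi> (x * y) = \<phi> x * \<phi> y"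
  shows "map_poly \<phi> (p ^ n) = map_poly \<phi> p ^ n"
  by (induction n) (auto simp: map_poly_mult_hom[OF assms(1,3,4)] assms map_poly_1')

lemma coeff_mult_monom_right:
  "coeff (q * monom a i) j = (if j < i then 0 else coeff q (j - i) * (a :: 'a::comm_semiring_0))"
  by (metis coeff_monom_mult mult.commute)

text \<open>Read modulo x^h: no nontrivial combination of powers of A with coefficients of the
  prescribed lengths is divisible by x^h with a quotient of length at most \<open>G\<close>. The
  induction on the degree of A raises \<open>G\<close>.\<close>

definition rigid :: "'k::field poly \<Rightarrow> nat \<Rightarrow> nat \<Rightarrow> nat \<Rightarrow> (nat \<Rightarrow> nat) \<Rightarrow> bool"
  where "rigid A h G \<mu> len \<longleftrightarrow> (\<forall>c f. (\<forall>i\<ge>G. coeff c i = 0) \<longrightarrow>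
     (\<forall>m\<le>\<mu>. \<forall>i\<ge>len m. coeff (f m) i = 0) \<longrightarrow>
     monom 1 h * c = (\<Sum>m\<le>\<mu>. A ^ m * f m) \<longrightarrow> c = 0 \<and> (\<forall>m\<le>\<mu>. f m = 0))"

abbreviation at0 :: "'k::field poly poly \<Rightarrow> 'k poly"
  where "at0 \<equiv> map_poly (\<lambda>p. coeff p 0)"

lemmas at0_hom [simp] =
  map_poly_add_hom[where \<phi> = "\<lambda>p. coeff p 0", simplified]
  map_poly_sum_hom[where \<phi> = "\<lambda>p. coeff p 0", simplified]
  map_poly_mult_hom[where \<phi> = "\<lambda>p. coeff p 0", simplified coeff_mult_0, simplified]
  map_poly_power_hom[where \<phi> = "\<lambda>p. coeff p 0", simplified coeff_mult_0, simplified]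

text \<open>The inner variable of \<open>'k poly poly\<close> is the parameter, the outer one is \<open>x\<close>.\<close>

lemma rigid_generic:
  fixes A :: "'k::field poly"
  assumes "\<And>c f. (\<forall>i\<ge>G. coeff c i = 0) \<Longrightarrow> (\<forall>m\<le>\<mu>. \<forall>i\<ge>len m. coeff (f m) i = 0) \<Longrightarrow>
     monom 1 h * c = (\<Sum>m\<le>\<mu>. ([:1, [:0, -1:]:] * map_poly (\<lambda>a. [:a:]) A) ^ m * f m) \<Longrightarrow>
     at0 c = 0 \<and> (\<forall>m\<le>\<mu>. at0 (f m) = 0)"
  shows "finite {\<epsilon>. \<not> rigid ([:1, -\<epsilon>:] * A) h G \<mu> len}"
proof -
  define AA where "AA = [:1, [:0, -1:]:] * map_poly (\<lambda>a. [:a:]) A"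
  \<comment> \<open>The unknowns are the coefficients of \<open>c\<close> (block 0) and of the
    \<open>f m\<close> (block \<open>Suc m\<close>); the equations are the coefficients of x^j for
    all j.\<close>
  define P where "P s = (case s of 0 \<Rightarrow> - monom 1 h | Suc m \<Rightarrow> AA ^ m)" for s
  define ln where "ln s = (case s of 0 \<Rightarrow> G | Suc m \<Rightarrow> len m)" for s
  define I where "I = (SIGMA s : {..Suc \<mu>}. {..<ln s})"
  define m where "m j si = (case si of (s, i) \<Rightarrow> coeff (monom 1 i * P s) j)" for j :: nat and si
  have ev: "map_poly (\<lambda>p. poly p \<epsilon>) AA = [:1, -\<epsilon>:] * A" for \<epsilon>
  proof -
    have "map_poly (\<lambda>p. poly p \<epsilon>) (map_poly (\<lambda>a. [:a:]) A) = A"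
      by (subst map_poly_map_poly) (auto simp: o_def)
    then show ?thesis unfolding AA_def
      by (subst map_poly_mult_hom) (auto simp: map_poly_pCons)
  qed
  have "finite {t. \<not> (\<forall>v. (\<forall>j\<in>UNIV. (\<Sum>i\<in>I. poly (m j i) t * v i) = 0) \<longrightarrow> (\<forall>i\<in>I. v i = 0))}"
  proof (rule generic_injective)
    show "finite I" by (simp add: I_def)
    fix v :: "nat \<times> nat \<Rightarrow> 'k poly" and si
    assume v: "\<And>j. j \<in> UNIV \<Longrightarrow> (\<Sum>i\<in>I. m j i * v i) = 0" and si: "si \<in> I"
    define u where "u s = (\<Sum>i<ln s. monom (v (s, i)) i)" for s
    have cu: "coeff (u s) i = (if i < ln s then v (s, i) else 0)" for s i
      by (simp add: u_def coeff_sum)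
    have "coeff (\<Sum>s\<le>Suc \<mu>. P s * u s) j = 0" for j
    proof -
      have "0 = (\<Sum>si\<in>I. m j si * v si)" using v by simp
      also have "\<dots> = (\<Sum>(s, i)\<in>I. coeff (monom 1 i * P s) j * v (s, i))"
        by (intro sum.cong) (auto simp: m_def)
      also have "\<dots> = (\<Sum>s\<le>Suc \<mu>. \<Sum>i<ln s. coeff (monom 1 i * P s) j * v (s, i))"
        unfolding I_def by (rule sum.Sigma[symmetric]) auto
      also have "\<dots> = (\<Sum>s\<le>Suc \<mu>. \<Sum>i<ln s. coeff (P s * monom (v (s, i)) i) j)"
        by (intro sum.cong refl) (simp add: coeff_monom_mult mult.commute[of "P _"])
      also have "\<dots> = coeff (\<Sum>s\<le>Suc \<mu>. P s * u s) j"
        by (simp add: u_def coeff_sum sum_distrib_left)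
      finally show ?thesis by simp
    qed
    then have "(\<Sum>s\<le>Suc \<mu>. P s * u s) = 0" by (intro poly_eqI) simp
    then have "monom 1 h * u 0 = (\<Sum>m\<le>\<mu>. AA ^ m * u (Suc m))"
      by (subst (asm) sum.atMost_Suc_shift) (simp add: P_def)
    then have "at0 (u 0) = 0 \<and> (\<forall>m\<le>\<mu>. at0 (u (Suc m)) = 0)"
      unfolding AA_def by (intro assms) (auto simp: cu ln_def)
    moreover obtain s i where "si = (s, i)" "s \<le> Suc \<mu>" "i < ln s" using si by (auto simp: I_def)
    ultimately have "at0 (u s) = 0" by (cases s) auto
    then have "coeff (at0 (u s)) i = 0" by simp
    then show "coeff (v si) 0 = 0" using \<open>si = (s, i)\<close> \<open>i < ln s\<close> by (simp add: coeff_map_poly cu)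
  qed
  moreover have "{\<epsilon>. \<not> rigid ([:1, -\<epsilon>:] * A) h G \<mu> len} \<subseteq>
      {t. \<not> (\<forall>v. (\<forall>j\<in>UNIV. (\<Sum>i\<in>I. poly (m j i) t * v i) = 0) \<longrightarrow> (\<forall>i\<in>I. v i = 0))}"
  proof (intro subsetI CollectI notI)
    fix t assume t: "t \<in> {\<epsilon>. \<not> rigid ([:1, -\<epsilon>:] * A) h G \<mu> len}"
    assume inj: "\<forall>v. (\<forall>j\<in>UNIV. (\<Sum>i\<in>I. poly (m j i) t * v i) = 0) \<longrightarrow> (\<forall>i\<in>I. v i = 0)"
    have "rigid ([:1, -t:] * A) h G \<mu> len"
      unfolding rigid_def
    proof (intro allI impI)
      fix c f assume c: "\<forall>i\<ge>G. coeff c i = 0" and f: "\<forall>m\<le>\<mu>. \<forall>i\<ge>len m. coeff (f m) i = 0"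
        and eq: "monom 1 h * c = (\<Sum>m\<le>\<mu>. ([:1, -t:] * A) ^ m * f m)"
      define u where "u s = (case s of 0 \<Rightarrow> c | Suc m \<Rightarrow> f m)" for s
      define p where "p s = map_poly (\<lambda>p. poly p t) (P s)" for s
      have cu: "coeff (u s) i = 0" if "s \<le> Suc \<mu>" "i \<ge> ln s" for s i
        using that c f by (cases s) (auto simp: u_def ln_def)
      have mo: "(\<Sum>i<ln s. monom (coeff (u s) i) i) = u s" if "s \<le> Suc \<mu>" for s
        using cu[OF that] by (intro poly_eqI) (simp add: coeff_sum)
      have p0: "p 0 = - monom 1 h"
        by (rule poly_eqI) (simp add: p_def P_def coeff_map_poly)
      have ps: "p (Suc n) = ([:1, -t:] * A) ^ n" for n
        unfolding p_def P_def nat.case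
        by (subst map_poly_power_hom) (auto simp: ev)
      have zero: "(\<Sum>s\<le>Suc \<mu>. p s * u s) = 0"
        by (subst sum.atMost_Suc_shift) (simp only: p0 ps u_def nat.case eq[symmetric], simp)
      have "\<forall>si\<in>I. (case si of (s, i) \<Rightarrow> coeff (u s) i) = 0"
      proof (rule inj[THEN spec, THEN mp], intro ballI)
        fix j
        have "(\<Sum>si\<in>I. poly (m j si) t * (case si of (s, i) \<Rightarrow> coeff (u s) i)) =
          (\<Sum>(s, i)\<in>I. poly (coeff (monom 1 i * P s) j) t * coeff (u s) i)"
          by (intro sum.cong) (auto simp: m_def)
        also have "\<dots> =
          (\<Sum>s\<le>Suc \<mu>. \<Sum>i<ln s. poly (coeff (monom 1 i * P s) j) t * coeff (u s) i)"
          unfolding I_def by (rule sum.Sigma[symmetric]) auto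
        also have "\<dots> = (\<Sum>s\<le>Suc \<mu>. \<Sum>i<ln s. coeff (p s * monom (coeff (u s) i) i) j)"
          by (intro sum.cong refl) (simp add: coeff_monom_mult coeff_mult_monom_right p_def coeff_map_poly)
        also have "\<dots> = (\<Sum>s\<le>Suc \<mu>. coeff (p s * (\<Sum>i<ln s. monom (coeff (u s) i) i)) j)"
          by (simp add: sum_distrib_left coeff_sum)
        also have "\<dots> = (\<Sum>s\<le>Suc \<mu>. coeff (p s * u s) j)" by (intro sum.cong refl) (simp add: mo)
        also have "\<dots> = coeff (\<Sum>s\<le>Suc \<mu>. p s * u s) j" by (simp add: coeff_sum)
        finally show "(\<Sum>si\<in>I. poly (m j si) t * (case si of (s, i) \<Rightarrow> coeff (u s) i)) = 0"
          by (simp only: zero coeff_0)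
      qed
      then have "coeff (u s) i = 0" if "s \<le> Suc \<mu>" for s i
        using that cu[of s i] by (cases "i < ln s") (auto simp: I_def)
      then have "u s = 0" if "s \<le> Suc \<mu>" for s using that by (intro poly_eqI) auto
      from this[of 0] this[of "Suc _"] show "c = 0 \<and> (\<forall>m\<le>\<mu>. f m = 0)" by (auto simp: u_def)
    qed
    then show False using t by simp
  qed
  ultimately show ?thesis by (rule finite_subset[rotated])
qed

lemma at0_diff: "at0 (p - q) = at0 p - at0 q"
  by (rule poly_eqI) (simp add: coeff_map_poly)

lemma degree_le_iff_coeff: "degree p \<le> n \<longleftrightarrow> (\<forall>i>n. coeff p i = 0)"
  by (auto intro: degree_le coeff_eq_0)

lemma coeff_zero_below_eq_0: "(\<forall>i\<ge>0. coeff p i = 0) \<Longrightarrow> p = 0"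
  by (simp add: poly_eq_iff)

lemma degree_power_mult_le:
  fixes A :: "'a::idom poly"
  assumes "degree A \<le> \<kappa>" "\<forall>i>l. coeff f i = 0"
  shows "degree (A ^ m * f) \<le> \<kappa> * m + l"
proof -
  have "degree f \<le> l" using assms(2) by (simp add: degree_le_iff_coeff)
  then have "degree (A ^ m * f) \<le> degree (A ^ m) + l" using degree_mult_le[of "A^m" f] by linarith
  also have "\<dots> \<le> \<kappa> * m + l" using degree_power_le[of A m] assms(1)
    using mult_le_mono1[of "degree A" \<kappa> m] by linarith
  finally show ?thesis .
qed

text \<open>The new factor 1 - \<epsilon> x raises the degree of A by one. The last term of the
  relation contains (1 - \<epsilon> x)^n with n = \<open>Suc \<mu>\<close>, so its cofactor has
  degree n less than the whole relation. At \<epsilon> = 0 this factor disappears, and the n top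
  coefficients of \<open>c\<close> disappear with it; what remains is an instance of
  \<open>IH\<close>. Only degrees are compared, hence the independence of the
  characteristic.\<close>

lemma rigid_step:
  fixes A :: "'k::field poly"
  assumes deg: "degree A = \<kappa>" and \<kappa>: "\<kappa> = Suc \<mu> + e"
    and IH: "\<And>L. rigid A h G \<mu> (\<lambda>m. if m < \<mu> then Suc (m + e) else L)"
    and h: "(Suc \<kappa>) * Suc \<mu> \<le> h + (G + Suc \<mu>)"
  shows "finite {\<epsilon>. \<not> rigid ([:1, -\<epsilon>:] * A) h (G + Suc \<mu>) (Suc \<mu>)
           (\<lambda>m. if m < Suc \<mu> then Suc (m + e) else L)}"
proof (rule rigid_generic)
  fix c and f :: "nat \<Rightarrow> 'k poly poly"
  define AA where "AA = map_poly (\<lambda>a. [:a:]) A"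
  define B where "B = [:1, [:0, -1:]:] * AA"
  define n where "n = Suc \<mu>"
  assume c: "\<forall>i\<ge>G + Suc \<mu>. coeff c i = 0"
    and f: "\<forall>m\<le>Suc \<mu>. \<forall>i\<ge>(if m < Suc \<mu> then Suc (m + e) else L). coeff (f m) i = 0"
    and eq: "monom 1 h * c = (\<Sum>m\<le>Suc \<mu>. ([:1, [:0, -1:]:] * map_poly (\<lambda>a. [:a:]) A) ^ m * f m)"
  have fm: "\<forall>i>m+e. coeff (f m) i = 0" if "m < n" for m
    using f[rule_format, of m] that by (auto simp: n_def)
  have A0: "A \<noteq> 0" using deg \<kappa> by auto
  have degAA: "degree AA \<le> \<kappa>" unfolding AA_def using deg map_poly_degree_leq[of "\<lambda>a. [:a:]" A] by simp
  have at0AA: "at0 AA = A" unfolding AA_def by (subst map_poly_map_poly) (auto simp: o_def)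
  have at0x: "at0 (monom 1 h) = monom (1::'k) h" by (subst map_poly_monom) auto
  have at0l: "at0 [:1, [:0, -1:]:] = (1 :: 'k poly)" by (simp add: map_poly_pCons)
  have at0B: "at0 B = A" by (simp only: B_def at0_hom at0l at0AA mult_1)
  have degB: "degree B \<le> Suc \<kappa>"
    unfolding B_def using degAA degree_mult_le[of "[:1, [:0, -1:]:]" AA] by simp
  \<comment> \<open>An upper bound for the degree of x^h c and of all terms except the last.\<close>
  define D where "D = h + G + n - 1"
  define R where "R = monom 1 h * c - (\<Sum>m<n. B ^ m * f m)"
  have Req: "R = [:1, [:0, -1:]:] ^ n * (AA ^ n * f n)"
  proof -
    have "(\<Sum>m\<le>Suc \<mu>. B ^ m * f m) = (\<Sum>m<n. B ^ m * f m) + B ^ n * f n"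
      unfolding n_def by (simp add: lessThan_Suc_atMost)
    then have "R = B ^ n * f n" unfolding R_def using eq[folded AA_def, folded B_def] by simp
    then show ?thesis by (simp only: B_def power_mult_distrib mult.assoc)
  qed
  have h': "Suc \<kappa> * n \<le> D + 1" "n \<le> D" "D - n + 1 = h + G" "1 \<le> h + G"
  proof -
    have "Suc \<kappa> * n \<ge> 2 * n" using \<kappa> by (intro mult_le_mono1) simp
    moreover have "Suc \<kappa> * n \<le> h + G + n" using h by (simp add: n_def)
    moreover have "n \<ge> 1" by (simp add: n_def)
    ultimately show "Suc \<kappa> * n \<le> D + 1" "n \<le> D" "D - n + 1 = h + G" "1 \<le> h + G" unfolding D_def by linarith+
  qed
  have low1: "degree (\<Sum>m<n. B ^ m * f m) \<le> D"
  proof (rule degree_sum_le)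
    fix m assume m: "m \<in> {..<n}"
    then have "degree (B ^ m * f m) \<le> Suc \<kappa> * m + (m + e)"
      using fm degB by (intro degree_power_mult_le) auto
    also have "\<dots> \<le> Suc \<kappa> * \<mu> + (\<mu> + e)" using m by (intro add_mono mult_le_mono2) (auto simp: n_def)
    also have "\<dots> \<le> D" using h'(1) \<kappa> unfolding n_def by simp
    finally show "degree (B ^ m * f m) \<le> D" .
  qed auto
  have "degree c < G + n \<or> c = 0"
    using c[rule_format, of "degree c"] unfolding n_def by (cases "degree c < G + Suc \<mu>") auto
  then have low2: "degree (monom 1 h * c) \<le> D"
    using degree_mult_le[of "monom 1 h" c] degree_monom_le[of "1 :: 'k poly" h] unfolding D_def by auto
  have degR: "degree R \<le> D" unfolding R_def using low1 low2 by (intro degree_diff_le)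
  have degQ: "degree (AA ^ n * f n) \<le> D - n"
  proof (cases "AA ^ n * f n = 0")
    case False
    have "degree R = n + degree (AA ^ n * f n)"
      unfolding Req using False by (subst degree_mult_eq) (auto simp: degree_power_eq)
    then show ?thesis using degR by simp
  next
    case True
    show ?thesis unfolding True by simp
  qed
  define cc where "cc = at0 c"
  define ff where "ff m = at0 (f m)" for m
  have ffm: "\<forall>i>m+e. coeff (ff m) i = 0" if "m < n" for m
    using fm[OF that] by (simp add: ff_def coeff_map_poly)
  have at0R: "at0 R = A ^ n * ff n" unfolding Req by (simp add: at0l at0AA ff_def)
  have degR0: "degree (at0 R) \<le> D - n"
    unfolding at0R ff_def using degQ map_poly_degree_leq[of "\<lambda>p. coeff p 0" "AA ^ n * f n"]
    by (simp add: at0AA)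
  have at0R': "at0 R = monom 1 h * cc - (\<Sum>m<n. A ^ m * ff m)"
    unfolding R_def cc_def ff_def by (subst at0_diff) (simp add: at0x at0B)
  have low3: "degree (\<Sum>m<n. A ^ m * ff m) \<le> D - n"
  proof (rule degree_sum_le)
    fix m assume m: "m \<in> {..<n}"
    then have "degree (A ^ m * ff m) \<le> \<kappa> * m + (m + e)"
      using ffm deg by (intro degree_power_mult_le) auto
    also have "\<dots> \<le> \<kappa> * \<mu> + (\<mu> + e)" using m by (intro add_mono mult_le_mono2) (auto simp: n_def)
    also have "\<dots> \<le> D - n" using h'(1) \<kappa> unfolding n_def by simp
    finally show "degree (A ^ m * ff m) \<le> D - n" .
  qed auto
  have "degree (monom 1 h * cc) \<le> D - n"
  proof -
    have "monom 1 h * cc = at0 R + (\<Sum>m<n. A ^ m * ff m)" by (simp add: at0R')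
    then show ?thesis using degR0 low3 by (simp add: degree_add_le)
  qed
  then have cc: "\<forall>i\<ge>G. coeff cc i = 0"
  proof (intro allI impI)
    fix i assume d: "degree (monom 1 h * cc) \<le> D - n" and i: "i \<ge> G"
    have "coeff (monom 1 h * cc) (h + i) = 0" using d i h' by (intro coeff_eq_0) linarith
    then show "coeff cc i = 0" by (simp add: coeff_monom_mult)
  qed
  \<comment> \<open>At \<epsilon> = 0 the last two terms merge: A^n f_n is absorbed into the
    coefficient of A^\<mu>. This is why the last length must be arbitrary in
    \<open>IH\<close>.\<close>
  define gg where "gg m = (if m < \<mu> then ff m else ff \<mu> + A * ff n)" for m
  have "cc = 0 \<and> (\<forall>m\<le>\<mu>. gg m = 0)"
  proof (rule IH[of "Suc (degree (gg \<mu>))", unfolded rigid_def, rule_format])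
    show "coeff cc i = 0" if "G \<le> i" for i using cc that by blast
    show "coeff (gg m) i = 0" if "m \<le> \<mu>" "(if m < \<mu> then Suc (m + e) else Suc (degree (gg \<mu>))) \<le> i" for m i
    proof (cases "m < \<mu>")
      case True
      then show ?thesis using that ffm[of m] by (simp add: gg_def n_def)
    next
      case False
      then show ?thesis using that by (auto intro!: coeff_eq_0)
    qed
    have "monom 1 h * cc = (\<Sum>m<n. A ^ m * ff m) + A ^ n * ff n" using at0R at0R' by (simp add: algebra_simps)
    also have "\<dots> = (\<Sum>m<\<mu>. A ^ m * gg m) + A ^ \<mu> * gg \<mu>" by (simp add: n_def gg_def algebra_simps)
    also have "\<dots> = (\<Sum>m\<le>\<mu>. A ^ m * gg m)" by (simp flip: lessThan_Suc_atMost)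
    finally show "monom 1 h * cc = (\<Sum>m\<le>\<mu>. A ^ m * gg m)" .
  qed
  then have gz: "cc = 0" "\<And>m. m \<le> \<mu> \<Longrightarrow> gg m = 0" by auto
  have z: "cc = 0" "ff m = 0" if "m < \<mu>" for m
    using gz(1) gz(2)[of m] that by (simp_all add: gg_def)
  have z3: "ff \<mu> + A * ff n = 0" using gz(2)[of \<mu>] by (simp add: gg_def)
  \<comment> \<open>The merged coefficient splits again, because f_\<mu> has smaller degree than
    A.\<close>
  have "ff n = 0"
  proof (rule ccontr)
    assume nz: "ff n \<noteq> 0"
    have "degree (A * ff n) \<ge> \<kappa>" using A0 nz deg by (simp add: degree_mult_eq)
    moreover have "degree (A * ff n) = degree (ff \<mu>)" using z3
      by (simp add: add_eq_0_iff)
    moreover have "degree (ff \<mu>) \<le> \<mu> + e" using ffm[of \<mu>] by (simp add: degree_le_iff_coeff n_def)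
    ultimately show False using \<kappa> by simp
  qed
  then have "ff \<mu> = 0" using z3 by simp
  then have "ff m = 0" if "m \<le> Suc \<mu>" for m
    using that z(2)[of m] \<open>ff n = 0\<close> unfolding n_def by (cases "m = Suc \<mu>"; cases "m = \<mu>") auto
  then show "at0 c = 0 \<and> (\<forall>m\<le>Suc \<mu>. at0 (f m) = 0)" using gz(1) by (simp add: cc_def ff_def)
qed

text \<open>The lengths of all other terms bound the degree of the last one, so a single large
  \<open>M\<close> covers every \<open>L\<close>. Thus the exceptional parameters for all
  \<open>L\<close> together form a finite set.\<close>

lemma rigid_unbounded:
  fixes A :: "'k::field poly"
  assumes r: "\<And>L. L = M \<Longrightarrow> rigid A h G \<mu> (\<lambda>m. if m < \<mu> then len m else L)" and A: "A \<noteq> 0"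
    and M: "M > h + G" "\<And>m. m < \<mu> \<Longrightarrow> M > degree A * m + len m"
  shows "rigid A h G \<mu> (\<lambda>m. if m < \<mu> then len m else L)"
  unfolding rigid_def
proof (intro allI impI)
  fix c and f :: "nat \<Rightarrow> 'k poly"
  assume c: "\<forall>i\<ge>G. coeff c i = 0"
    and f: "\<forall>m\<le>\<mu>. \<forall>i\<ge>(if m < \<mu> then len m else L). coeff (f m) i = 0"
    and eq: "monom 1 h * c = (\<Sum>m\<le>\<mu>. A ^ m * f m)"
  have fm: "\<forall>i\<ge>len m. coeff (f m) i = 0" if "m < \<mu>" for m
    using f[rule_format, of m] that by auto
  have "A ^ \<mu> * f \<mu> = monom 1 h * c - (\<Sum>m<\<mu>. A ^ m * f m)"
    using eq by (simp flip: lessThan_Suc_atMost)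
  moreover have "degree (\<Sum>m<\<mu>. A ^ m * f m) \<le> M - 1"
  proof (rule degree_sum_le)
    fix m assume "m \<in> {..<\<mu>}"
    then have "degree (A ^ m * f m) \<le> degree A * m + len m" "M > degree A * m + len m"
      using fm M by (auto intro!: degree_power_mult_le)
    then show "degree (A ^ m * f m) \<le> M - 1" by simp
  qed auto
  moreover have "degree c < G \<or> c = 0" using c by (metis leading_coeff_0_iff linorder_not_le)
  then have "degree (monom 1 h * c) \<le> M - 1"
    using degree_mult_le[of "monom 1 h" c] degree_monom_le[of "1 :: 'k" h] M(1) by auto
  ultimately have d: "degree (A ^ \<mu> * f \<mu>) \<le> M - 1" by (simp add: degree_diff_le)
  have "degree (f \<mu>) \<le> M - 1"
    using d A by (cases "f \<mu> = 0") (auto simp: degree_mult_eq)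
  then have "\<forall>i\<ge>M. coeff (f \<mu>) i = 0" using M(1) by (auto intro!: coeff_eq_0)
  then have "\<forall>m\<le>\<mu>. \<forall>i\<ge>(if m < \<mu> then len m else M). coeff (f m) i = 0"
    using fm by (auto simp: le_less)
  then show "c = 0 \<and> (\<forall>m\<le>\<mu>. f m = 0)" using r[OF refl] c eq unfolding rigid_def by blast
qed

section \<open>Jets of polynomials along a rational curve\<close>

definition tri :: "nat \<Rightarrow> nat"
  where "tri n = n * Suc n div 2"

lemma tri_0 [simp]: "tri 0 = 0"
  by (simp add: tri_def)

lemma tri_double: "2 * tri n = n * Suc n"
  unfolding tri_def by (rule dvd_mult_div_cancel) simp

lemma tri_Suc: "tri (Suc n) = tri n + Suc n"
proof -
  have "2 * tri (Suc n) = 2 * (tri n + Suc n)"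
    unfolding distrib_left tri_double by simp
  then show ?thesis by (simp only: mult_left_cancel[OF zero_neq_numeral[symmetric]])
qed

text \<open>The digits are A-adic: those below index \<mu> have bounded length, and the last one
  collects all higher digits. \<open>tri \<mu>\<close> is the sum of the increments of
  \<open>G\<close> in the steps that lead up to \<mu>.\<close>

definition digit_rigid :: "'k::field poly \<Rightarrow> nat \<Rightarrow> nat \<Rightarrow> nat \<Rightarrow> bool"
  where "digit_rigid A \<mu> e h \<longleftrightarrow> (\<forall>L. rigid A h (tri \<mu>) \<mu> (\<lambda>m. if m < \<mu> then Suc (m + e) else L))"

lemma digit_rigid_0: "digit_rigid A 0 e h"
  unfolding digit_rigid_def rigid_def tri_0
proof (intro allI impI)
  fix L c f assume "\<forall>i\<ge>0. coeff c i = 0" and "monom 1 h * c = (\<Sum>m\<le>0. A ^ m * f m)"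
  then show "c = 0 \<and> (\<forall>m\<le>0. f m = 0)" using coeff_zero_below_eq_0[of c] by auto
qed

text \<open>The index \<kappa> - e is truncated at 0, where the claim is trivial. The value
  \<epsilon> = 0 is excluded as well, because the degree has to rise.\<close>

lemma digit_rigid_step:
  fixes A :: "'k::field poly"
  assumes deg: "degree A = \<kappa>" and r: "digit_rigid A (\<kappa> - 1 - e) e h" and h: "\<kappa> * Suc \<kappa> \<le> 2 * h"
  shows "finite {\<epsilon>. \<epsilon> = 0 \<or> \<not> digit_rigid ([:1, -\<epsilon>:] * A) (\<kappa> - e) e h}"
proof (cases "\<kappa> \<le> e")
  case True
  then show ?thesis by (simp add: digit_rigid_0)
next
  case False
  define \<mu> where "\<mu> = \<kappa> - 1 - e"
  have \<kappa>: "\<kappa> = Suc \<mu> + e" "\<kappa> - e = Suc \<mu>" using False by (auto simp: \<mu>_def)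
  define M where "M = Suc (Suc (h + tri (Suc \<mu>) + Suc \<kappa> * Suc \<kappa> + \<kappa> + e))"
  \<comment> \<open>Twice the left side is (\<kappa> - e)(\<kappa> + e + 1) + (\<mu> + 1)(\<mu> +
    2). The first summand is at most \<kappa> (\<kappa> + 1), hence at most 2 h.\<close>
  have bound: "Suc \<kappa> * Suc \<mu> \<le> h + (tri \<mu> + Suc \<mu>)"
  proof -
    have "(\<kappa> - e) * Suc (\<kappa> + e) \<le> \<kappa> * Suc \<kappa>"
      using False by (auto simp: \<kappa>(1) algebra_simps)
    then have "2 * (Suc \<kappa> * Suc \<mu>) \<le> 2 * h + \<mu> * Suc \<mu> + 2 * Suc \<mu>"
      using h unfolding \<kappa> by (simp add: algebra_simps)
    then have "2 * (Suc \<kappa> * Suc \<mu>) \<le> 2 * (h + (tri \<mu> + Suc \<mu>))"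
      unfolding distrib_left tri_double by simp
    then show ?thesis by (simp only: nat_mult_le_cancel_disj)
  qed
  have "finite {\<epsilon>. \<not> rigid ([:1, -\<epsilon>:] * A) h (tri \<mu> + Suc \<mu>) (Suc \<mu>)
           (\<lambda>m. if m < Suc \<mu> then Suc (m + e) else M)}"
    by (rule rigid_step[OF deg \<kappa>(1) _ bound]) (use r in \<open>auto simp: digit_rigid_def \<mu>_def\<close>)
  then have "finite (insert 0 {\<epsilon>. \<not> rigid ([:1, -\<epsilon>:] * A) h (tri (Suc \<mu>)) (Suc \<mu>)
           (\<lambda>m. if m < Suc \<mu> then Suc (m + e) else M)})" by (simp only: tri_Suc finite_insert)
  moreover have "{\<epsilon>. \<epsilon> = 0 \<or> \<not> digit_rigid ([:1, -\<epsilon>:] * A) (\<kappa> - e) e h} \<subseteq>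
     insert 0 {\<epsilon>. \<not> rigid ([:1, -\<epsilon>:] * A) h (tri (Suc \<mu>)) (Suc \<mu>)
           (\<lambda>m. if m < Suc \<mu> then Suc (m + e) else M)}"
  proof (intro subsetI, rule ccontr)
    fix t assume t: "t \<in> {\<epsilon>. \<epsilon> = 0 \<or> \<not> digit_rigid ([:1, -\<epsilon>:] * A) (\<kappa> - e) e h}"
    assume "t \<notin> insert 0 {\<epsilon>. \<not> rigid ([:1, -\<epsilon>:] * A) h (tri (Suc \<mu>)) (Suc \<mu>)
           (\<lambda>m. if m < Suc \<mu> then Suc (m + e) else M)}"
    then have t0: "t \<noteq> 0" and rt: "rigid ([:1, -t:] * A) h (tri (Suc \<mu>)) (Suc \<mu>)
           (\<lambda>m. if m < Suc \<mu> then Suc (m + e) else M)" by blast+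
    have A: "A \<noteq> 0" using deg \<kappa> by auto
    then have dA: "degree ([:1, -t:] * A) = Suc \<kappa>"
      using t0 deg by (subst degree_mult_eq) auto
    have "digit_rigid ([:1, -t:] * A) (Suc \<mu>) e h"
      unfolding digit_rigid_def
    proof (intro allI, rule rigid_unbounded[where M = M])
      show "[:1, -t:] * A \<noteq> 0" using dA by force
      show "degree ([:1, - t:] * A) * m + Suc (m + e) < M" if "m < Suc \<mu>" for m
      proof -
        have m: "m \<le> \<kappa>" using that \<kappa>(1) by linarith
        then have "Suc \<kappa> * m \<le> Suc \<kappa> * Suc \<kappa>" by (intro mult_le_mono2) simp
        then show ?thesis using m unfolding dA M_def by linarith
      qed
      show "h + tri (Suc \<mu>) < M" unfolding M_def by linarith
    qed (use rt in auto)
    then show False using t t0 \<kappa>(2) by simp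
  qed
  ultimately show ?thesis by (rule finite_subset[rotated])
qed

text \<open>As soon as A has degree \<delta> + 1, the right side of the relation has degree at most
  tri (\<delta> + 1) + tri \<delta> - 1. The quotient is then short automatically, and
  \<open>G\<close> becomes arbitrary.\<close>

lemma digit_rigid_last:
  fixes A :: "'k::field poly"
  assumes deg: "degree A = Suc \<delta>" and r: "digit_rigid A \<delta> 0 (tri (Suc \<delta>))"
  shows "rigid A (tri (Suc \<delta>)) G \<delta> Suc"
  unfolding rigid_def
proof (intro allI impI)
  fix c and f :: "nat \<Rightarrow> 'k poly"
  assume f: "\<forall>m\<le>\<delta>. \<forall>i\<ge>Suc m. coeff (f m) i = 0"
    and eq: "monom 1 (tri (Suc \<delta>)) * c = (\<Sum>m\<le>\<delta>. A ^ m * f m)"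
  have "degree (\<Sum>m\<le>\<delta>. A ^ m * f m) \<le> Suc \<delta> * \<delta> + \<delta>"
  proof (rule degree_sum_le)
    fix m assume m: "m \<in> {..\<delta>}"
    then have "degree (A ^ m * f m) \<le> Suc \<delta> * m + m"
      using f deg by (intro degree_power_mult_le) auto
    also have "\<dots> \<le> Suc \<delta> * \<delta> + \<delta>" using m by (intro add_mono mult_le_mono2) auto
    finally show "degree (A ^ m * f m) \<le> Suc \<delta> * \<delta> + \<delta>" .
  qed auto
  then have d: "degree (monom 1 (tri (Suc \<delta>)) * c) \<le> Suc \<delta> * \<delta> + \<delta>" by (simp only: eq)
  have c: "\<forall>i\<ge>tri \<delta>. coeff c i = 0"
  proof (intro allI impI)
    fix i assume "i \<ge> tri \<delta>"
    then have "tri (Suc \<delta>) + i > Suc \<delta> * \<delta> + \<delta>"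
      using tri_double[of \<delta>] tri_Suc[of \<delta>] by simp
    then have "coeff (monom 1 (tri (Suc \<delta>)) * c) (tri (Suc \<delta>) + i) = 0"
      using d by (intro coeff_eq_0) linarith
    then show "coeff c i = 0" by (simp only: coeff_monom_mult) simp
  qed
  have "rigid A (tri (Suc \<delta>)) (tri \<delta>) \<delta> (\<lambda>m. if m < \<delta> then Suc (m + 0) else Suc \<delta>)"
    using r unfolding digit_rigid_def by blast
  then show "c = 0 \<and> (\<forall>m\<le>\<delta>. f m = 0)"
    using c f eq unfolding rigid_def by (auto simp: le_less)
qed

text \<open>This keeps what has been gained while further factors are multiplied in: a solution over
  \<open>k[\<epsilon>]\<close> specializes at \<epsilon> = 0 to a relation for A itself.\<close>

lemma rigid_open:
  fixes A :: "'k::field poly"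
  assumes r: "rigid A h G \<mu> len"
  shows "finite {\<epsilon>. \<not> rigid ([:1, -\<epsilon>:] * A) h G \<mu> len}"
proof (rule rigid_generic)
  fix c and f :: "nat \<Rightarrow> 'k poly poly"
  assume c: "\<forall>i\<ge>G. coeff c i = 0" and f: "\<forall>m\<le>\<mu>. \<forall>i\<ge>len m. coeff (f m) i = 0"
    and eq: "monom 1 h * c = (\<Sum>m\<le>\<mu>. ([:1, [:0, -1:]:] * map_poly (\<lambda>a. [:a:]) A) ^ m * f m)"
  have at0AA: "at0 (map_poly (\<lambda>a. [:a:]) A) = A" by (subst map_poly_map_poly) (auto simp: o_def)
  have at0x: "at0 (monom 1 h) = monom (1::'k) h" by (subst map_poly_monom) auto
  have at0l: "at0 [:1, [:0, -1:]:] = (1 :: 'k poly)" by (simp add: map_poly_pCons)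
  have "at0 (monom 1 h * c) = (\<Sum>m\<le>\<mu>. A ^ m * at0 (f m))"
    unfolding eq by (simp only: at0_hom at0AA at0l mult_1)
  then have "monom 1 h * at0 c = (\<Sum>m\<le>\<mu>. A ^ m * at0 (f m))" by (simp only: at0_hom at0x)
  moreover have "\<forall>i\<ge>G. coeff (at0 c) i = 0" using c by (simp add: coeff_map_poly)
  moreover have "\<forall>m\<le>\<mu>. \<forall>i\<ge>len m. coeff (at0 (f m)) i = 0" using f by (simp add: coeff_map_poly)
  ultimately show "at0 c = 0 \<and> (\<forall>m\<le>\<mu>. at0 (f m) = 0)"
    using r[unfolded rigid_def, THEN spec[of _ "at0 c"], THEN spec[of _ "\<lambda>m. at0 (f m)"]] by blast
qed

text \<open>A is a product of factors 1 - t x, each t chosen outside a finite set that is bad for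
  one of the rows. The last row is handled by \<open>digit_rigid\<close> up to degree \<delta> + 1,
  converted there by \<open>digit_rigid_last\<close>, and preserved by \<open>rigid_open\<close>
  afterwards.\<close>

theorem rigid_polynomial_exists:
  fixes Hs :: "(nat \<times> nat) set"
  assumes inf: "infinite (UNIV :: 'k::field set)" and fin: "finite Hs"
    and h: "\<And>e h. (e, h) \<in> Hs \<Longrightarrow> n * (n - 1) \<le> 2 * h" and \<kappa>: "\<kappa> \<le> n"
  shows "\<exists>A :: 'k poly. degree A = \<kappa> \<and> coeff A 0 = 1 \<and> (\<forall>(e, h)\<in>Hs. digit_rigid A (\<kappa> - 1 - e) e h) \<and>
     (\<kappa> \<le> Suc \<delta> \<longrightarrow> digit_rigid A (\<kappa> - 1) 0 (tri (Suc \<delta>))) \<and>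
     (\<delta> < \<kappa> \<longrightarrow> rigid A (tri (Suc \<delta>)) G \<delta> Suc)"
  using \<kappa>
proof (induction \<kappa>)
  case 0
  show ?case by (rule exI[of _ 1]) (auto simp: digit_rigid_0)
next
  case (Suc \<kappa>)
  then obtain A :: "'k poly" where A: "degree A = \<kappa>" "coeff A 0 = 1"
    and A1: "\<And>e h. (e, h) \<in> Hs \<Longrightarrow> digit_rigid A (\<kappa> - 1 - e) e h"
    and A2: "\<kappa> \<le> Suc \<delta> \<Longrightarrow> digit_rigid A (\<kappa> - 1) 0 (tri (Suc \<delta>))"
    and A3: "\<delta> < \<kappa> \<Longrightarrow> rigid A (tri (Suc \<delta>)) G \<delta> Suc" by auto
  define bad1 where "bad1 = (\<Union>(e, h)\<in>Hs. {\<epsilon>. \<epsilon> = 0 \<or> \<not> digit_rigid ([:1, -\<epsilon>:] * A) (\<kappa> - e) e h})"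
  define bad2 where "bad2 = (if \<kappa> \<le> \<delta> then
     {\<epsilon>. \<epsilon> = 0 \<or> \<not> digit_rigid ([:1, -\<epsilon>:] * A) (\<kappa> - 0) 0 (tri (Suc \<delta>))} else {})"
  define bad3 where "bad3 = (if \<delta> < \<kappa> then
     {\<epsilon>. \<not> rigid ([:1, -\<epsilon>:] * A) (tri (Suc \<delta>)) G \<delta> Suc} else {})"
  have "\<kappa> * Suc \<kappa> \<le> n * (n - 1)"
    using Suc.prems by (subst mult.commute, intro mult_le_mono) auto
  then have "\<kappa> * Suc \<kappa> \<le> 2 * h" if "(e, h) \<in> Hs" for e h using h[OF that] by linarith
  then have "finite {\<epsilon>. \<epsilon> = 0 \<or> \<not> digit_rigid ([:1, -\<epsilon>:] * A) (\<kappa> - e) e h}" if "(e, h) \<in> Hs" for e h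
    using that by (intro digit_rigid_step A A1) auto
  then have "finite bad1" unfolding bad1_def by (intro finite_UN_I[OF fin]) (simp only: split_paired_all prod.case)
  moreover have "finite bad2"
  proof (cases "\<kappa> \<le> \<delta>")
    case True
    have "\<kappa> * Suc \<kappa> \<le> Suc \<delta> * Suc (Suc \<delta>)" using True by (intro mult_le_mono) auto
    then have "\<kappa> * Suc \<kappa> \<le> 2 * tri (Suc \<delta>)" by (simp only: tri_double)
    then show ?thesis unfolding bad2_def using True A A2
      by (simp only: if_True) (rule digit_rigid_step, auto)
  qed (simp add: bad2_def)
  moreover have "finite bad3" unfolding bad3_def using rigid_open[OF A3]
    by (cases "\<delta> < \<kappa>") (simp_all only: if_True if_False finite.emptyI)
  ultimately have "finite (insert 0 (bad1 \<union> bad2 \<union> bad3))" by simp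
  then obtain t where t: "t \<notin> insert 0 (bad1 \<union> bad2 \<union> bad3)" using inf ex_new_if_finite by blast
  define B where "B = [:1, -t:] * A"
  have "A \<noteq> 0" using A(2) by auto
  then have dB: "degree B = Suc \<kappa>" unfolding B_def using t A(1) by (subst degree_mult_eq) auto
  have B2: "digit_rigid B \<kappa> 0 (tri (Suc \<delta>))" if "\<kappa> \<le> \<delta>" using t that by (auto simp: B_def bad2_def)
  show ?case
  proof (intro exI[of _ B] conjI impI)
    show "degree B = Suc \<kappa>" by (rule dB)
    show "coeff B 0 = 1" using A(2) by (simp add: B_def coeff_mult_0)
    show "digit_rigid B (Suc \<kappa> - 1) 0 (tri (Suc \<delta>))" if "Suc \<kappa> \<le> Suc \<delta>" using B2 that by simp
    show "rigid B (tri (Suc \<delta>)) G \<delta> Suc" if "\<delta> < Suc \<kappa>"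
    proof (cases "\<delta> < \<kappa>")
      case True
      then show ?thesis using t by (auto simp: B_def bad3_def)
    next
      case False
      then have "\<kappa> = \<delta>" using that by simp
      then show ?thesis using B2 dB by (intro digit_rigid_last) auto
    qed
    show "\<forall>(e, h)\<in>Hs. digit_rigid B (Suc \<kappa> - 1 - e) e h"
      using t by (auto simp: B_def bad1_def)
  qed
qed

section \<open>Normal forms on the curve and solvability for jets\<close>

text \<open>Exponents of the monomials x^a y^j in normal form on the curve y A(x) = 1 with deg A =
  \<kappa>: a multiple of x^\<kappa> y can be rewritten with smaller exponents.\<close>

definition normal_index :: "nat \<Rightarrow> nat \<Rightarrow> nat \<Rightarrow> (nat \<times> nat) set"
  where "normal_index \<kappa> \<delta> J = {(a, j). j \<le> J \<and> a + j \<le> \<delta> \<and> (j = 0 \<or> a < \<kappa>)}"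

lemma finite_normal_index [simp]: "finite (normal_index \<kappa> \<delta> J)"
  by (rule finite_subset[of _ "{..\<delta>} \<times> {..J}"]) (auto simp: normal_index_def)

text \<open>Comparing degrees, the lowest digit cannot cancel a nonzero multiple of A, so it is zero
  and A can be divided out. This is the uniqueness of the A-adic expansion, with no bound on the top
  digit.\<close>

lemma adic_zero:
  fixes A :: "'k::field poly"
  assumes "degree A = \<kappa>" "A \<noteq> 0"
  shows "(\<And>m i. m < n \<Longrightarrow> i \<ge> \<kappa> \<Longrightarrow> coeff (F m) i = 0) \<Longrightarrow> (\<Sum>m\<le>n. A ^ m * F m) = 0 \<Longrightarrow> m \<le> n \<Longrightarrow> F m = 0"
proof (induction n arbitrary: F m)
  case 0
  then show ?case by simp
next
  case (Suc n)
  define X where "X = (\<Sum>m\<le>n. A ^ m * F (Suc m))"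
  have eq: "F 0 + A * X = 0"
    using Suc.prems(2) by (subst (asm) sum.atMost_Suc_shift) (simp add: X_def sum_distrib_left mult.assoc)
  have X0: "X = 0"
  proof (rule ccontr)
    assume "X \<noteq> 0"
    then have "degree (A * X) \<ge> \<kappa>" "A * X \<noteq> 0" using assms by (auto simp: degree_mult_eq)
    moreover have "A * X = - F 0" using eq by (simp add: eq_neg_iff_add_eq_0 add.commute)
    ultimately have "degree (F 0) \<ge> \<kappa>" "F 0 \<noteq> 0" by auto
    then show False using Suc.prems(1)[of 0 "degree (F 0)"] by auto
  qed
  then have "F 0 = 0" using eq by simp
  moreover have "F (Suc i) = 0" if "i \<le> n" for i
    by (rule Suc.IH[of "\<lambda>i. F (Suc i)", OF _ _ that]) (use Suc.prems(1) X0 in \<open>auto simp: X_def\<close>)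
  ultimately show ?case using Suc.prems(3) by (cases m) auto
qed

text \<open>On the curve y is 1 / A, and multiplication by A^J clears the denominators of the sum of
  the u_j y^j. Injectivity together with the count yields all jets of length
  \<open>h\<close>.\<close>

lemma row_solvable:
  fixes A :: "'k::field poly"
  assumes card: "h \<le> card (normal_index \<kappa> \<delta> J)"
    and inj: "\<And>F c. (\<And>m i. m \<le> J \<Longrightarrow> coeff (F m) i \<noteq> 0 \<Longrightarrow> (i, J - m) \<in> normal_index \<kappa> \<delta> J) \<Longrightarrow>
       monom 1 h * c = (\<Sum>m\<le>J. A ^ m * F m) \<Longrightarrow> \<forall>m\<le>J. F m = 0"
  shows "\<exists>u. (\<forall>j i. coeff (u j) i \<noteq> 0 \<longrightarrow> j \<le> J \<and> i + j \<le> \<delta>) \<and>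
     monom 1 h dvd (t - (\<Sum>j\<le>J. u j * A ^ (J - j)))"
proof -
  define U where "U = normal_index \<kappa> \<delta> J"
  define m where "m i aj = (case aj of (a, j) \<Rightarrow> coeff (monom 1 a * A ^ (J - j)) i)" for i :: nat and aj
  define pol where "pol v j = (\<Sum>a\<le>\<delta>. monom (if (a, j) \<in> U then v (a, j) else 0) a)" for v :: "nat \<times> nat \<Rightarrow> 'k" and j
  have finU: "finite U" by (simp add: U_def)
  have cpol: "coeff (pol v j) i = (if (i, j) \<in> U then v (i, j) else 0)" for v i j
    by (auto simp: pol_def coeff_sum U_def normal_index_def)
  have expand: "(\<Sum>aj\<in>U. m i aj * v aj) = coeff (\<Sum>j\<le>J. pol v j * A ^ (J - j)) i" for v i
  proof -
    have "(\<Sum>aj\<in>U. m i aj * v aj) = (\<Sum>(a, j)\<in>U. coeff (monom (v (a, j)) a * A ^ (J - j)) i)"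
      by (intro sum.cong) (auto simp: m_def coeff_monom_mult)
    also have "\<dots> = (\<Sum>(a, j)\<in>{..\<delta>} \<times> {..J}. coeff (monom (if (a, j) \<in> U then v (a, j) else 0) a * A ^ (J - j)) i)"
      by (intro sum.mono_neutral_cong_left) (auto simp: U_def normal_index_def split: if_splits)
    also have "\<dots> = (\<Sum>j\<le>J. \<Sum>a\<le>\<delta>. coeff (monom (if (a, j) \<in> U then v (a, j) else 0) a * A ^ (J - j)) i)"
      by (subst sum.cartesian_product[symmetric]) (rule sum.swap)
    also have "\<dots> = coeff (\<Sum>j\<le>J. pol v j * A ^ (J - j)) i"
      by (simp add: pol_def coeff_sum sum_distrib_right)
    finally show ?thesis .
  qed
  have "\<exists>v. \<forall>i\<in>{..<h}. (\<Sum>aj\<in>U. m i aj * v aj) = coeff t i"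
  proof (rule square_system_solvable)
    show "card {..<h} \<le> card U" using card by (simp add: U_def)
    fix v assume v: "\<And>i. i \<in> {..<h} \<Longrightarrow> (\<Sum>aj\<in>U. m i aj * v aj) = 0"
    define F where "F m = pol v (J - m)" for m
    have "(\<Sum>j\<le>J. pol v j * A ^ (J - j)) = (\<Sum>m\<le>J. A ^ m * F m)"
      by (rule sum.reindex_bij_witness[of _ "\<lambda>m. J - m" "\<lambda>j. J - j"]) (auto simp: F_def mult.commute)
    moreover have "monom 1 h dvd (\<Sum>j\<le>J. pol v j * A ^ (J - j))"
      unfolding monom_1_dvd_iff' using v expand by auto
    ultimately obtain c where c: "(\<Sum>m\<le>J. A ^ m * F m) = monom 1 h * c" unfolding dvd_def by auto
    have "\<forall>m\<le>J. F m = 0"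
      by (rule inj[OF _ c[symmetric]]) (auto simp: F_def cpol U_def split: if_splits)
    then have "pol v j = 0" if "j \<le> J" for j using that F_def[of "J - j"] by auto
    then have "v (i, j) = 0" if "(i, j) \<in> U" for i j
      using that cpol[of v j i] by (auto simp: U_def normal_index_def)
    then show "\<forall>aj\<in>U. v aj = 0" by auto
  qed (simp_all add: finU)
  then obtain v where v: "\<And>i. i < h \<Longrightarrow> (\<Sum>aj\<in>U. m i aj * v aj) = coeff t i" by auto
  show ?thesis
  proof (intro exI conjI allI impI)
    show "j \<le> J" "i + j \<le> \<delta>" if "coeff (pol v j) i \<noteq> 0" for i j
      using that by (auto simp: cpol U_def normal_index_def split: if_splits)
    show "monom 1 h dvd (t - (\<Sum>j\<le>J. pol v j * A ^ (J - j)))"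
      unfolding monom_1_dvd_iff' using v expand by simp
  qed
qed

text \<open>For an exponent j > 0 of y there are min(\<kappa>, J + e + 1 - j) exponents of x; the
  deficits of this minimum against \<kappa> add up to \<open>tri (\<kappa> - 1 - e)\<close>.\<close>

lemma card_normal_index:
  "card (normal_index \<kappa> (J + e) J) + tri (\<kappa> - 1 - e) = \<kappa> * J + J + e + 1" if "\<kappa> - 1 - e \<le> J"
proof -
  define S where "S j = {a. a + j \<le> J + e \<and> (j = 0 \<or> a < \<kappa>)}" for j
  have S: "S j = {..<(if j = 0 then J + e + 1 else min \<kappa> (J + e + 1 - j))}" if "j \<le> J" for j
    using that by (cases "j = 0") (auto simp: S_def less_diff_conv)
  have "normal_index \<kappa> (J + e) J = (\<Union>j\<in>{..J}. (\<lambda>a. (a, j)) ` S j)"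
    by (auto simp: normal_index_def S_def)
  moreover have "card (\<Union>j\<in>{..J}. (\<lambda>a. (a, j)) ` S j) = (\<Sum>j\<le>J. card ((\<lambda>a. (a, j)) ` S j))"
    by (rule card_UN_disjoint) (auto simp: S)
  moreover have "(\<Sum>j\<le>J. card ((\<lambda>a. (a, j)) ` S j)) =
      (\<Sum>j\<le>J. if j = 0 then J + e + 1 else min \<kappa> (J + e + 1 - j))"
    by (intro sum.cong refl, subst card_image) (auto simp: inj_on_def S)
  ultimately have c: "card (normal_index \<kappa> (J + e) J) =
     (\<Sum>j\<le>J. if j = 0 then J + e + 1 else min \<kappa> (J + e + 1 - j))" by simp
  show ?thesis unfolding c using that
  proof (induction J)
    case 0
    then show ?case by simp
  next
    case (Suc J)
    define f where "f J = (\<Sum>j\<le>J. if j = 0 then J + e + 1 else min \<kappa> (J + e + 1 - j))" for J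
    have f: "f J = J + e + 1 + (\<Sum>m<J. min \<kappa> (m + e + 1))" for J
    proof -
      have "f J = J + e + 1 + (\<Sum>j<J. min \<kappa> (J + e + 1 - Suc j))"
        unfolding f_def by (subst sum.atMost_shift) simp
      also have "(\<Sum>j<J. min \<kappa> (J + e + 1 - Suc j)) = (\<Sum>m<J. min \<kappa> (m + e + 1))"
        by (rule sum.reindex_bij_witness[of _ "\<lambda>m. J - Suc m" "\<lambda>m. J - Suc m"]) (auto simp: algebra_simps)
      finally show ?thesis .
    qed
    have key: "(\<Sum>m<J. min \<kappa> (m + e + 1)) + tri (\<kappa> - 1 - e) = \<kappa> * J" if "\<kappa> - 1 - e \<le> J" for J
    proof -
      have "(\<Sum>m<n. min \<kappa> (m + e + 1)) + tri (\<kappa> - 1 - e) = \<kappa> * n + tri (\<kappa> - 1 - e - n)" for n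
      proof (induction n)
        case 0
        then show ?case by simp
      next
        case (Suc n)
        show ?case
        proof (cases "\<kappa> - 1 - e \<le> n")
          case True
          then have "\<kappa> - 1 - e - n = 0" "\<kappa> - 1 - e - Suc n = 0" "min \<kappa> (n + e + 1) = \<kappa>" by auto
          then show ?thesis using Suc.IH by simp
        next
          case False
          then have "\<kappa> - 1 - e - n = Suc (\<kappa> - 1 - e - Suc n)" by simp
          then have "tri (\<kappa> - 1 - e - n) = tri (\<kappa> - 1 - e - Suc n) + Suc (\<kappa> - 1 - e - Suc n)"
            by (simp only: tri_Suc)
          moreover have "min \<kappa> (n + e + 1) + Suc (\<kappa> - 1 - e - Suc n) = \<kappa>" using False by auto
          ultimately show ?thesis using Suc.IH unfolding sum.lessThan_Suc mult_Suc_right by linarith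
        qed
      qed
      from this[of J] that show ?thesis by simp
    qed
    show ?case using f[of "Suc J"] key[OF Suc.prems] unfolding f_def by simp
  qed
qed

text \<open>The count leaves to the quotient \<open>c\<close> at most
  \<open>tri (\<kappa> - 1 - e)\<close> coefficients, so \<open>digit_rigid\<close> applies once all
  digits from index \<mu> on are collected in one. It gives \<open>c\<close> = 0, and the uniqueness
  of the A-adic expansion does the rest.\<close>

lemma digit_row:
  fixes A :: "'k::field poly"
  assumes A: "degree A = \<kappa>" "A \<noteq> 0" and r: "digit_rigid A (\<kappa> - 1 - e) e h"
    and J: "\<kappa> - 1 - e \<le> J" and h: "h + tri (\<kappa> - 1 - e) = \<kappa> * J + J + e + 1"
  shows "\<exists>u. (\<forall>j i. coeff (u j) i \<noteq> 0 \<longrightarrow> j \<le> J \<and> i + j \<le> J + e) \<and>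
     monom 1 h dvd (t - (\<Sum>j\<le>J. u j * A ^ (J - j)))"
proof (rule row_solvable[where \<kappa> = \<kappa>])
  show "h \<le> card (normal_index \<kappa> (J + e) J)" using card_normal_index[OF J] h by linarith
  fix F :: "nat \<Rightarrow> 'k poly" and c
  assume F: "\<And>m i. m \<le> J \<Longrightarrow> coeff (F m) i \<noteq> 0 \<Longrightarrow> (i, J - m) \<in> normal_index \<kappa> (J + e) J"
    and eq: "monom 1 h * c = (\<Sum>m\<le>J. A ^ m * F m)"
  define \<mu> where "\<mu> = \<kappa> - 1 - e"
  have F1: "coeff (F m) i = 0" if "m \<le> J" "i > m + e" for m i
    using F[OF that(1), of i] that by (cases "coeff (F m) i = 0") (auto simp: normal_index_def)
  have F2: "coeff (F m) i = 0" if "m < J" "i \<ge> \<kappa>" for m i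
    using F[of m i] that by (cases "coeff (F m) i = 0") (auto simp: normal_index_def)
  have "degree (\<Sum>m\<le>J. A ^ m * F m) \<le> \<kappa> * J + (J + e)"
  proof (rule degree_sum_le)
    fix m assume m: "m \<in> {..J}"
    then have "degree (A ^ m * F m) \<le> \<kappa> * m + (m + e)"
      using F1 A by (intro degree_power_mult_le) auto
    also have "\<dots> \<le> \<kappa> * J + (J + e)" using m by (intro add_mono mult_le_mono2) auto
    finally show "degree (A ^ m * F m) \<le> \<kappa> * J + (J + e)" .
  qed auto
  then have d: "degree (monom 1 h * c) \<le> \<kappa> * J + (J + e)" by (simp only: eq)
  have c: "\<forall>i\<ge>tri \<mu>. coeff c i = 0"
  proof (intro allI impI)
    fix i assume "i \<ge> tri \<mu>"
    then have "coeff (monom 1 h * c) (h + i) = 0" using d h by (intro coeff_eq_0) (simp add: \<mu>_def)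
    then show "coeff c i = 0" by (simp only: coeff_monom_mult) simp
  qed
  define f where "f m = (if m < \<mu> then F m else (\<Sum>i\<le>J - \<mu>. A ^ i * F (\<mu> + i)))" for m
  have "(\<Sum>m\<le>J. A ^ m * F m) = (\<Sum>m<\<mu>. A ^ m * F m) + (\<Sum>m\<in>{\<mu>..J}. A ^ m * F m)"
    using J by (subst sum.union_disjoint[symmetric]) (auto simp: \<mu>_def intro!: sum.cong)
  also have "(\<Sum>m\<in>{\<mu>..J}. A ^ m * F m) = (\<Sum>i\<le>J - \<mu>. A ^ (\<mu> + i) * F (\<mu> + i))"
    using J by (intro sum.reindex_bij_witness[of _ "\<lambda>i. \<mu> + i" "\<lambda>m. m - \<mu>"]) (auto simp: \<mu>_def)
  also have "\<dots> = A ^ \<mu> * f \<mu>" by (simp add: f_def sum_distrib_left power_add mult.assoc)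
  also have "(\<Sum>m<\<mu>. A ^ m * F m) + \<dots> = (\<Sum>m\<le>\<mu>. A ^ m * f m)"
    by (simp add: f_def flip: lessThan_Suc_atMost)
  finally have eq': "monom 1 h * c = (\<Sum>m\<le>\<mu>. A ^ m * f m)" using eq by simp
  have "rigid A h (tri \<mu>) \<mu> (\<lambda>m. if m < \<mu> then Suc (m + e) else Suc (degree (f \<mu>)))"
    using r unfolding digit_rigid_def \<mu>_def by blast
  moreover have "\<forall>m\<le>\<mu>. \<forall>i\<ge>(if m < \<mu> then Suc (m + e) else Suc (degree (f \<mu>))). coeff (f m) i = 0"
  proof (intro allI impI)
    fix m i assume m: "m \<le> \<mu>" and i: "i \<ge> (if m < \<mu> then Suc (m + e) else Suc (degree (f \<mu>)))"
    show "coeff (f m) i = 0"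
    proof (cases "m < \<mu>")
      case True
      then show ?thesis using i F1[of m i] J by (simp add: f_def \<mu>_def)
    next
      case False
      then have "m = \<mu>" using m by simp
      then show ?thesis using i by (simp add: coeff_eq_0)
    qed
  qed
  ultimately have "c = 0" using c eq' unfolding rigid_def by blast
  then have "(\<Sum>m\<le>J. A ^ m * F m) = 0" using eq by simp
  then show "\<forall>m\<le>J. F m = 0"
    using adic_zero[OF A, of J F] F2 by blast
qed

text \<open>For the row of order e + 1 along the curve all exponents of total degree at most
  \<delta> are used, without reduction modulo the curve. The case \<delta> = 0 is separate because
  \<kappa> may then be 0.\<close>

lemma triangle_row:
  fixes A :: "'k::field poly"
  assumes A: "degree A = \<kappa>" and \<delta>: "\<delta> < \<kappa> \<or> \<delta> = 0"
    and r: "\<delta> < \<kappa> \<Longrightarrow> rigid A (tri (Suc \<delta>)) (\<kappa> * \<delta> + \<delta> + 1) \<delta> Suc"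
  shows "\<exists>u. (\<forall>j i. coeff (u j) i \<noteq> 0 \<longrightarrow> j \<le> \<delta> \<and> i + j \<le> \<delta>) \<and>
     monom 1 (tri (Suc \<delta>)) dvd (t - (\<Sum>j\<le>\<delta>. u j * A ^ (\<delta> - j)))"
proof (rule row_solvable[where \<kappa> = "Suc \<delta>"])
  have "card (normal_index (Suc \<delta>) (\<delta> + 0) \<delta>) + tri \<delta> = Suc \<delta> * \<delta> + \<delta> + 1"
    using card_normal_index[of "Suc \<delta>" 0 \<delta>] by simp
  then show "tri (Suc \<delta>) \<le> card (normal_index (Suc \<delta>) \<delta> \<delta>)"
    using tri_Suc[of \<delta>] tri_double[of \<delta>] by simp
  fix F :: "nat \<Rightarrow> 'k poly" and c
  assume F: "\<And>m i. m \<le> \<delta> \<Longrightarrow> coeff (F m) i \<noteq> 0 \<Longrightarrow> (i, \<delta> - m) \<in> normal_index (Suc \<delta>) \<delta> \<delta>"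
    and eq: "monom 1 (tri (Suc \<delta>)) * c = (\<Sum>m\<le>\<delta>. A ^ m * F m)"
  have F1: "coeff (F m) i = 0" if "m \<le> \<delta>" "i > m" for m i
    using F[OF that(1), of i] that by (cases "coeff (F m) i = 0") (auto simp: normal_index_def)
  show "\<forall>m\<le>\<delta>. F m = 0"
  proof (cases "\<delta> = 0")
    case True
    have "tri (Suc \<delta>) = 1" using True by (simp add: tri_Suc)
    then have "coeff (F 0) 0 = 0"
      using arg_cong[OF eq, of "\<lambda>p. coeff p 0"] True by (simp add: coeff_monom_mult)
    then have "coeff (F 0) i = 0" for i using F1[of 0 i] by (cases i) auto
    then show ?thesis using True by (simp add: poly_eq_iff)
  next
    case False
    then have \<delta>: "\<delta> < \<kappa>" using \<delta> by simp
    have "degree (\<Sum>m\<le>\<delta>. A ^ m * F m) \<le> \<kappa> * \<delta> + \<delta>"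
    proof (rule degree_sum_le)
      fix m assume m: "m \<in> {..\<delta>}"
      then have "degree (A ^ m * F m) \<le> \<kappa> * m + m"
        using F1 A by (intro degree_power_mult_le) auto
      also have "\<dots> \<le> \<kappa> * \<delta> + \<delta>" using m by (intro add_mono mult_le_mono2) auto
      finally show "degree (A ^ m * F m) \<le> \<kappa> * \<delta> + \<delta>" .
    qed auto
    then have d: "degree (monom 1 (tri (Suc \<delta>)) * c) \<le> \<kappa> * \<delta> + \<delta>" by (simp only: eq)
    have c: "\<forall>i\<ge>\<kappa> * \<delta> + \<delta> + 1. coeff c i = 0"
    proof (intro allI impI)
      fix i assume "i \<ge> \<kappa> * \<delta> + \<delta> + 1"
      then have "coeff (monom 1 (tri (Suc \<delta>)) * c) (tri (Suc \<delta>) + i) = 0" using d by (intro coeff_eq_0) simp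
      then show "coeff c i = 0" by (simp only: coeff_monom_mult) simp
    qed
    have "\<forall>m\<le>\<delta>. \<forall>i\<ge>Suc m. coeff (F m) i = 0" using F1 by auto
    then show ?thesis using r[OF \<delta>] c eq unfolding rigid_def by blast
  qed
qed

lemma tri_diff:
  assumes "1 \<le> k" "k \<le> D"
  shows "tri D + tri (k - 1) = tri (D - k) + k * D"
proof -
  obtain k' x where k': "k = Suc k'" and x: "D = k + x" using assms by (metis Suc_pred' le_Suc_ex less_eq_Suc_le One_nat_def)
  have "2 * (tri D + tri (k - 1)) = 2 * (tri (D - k) + k * D)"
    unfolding distrib_left tri_double k' x by (simp add: algebra_simps)
  then show ?thesis by simp
qed

lemma tri_mono: "m \<le> n \<Longrightarrow> tri m \<le> tri n"
  unfolding tri_def by (intro div_le_mono mult_le_mono) auto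

text \<open>Dimension of the polynomials of degree at most d - k b modulo the multiples of the curve
  equation, which has degree k; the last row takes all that remains. Row 0 loses
  \<open>tri s\<close> to a point of multiplicity s at infinity.\<close>

definition row_size :: "nat \<Rightarrow> nat \<Rightarrow> nat \<Rightarrow> nat \<Rightarrow> nat \<Rightarrow> nat"
  where "row_size d k e s b = (if b = 0 then tri (d + 1) - tri (d + 1 - k) - tri s
     else if b \<le> e then tri (d + 1 - k * b) - tri (d + 1 - k * (b + 1)) else tri (d + 1 - k * b))"

text \<open>\<open>\<phi>\<close> approximates \<open>1 / A\<close>, so that \<open>y = \<phi> x\<close> is a germ of the curve \<open>y A(x) = 1\<close>.\<close>

theorem curve_rows:
  fixes d k e r s :: nat
  assumes inf: "infinite (UNIV :: 'k::field set)"
    and d: "d + 1 = k * (e + 1) + r" and r: "r < k \<or> r \<le> 1" and k: "1 \<le> k"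
    and s: "s = 0 \<or> (s = e \<and> e + 1 \<le> k)"
  shows "\<exists>A :: 'k poly. coeff A 0 = 1 \<and> degree A < k \<and>
    (\<forall>b\<le>e+1. \<forall>a<row_size d k e s b. \<exists>u.
      (\<forall>j i. coeff (u j) i \<noteq> 0 \<longrightarrow> i + j \<le> d - k * b \<and> (b = 0 \<longrightarrow> j \<le> d - s)) \<and>
      (\<forall>N\<ge>row_size d k e s b.
         monom 1 (row_size d k e s b) dvd (\<Sum>j\<le>d. u j * (\<Sum>i\<le>N. (1 - A) ^ i) ^ j) - monom 1 a))"
proof -
  define \<kappa> where "\<kappa> = k - 1"
  define h where "h = row_size d k e s"
  \<comment> \<open>Bounds for the exponent of y. For b \<le> e the sum \<open>J b + e' b\<close> is
    d - k b, so that \<open>digit_row\<close> covers row 0 and the inner rows alike.\<close>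
  define J where "J b = (if b = 0 then d - s else d - k * b)" for b
  define e' where "e' b = (if b = 0 then s else 0)" for b :: nat
  define Hs where "Hs = (\<lambda>b. (e' b, h b)) ` {..e}"
  have bk: "k \<le> d + 1 - k * b" "k * b \<le> d" if "b \<le> e" for b
  proof -
    have "k * b \<le> k * e" using that by (intro mult_le_mono2)
    moreover have "d + 1 = k * e + k + r" using d by simp
    ultimately show "k \<le> d + 1 - k * b" "k * b \<le> d" using k by linarith+
  qed
  have hb: "h b + tri s' + tri \<kappa> = k * (d + 1 - k * b)" if "b \<le> e" "s' = e' b" for b s'
  proof -
    define D where "D = d + 1 - k * b"
    have D: "k \<le> D" using bk[OF that(1)] by (simp add: D_def)
    have t: "tri D + tri \<kappa> = tri (D - k) + k * D" using tri_diff[OF k D] by (simp add: \<kappa>_def)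
    have "D - k = d + 1 - k * (b + 1)" by (simp add: D_def)
    moreover have "tri s \<le> tri D - tri (D - k)" if "b = 0"
    proof -
      have "tri s \<le> tri \<kappa>" if "s \<noteq> 0"
      proof -
        have "s \<le> \<kappa>" using s that by (auto simp: \<kappa>_def)
        then show ?thesis by (rule tri_mono)
      qed
      moreover have "2 * tri \<kappa> \<le> k * D"
        unfolding tri_double using D k by (intro order_trans[OF _ mult_le_mono2[of k D k]]) (auto simp: \<kappa>_def)
      ultimately show ?thesis using t by (cases "s = 0") auto
    qed
    ultimately have "h b + tri s' = tri D - tri (D - k)" using that
      by (auto simp: h_def row_size_def e'_def D_def)
    moreover have "tri (D - k) \<le> tri D" by (rule tri_mono) simp
    ultimately show ?thesis using t unfolding D_def[symmetric] by linarith
  qed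
  \<comment> \<open>The lower bound on the jet length that the construction of A needs in each of
    its \<kappa> stages.\<close>
  have h\<kappa>: "\<kappa> * (\<kappa> - 1) \<le> 2 * h b" if b: "b \<le> e" for b
  proof -
    obtain k' where k': "k = Suc k'" using k by (cases k) auto
    have eq: "2 * h b + e' b * Suc (e' b) + \<kappa> * Suc \<kappa> = 2 * (k * (d + 1 - k * b))"
      using arg_cong[OF hb[OF b refl], of "\<lambda>x. 2 * x"] by (simp only: distrib_left tri_double)
    have "\<kappa> * (\<kappa> - 1) + e' b * Suc (e' b) + \<kappa> * Suc \<kappa> \<le> 2 * (k * (d + 1 - k * b))"
    proof (cases "e' b = 0")
      case True
      have "\<kappa> * (\<kappa> - 1) + \<kappa> * Suc \<kappa> \<le> 2 * (k * k)"
        by (cases k') (auto simp: \<kappa>_def k' algebra_simps)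
      also have "\<dots> \<le> 2 * (k * (d + 1 - k * b))" using bk(1)[OF b] by simp
      finally show ?thesis using True by simp
    next
      case False
      then have b0: "b = 0" "e' b = e" "s = e" "e + 1 \<le> k" "e \<noteq> 0" using s by (auto simp: e'_def split: if_splits)
      have "e * Suc e \<le> k * k" using b0 by (intro mult_le_mono) auto
      moreover have "\<kappa> * (\<kappa> - 1) + \<kappa> * Suc \<kappa> \<le> 2 * (k * k)"
        by (cases k') (auto simp: \<kappa>_def k' algebra_simps)
      ultimately have "\<kappa> * (\<kappa> - 1) + e * Suc e + \<kappa> * Suc \<kappa> \<le> 2 * (k * (2 * k))" by simp
      also have "\<dots> \<le> 2 * (k * (d + 1 - k * b))"
      proof -
        have "k * 2 \<le> k * (e + 1)" using b0 by (intro mult_le_mono2) simp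
        then have "2 * k \<le> d + 1" using d by linarith
        then have "2 * k \<le> d + 1 - k * b" by (simp only: b0(1) mult_0_right diff_zero)
        then show ?thesis by simp
      qed
      finally show ?thesis using b0 by simp
    qed
    then show ?thesis using eq by linarith
  qed
  define \<delta> where "\<delta> = r - 1"
  obtain A :: "'k poly" where A: "degree A = \<kappa>" "coeff A 0 = 1"
    and A1: "\<forall>(e, h)\<in>Hs. digit_rigid A (\<kappa> - 1 - e) e h"
    and A2: "\<delta> < \<kappa> \<longrightarrow> rigid A (tri (Suc \<delta>)) (\<kappa> * \<delta> + \<delta> + 1) \<delta> Suc"
    using rigid_polynomial_exists[OF inf, of Hs \<kappa> \<kappa> \<delta> "\<kappa> * \<delta> + \<delta> + 1"] h\<kappa> by (auto simp: Hs_def)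
  have A0: "A \<noteq> 0" using A by auto
  have row: "\<exists>u. (\<forall>j i. coeff (u j) i \<noteq> 0 \<longrightarrow> j \<le> J b \<and> i + j \<le> d - k * b) \<and>
     monom 1 (h b) dvd (A ^ J b * monom 1 a - (\<Sum>j\<le>J b. u j * A ^ (J b - j)))"
    if b: "b \<le> e + 1" and a: "a < h b" for a b
  proof (cases "b \<le> e")
    case True
    have se: "J b + e' b = d - k * b"
    proof -
      have "s \<le> d" using s d k by (auto simp: algebra_simps)
      then show ?thesis by (auto simp: J_def e'_def)
    qed
    have "(\<kappa> - 1 - e' b) \<le> J b"
      using bk[OF True] se k by (auto simp: \<kappa>_def)
    moreover have "digit_rigid A (\<kappa> - 1 - e' b) (e' b) (h b)" using A1 True by (auto simp: Hs_def)
    moreover have "h b + tri (\<kappa> - 1 - e' b) = \<kappa> * J b + J b + e' b + 1"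
    proof -
      define x where "x = e' b"
      have x: "x \<le> \<kappa>" using s by (auto simp: x_def e'_def \<kappa>_def)
      have "tri \<kappa> + tri x = tri (\<kappa> - 1 - x) + (x + 1) * \<kappa>"
      proof (cases "x < \<kappa>")
        case True
        then show ?thesis using tri_diff[of "x + 1" \<kappa>] by simp
      next
        case False
        then have "x = \<kappa>" using x by simp
        then show ?thesis using tri_double[of \<kappa>] by simp
      qed
      moreover have "h b + tri x + tri \<kappa> = k * (d + 1 - k * b)" by (rule hb[OF True]) (simp add: x_def)
      moreover have "k * (d + 1 - k * b) = \<kappa> * J b + J b + x + 1 + (x + 1) * \<kappa>"
      proof -
        have "d + 1 - k * b = J b + x + 1" using se bk[OF True] by (simp add: x_def)
        moreover have "k = Suc \<kappa>" using k by (simp add: \<kappa>_def)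
        ultimately show ?thesis by (simp add: algebra_simps)
      qed
      ultimately show ?thesis unfolding x_def[symmetric] by linarith
    qed
    ultimately show ?thesis using digit_row[OF A(1) A0, of "e' b" "h b" "J b"] se by simp
  next
    case False
    then have be: "b = e + 1" using b by simp
    have D: "d + 1 - k * b = r" using d be by simp
    have hr: "h b = tri r" using be D by (simp add: h_def row_size_def)
    then have "r \<noteq> 0" using a by (cases r) auto
    then have "Suc \<delta> = r" "J b = \<delta>" "d - k * b = \<delta>" using D be by (auto simp: \<delta>_def J_def)
    moreover have "\<delta> < \<kappa> \<or> \<delta> = 0" using r by (auto simp: \<delta>_def \<kappa>_def)
    ultimately show ?thesis using triangle_row[OF A(1), of \<delta>] A2 hr by simp
  qed
  show ?thesis
  proof (rule exI[of _ A], intro conjI allI impI)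
    show "coeff A 0 = 1" by (rule A)
    show "degree A < k" using A k by (simp add: \<kappa>_def)
    fix b a assume b: "b \<le> e + 1" and "a < row_size d k e s b"
    then obtain u where u: "\<And>j i. coeff (u j) i \<noteq> 0 \<Longrightarrow> j \<le> J b \<and> i + j \<le> d - k * b"
      and dv: "monom 1 (h b) dvd (A ^ J b * monom 1 a - (\<Sum>j\<le>J b. u j * A ^ (J b - j)))"
      using row[OF b] unfolding h_def by blast
    have Jd: "J b \<le> d" by (simp add: J_def)
    have u0: "u j = 0" if "j > J b" for j using u[of j] that by (auto simp: poly_eq_iff)
    show "\<exists>u. (\<forall>j i. coeff (u j) i \<noteq> 0 \<longrightarrow> i + j \<le> d - k * b \<and> (b = 0 \<longrightarrow> j \<le> d - s)) \<and>
      (\<forall>N\<ge>row_size d k e s b.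
         monom 1 (row_size d k e s b) dvd (\<Sum>j\<le>d. u j * (\<Sum>i\<le>N. (1 - A) ^ i) ^ j) - monom 1 a)"
    proof (rule exI[of _ u], intro conjI allI impI)
      show "i + j \<le> d - k * b" if "coeff (u j) i \<noteq> 0" for i j using u that by blast
      show "j \<le> d - s" if "coeff (u j) i \<noteq> 0" "b = 0" for i j using u[OF that(1)] that by (simp add: J_def)
      fix N assume N: "N \<ge> row_size d k e s b"
      define \<phi> where "\<phi> = (\<Sum>i\<le>N. (1 - A) ^ i)"
      define q where "q = monom (1::'k) (h b)"
      have "monom 1 1 dvd (1 - A)" using A by (simp add: monom_1_dvd_iff')
      then have "monom 1 1 ^ Suc N dvd (1 - A) ^ Suc N" by (rule dvd_power_same)
      then have "monom 1 (Suc N) dvd (1 - A) ^ Suc N" by (simp only: monom_power power_one mult_1)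
      moreover have "A * \<phi> = 1 - (1 - A) ^ Suc N"
        using sum_gp_basic[of "1 - A" N] by (simp add: \<phi>_def)
      moreover have "q dvd monom 1 (Suc N)" using N unfolding q_def h_def by (simp add: monom_1_dvd_iff' )
      ultimately have q1: "q dvd A * \<phi> - 1" by (simp add: dvd_trans)
      have qpow: "q dvd (A * \<phi>) ^ n - 1" for n
      proof (induction n)
        case (Suc n)
        have "(A * \<phi>) ^ Suc n - 1 = A * \<phi> * ((A * \<phi>) ^ n - 1) + (A * \<phi> - 1)" by (simp add: algebra_simps)
        moreover have "q dvd A * \<phi> * ((A * \<phi>) ^ n - 1) + (A * \<phi> - 1)"
          by (intro dvd_add dvd_mult Suc q1)
        ultimately show ?case by (simp only:)
      qed simp
      define S where "S = (\<Sum>j\<le>J b. u j * \<phi> ^ j)"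
      have "q dvd A ^ J b * S - (\<Sum>j\<le>J b. u j * A ^ (J b - j))"
      proof -
        have "A ^ J b * S - (\<Sum>j\<le>J b. u j * A ^ (J b - j)) = (\<Sum>j\<le>J b. u j * A ^ (J b - j) * ((A * \<phi>) ^ j - 1))"
          unfolding S_def sum_distrib_left sum_subtractf[symmetric]
        proof (rule sum.cong)
          fix j assume "j \<in> {..J b}"
          then have "A ^ J b = A ^ (J b - j) * A ^ j" by (simp flip: power_add)
          then show "A ^ J b * (u j * \<phi> ^ j) - u j * A ^ (J b - j) = u j * A ^ (J b - j) * ((A * \<phi>) ^ j - 1)"
            by (simp add: power_mult_distrib algebra_simps)
        qed simp
        then show ?thesis using qpow by (simp add: dvd_sum)
      qed
      then have "q dvd A ^ J b * S - (\<Sum>j\<le>J b. u j * A ^ (J b - j)) -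
          (A ^ J b * monom 1 a - (\<Sum>j\<le>J b. u j * A ^ (J b - j)))"
        using dv unfolding q_def by (rule dvd_diff)
      then have qY: "q dvd A ^ J b * (S - monom 1 a)" by (simp add: algebra_simps)
      \<comment> \<open>\<open>\<phi>\<close> inverts A modulo \<open>q\<close>, so the factor A^J
        can be cancelled.\<close>
      have "q dvd \<phi> ^ J b * (A ^ J b * (S - monom 1 a)) - ((A * \<phi>) ^ J b - 1) * (S - monom 1 a)"
        by (rule dvd_diff[OF dvd_mult[OF qY] dvd_mult2[OF qpow]])
      also have "\<phi> ^ J b * (A ^ J b * (S - monom 1 a)) - ((A * \<phi>) ^ J b - 1) * (S - monom 1 a) = S - monom 1 a"
        by (simp add: power_mult_distrib algebra_simps)
      finally have "q dvd S - monom 1 a" .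
      moreover have "S = (\<Sum>j\<le>d. u j * \<phi> ^ j)"
        unfolding S_def using Jd u0 by (intro sum.mono_neutral_left) auto
      ultimately show "monom 1 (row_size d k e s b) dvd (\<Sum>j\<le>d. u j * (\<Sum>i\<le>N. (1 - A) ^ i) ^ j) - monom 1 a"
        by (simp add: \<phi>_def q_def h_def)
    qed
  qed
qed

lemma sum_row_size:
  assumes d: "d + 1 = k * (e + 1) + r" and s: "tri s \<le> tri (d + 1) - tri (d + 1 - k)"
  shows "(\<Sum>b\<le>e+1. row_size d k e s b) + tri s = tri (d + 1)"
proof -
  define D where "D b = d + 1 - k * b" for b
  have mono: "tri (D (Suc b)) \<le> tri (D b)" for b
    by (rule tri_mono) (simp add: D_def)
  have tel: "(\<Sum>b<n. tri (D b) - tri (D (Suc b))) + tri (D n) = tri (D 0)" for n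
  proof (induction n)
    case (Suc n)
    then show ?case using mono[of n] by simp
  qed simp
  have "(\<Sum>b\<le>e+1. row_size d k e s b) = row_size d k e s 0 + (\<Sum>b<e. row_size d k e s (Suc b)) + row_size d k e s (Suc e)"
  proof -
    have "(\<Sum>b\<le>e+1. row_size d k e s b) = (\<Sum>b<Suc e. row_size d k e s b) + row_size d k e s (Suc e)"
      by (simp add: lessThan_Suc_atMost)
    then show ?thesis by (simp only: sum.lessThan_Suc_shift)
  qed
  moreover have "row_size d k e s 0 + tri s = tri (D 0) - tri (D (Suc 0))"
    using s by (simp add: row_size_def D_def)
  moreover have "(\<Sum>b<e. row_size d k e s (Suc b)) = (\<Sum>b<e. tri (D (Suc b)) - tri (D (Suc (Suc b))))"
    by (intro sum.cong) (auto simp: row_size_def D_def)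
  moreover have "row_size d k e s (Suc e) = tri (D (Suc e))" by (simp add: row_size_def D_def)
  moreover have "(\<Sum>b<Suc e. tri (D b) - tri (D (Suc b))) = tri (D 0) - tri (D (Suc 0)) + (\<Sum>b<e. tri (D (Suc b)) - tri (D (Suc (Suc b))))"
    by (rule sum.lessThan_Suc_shift)
  ultimately show ?thesis using tel[of "Suc e"] by (simp add: D_def)
qed

section \<open>Orders of vanishing of degenerating points\<close>

text \<open>A nonzero polynomial has no more roots, counted with multiplicity, than its degree. In
  the limit every row reduces to this one-variable statement.\<close>

lemma hermite_zero:
  fixes g :: "'k::field poly" and n :: nat
  assumes inj: "inj_on \<xi> {..<n}" and dv: "\<And>i. i < n \<Longrightarrow> [:- \<xi> i, 1:] ^ m i dvd g"
    and deg: "\<And>a. a \<ge> h \<Longrightarrow> coeff g a = 0" and h: "h \<le> (\<Sum>i<n. m i)"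
  shows "g = 0"
proof (rule ccontr)
  assume g: "g \<noteq> 0"
  have "degree g < h" using deg[of "degree g"] g by (cases "degree g < h") auto
  have "(\<Sum>i<n. m i) \<le> (\<Sum>i<n. count (proots g) (\<xi> i))"
    using dv g by (intro sum_mono) (auto simp: order_divides)
  also have "\<dots> = (\<Sum>x\<in>\<xi> ` {..<n}. count (proots g) x)" by (simp add: sum.reindex[OF inj])
  also have "\<dots> = (\<Sum>x\<in>\<xi> ` {..<n} \<inter> set_mset (proots g). count (proots g) x)"
    by (intro sum.mono_neutral_right) (auto simp: count_eq_zero_iff simp del: count_proots set_count_proots)
  also have "\<dots> \<le> (\<Sum>x\<in>set_mset (proots g). count (proots g) x)" by (intro sum_mono2) auto
  also have "\<dots> = size (proots g)" by (simp only: size_multiset_overloaded_eq)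
  also have "\<dots> \<le> degree g" by (rule size_proots_le)
  finally show False using \<open>degree g < h\<close> h by simp
qed

text \<open>In \<open>'k poly poly\<close> the inner variable is \<open>X\<close> and the outer one is \<open>Z\<close>;
  in \<open>'k poly poly poly\<close> the outermost variable is the degeneration parameter \<open>t\<close>.\<close>

definition low :: "nat \<Rightarrow> 'k::comm_ring_1 poly poly \<Rightarrow> bool"
  where "low e p \<longleftrightarrow> (\<forall>i j. i + j < e \<longrightarrow> coeff (coeff p j) i = 0)"

definition Low :: "nat \<Rightarrow> 'k::comm_ring_1 poly poly poly \<Rightarrow> bool"
  where "Low e P \<longleftrightarrow> (\<forall>c. low e (coeff P c))"

lemma low_0 [simp]: "low e 0" "low 0 p"
  by (auto simp: low_def)

lemma low_add: "low e p \<Longrightarrow> low e q \<Longrightarrow> low e (p + q)"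
  by (auto simp: low_def)

lemma low_sum: "(\<And>x. x \<in> A \<Longrightarrow> low e (f x)) \<Longrightarrow> low e (sum f A)"
  by (induction A rule: infinite_finite_induct) (auto intro: low_add)

lemma low_mult: "low a p \<Longrightarrow> low b q \<Longrightarrow> low (a + b) (p * q)"
  unfolding low_def coeff_mult coeff_sum
proof (intro allI impI sum.neutral ballI)
  fix i n j l
  assume p: "\<forall>i j. i + j < a \<longrightarrow> coeff (coeff p j) i = 0" and q: "\<forall>i j. i + j < b \<longrightarrow> coeff (coeff q j) i = 0"
    and "i + n < a + b" "j \<in> {..n}" "l \<in> {..i}"
  then have "l + j < a \<or> (i - l) + (n - j) < b" by auto
  then show "coeff (coeff p j) l * coeff (coeff q (n - j)) (i - l) = 0" using p q by auto
qed

lemma low_mono: "low e p \<Longrightarrow> e' \<le> e \<Longrightarrow> low e' p"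
  by (auto simp: low_def)

lemma Low_0 [simp]: "Low e 0" "Low 0 P"
  by (auto simp: Low_def)

lemma Low_add: "Low e P \<Longrightarrow> Low e Q \<Longrightarrow> Low e (P + Q)"
  by (auto simp: Low_def low_add)

lemma Low_sum: "(\<And>x. x \<in> A \<Longrightarrow> Low e (f x)) \<Longrightarrow> Low e (sum f A)"
  by (induction A rule: infinite_finite_induct) (auto intro: Low_add)

lemma Low_mult: "Low a P \<Longrightarrow> Low b Q \<Longrightarrow> Low (a + b) (P * Q)"
  unfolding Low_def coeff_mult by (auto intro!: low_sum low_mult)

lemma Low_mult_left: "Low b Q \<Longrightarrow> Low b (P * Q)"
  using Low_mult[of 0 P b Q] by simp

lemma Low_mono: "Low e p \<Longrightarrow> e' \<le> e \<Longrightarrow> Low e' p"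
  by (auto simp: Low_def intro: low_mono)

lemma Low_power: "Low 1 P \<Longrightarrow> Low n (P ^ n)"
proof (induction n)
  case (Suc n)
  then show ?case using Low_mult[of 1 P n "P ^ n"] by simp
qed simp

text \<open>1 + Z is invertible at X = Z = 0, hence does not change the order of vanishing
  there.\<close>

lemma low_unit_strip: "low e ([:1, 1:] * p) \<Longrightarrow> low e p"
proof -
  assume l: "low e ([:1, 1:] * p)"
  have "i + j < e \<longrightarrow> coeff (coeff p j) i = 0" for i j
  proof (induction j)
    case 0
    then show ?case using l[unfolded low_def, rule_format, of i 0] by simp
  next
    case (Suc j)
    then show ?case using l[unfolded low_def, rule_format, of i "Suc j"] by simp
  qed
  then show ?thesis by (simp add: low_def)
qed

text \<open>The coefficient of each \<open>X ^ i\<close> has degree at most \<open>\<rho>\<close> in \<open>Z\<close> and, when \<open>i + \<rho> < e\<close>,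
  vanishes to order greater than \<open>\<rho>\<close> at the point.\<close>

lemma low_stack:
  fixes \<gamma> :: "nat \<Rightarrow> 'k::field poly"
  assumes l: "low e (\<Sum>s\<le>\<rho>. [:1, 1:] ^ (l + s) * [:\<gamma> s:])" and s: "s \<le> \<rho>" and i: "i + \<rho> < e"
  shows "coeff (\<gamma> s) i = 0"
proof -
  define p where "p = (\<Sum>s\<le>\<rho>. [:1, 1:] ^ s * [:\<gamma> s:])"
  have "low e ([:1, 1:] ^ n * p) \<Longrightarrow> low e p" for n
  proof (induction n)
    case (Suc n)
    then show ?case using low_unit_strip[of e "[:1, 1:] ^ n * p"] by (simp only: power_Suc mult.assoc)
  qed simp
  moreover have "[:1, 1:] ^ l * p = (\<Sum>s\<le>\<rho>. [:1, 1:] ^ (l + s) * [:\<gamma> s:])"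
    by (simp only: p_def sum_distrib_left power_add mult.assoc)
  ultimately have lp: "low e p" using l by metis
  have cf: "coeff ([:1, 1:] ^ s) j = (of_nat (s choose j) :: 'a::comm_ring_1)" for s j
  proof (cases "j \<le> s")
    case True
    then show ?thesis by (simp add: coeff_linear_poly_power)
  next
    case False
    moreover have "degree ([:1, 1 :: 'a:] ^ s) \<le> s"
      using degree_power_le[of "[:1, 1 :: 'a:]" s] by (simp split: if_splits)
    ultimately show ?thesis by (simp add: coeff_eq_0 binomial_eq_0)
  qed
  \<comment> \<open>For fixed i, \<open>Q\<close> composed with 1 + Z is the coefficient of X^i in
    \<open>p\<close>. Its degree in Z is at most \<rho>, and it vanishes modulo Z^(e - i) with e - i
    > \<rho>.\<close>
  define Q where "Q = (\<Sum>s\<le>\<rho>. monom (coeff (\<gamma> s) i) s)"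
  have "coeff (pcompose Q [:1, 1:]) j = 0" for j
  proof -
    have pm: "pcompose (monom a s) [:1, 1:] = smult a ([:1, 1:] ^ s)" for a :: 'k and s
      by (induction s) (simp_all add: monom_0 monom_Suc pcompose_pCons)
    have "coeff (pcompose Q [:1, 1:]) j = (\<Sum>s\<le>\<rho>. coeff (\<gamma> s) i * of_nat (s choose j))"
      by (simp add: Q_def pcompose_sum pm coeff_sum cf)
    also have "\<dots> = coeff (coeff p j) i"
    proof -
      have "coeff (coeff ([:1, 1:] ^ s * [:\<gamma> s:]) j) i = coeff (\<gamma> s) i * of_nat (s choose j)" for s
      proof -
        have "coeff ([:1, 1:] ^ s * [:\<gamma> s:]) j = of_nat (s choose j) * \<gamma> s"
          by (simp add: mult.commute[of _ "[:\<gamma> s:]"] cf)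
        also have "\<dots> = smult (of_nat (s choose j)) (\<gamma> s)" by (simp add: of_nat_poly)
        finally show ?thesis by (simp add: mult.commute)
      qed
      then show ?thesis by (simp add: p_def coeff_sum)
    qed
    also have "\<dots> = 0"
    proof (cases "j \<le> \<rho>")
      case True
      then show ?thesis using lp i by (simp add: low_def)
    next
      case False
      then have "coeff p j = 0" unfolding p_def coeff_sum
      proof (intro sum.neutral ballI)
        fix s assume "s \<in> {..\<rho>}"
        then have "s choose j = 0" using False by simp
        then show "coeff ([:1, 1:] ^ s * [:\<gamma> s:]) j = 0"
          by (simp add: mult.commute[of _ "[:\<gamma> s:]"] cf binomial_eq_0)
      qed
      then show ?thesis by simp
    qed
    finally show ?thesis .
  qed
  then have "pcompose Q [:1, 1:] = 0" by (intro poly_eqI) simp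
  then have "Q = 0" by (rule pcompose_eq_0) simp
  moreover have "coeff Q s = coeff (\<gamma> s) i" using s by (simp add: Q_def coeff_sum)
  ultimately show ?thesis by simp
qed

lemma taylor_shift_dvd:
  fixes g :: "'k::field poly"
  assumes "\<And>i. i < m \<Longrightarrow> coeff (pcompose g [:\<xi>, 1:]) i = 0"
  shows "[:- \<xi>, 1:] ^ m dvd g"
proof -
  have "monom 1 m dvd pcompose g [:\<xi>, 1:]" using assms by (simp add: monom_1_dvd_iff')
  then obtain q where "pcompose g [:\<xi>, 1:] = monom 1 m * q" by (rule dvdE)
  then have "pcompose (pcompose g [:\<xi>, 1:]) [:-\<xi>, 1:] = pcompose (monom 1 m) [:-\<xi>, 1:] * pcompose q [:-\<xi>, 1:]"
    by (simp only: pcompose_mult)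
  moreover have "pcompose (pcompose g [:\<xi>, 1:]) [:-\<xi>, 1:] = g"
    by (simp flip: pcompose_assoc add: pcompose_pCons)
  moreover have "pcompose (monom 1 m) [:-\<xi>, 1:] = [:-\<xi>, 1:] ^ m"
    by (induction m) (simp_all add: monom_0 monom_Suc pcompose_pCons pcompose_1 flip: one_pCons)
  ultimately show ?thesis by simp
qed

section \<open>Exponents and Hasse derivatives\<close>

definition exps :: "nat \<Rightarrow> nat \<Rightarrow> (nat \<times> nat) set"
  where "exps d q = {(a, b). a + b \<le> d \<and> b \<le> q}"

lemma finite_exps [simp]: "finite (exps d q)"
  by (rule finite_subset[of _ "{..d} \<times> {..d}"]) (auto simp: exps_def)

lemma card_exps: "s \<le> d \<Longrightarrow> card (exps d (d - s)) + tri s = tri (d + 1)"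
proof -
  have c: "card (exps d q) = (\<Sum>b\<le>q. d + 1 - b)" if "q \<le> d" for q
  proof -
    have "exps d q = (\<Union>b\<in>{..q}. (\<lambda>a. (a, b)) ` {..<d + 1 - b})"
      using that by (auto simp: exps_def)
    moreover have "card (\<Union>b\<in>{..q}. (\<lambda>a. (a, b)) ` {..<d + 1 - b}) = (\<Sum>b\<le>q. card ((\<lambda>a. (a, b)) ` {..<d + 1 - b}))"
      by (rule card_UN_disjoint) auto
    moreover have "card ((\<lambda>a. (a, b)) ` {..<d + 1 - b}) = d + 1 - b" for b
      by (subst card_image) (auto simp: inj_on_def)
    ultimately show ?thesis by simp
  qed
  have "q \<le> d \<Longrightarrow> (\<Sum>b\<le>q. d + 1 - b) + tri (d - q) = tri (d + 1)" for q
  proof (induction q)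
    case 0
    then show ?case using tri_Suc[of d] by simp
  next
    case (Suc q)
    then have "tri (d - q) = tri (d - Suc q) + (d - q)" using tri_Suc[of "d - Suc q"] by (simp add: Suc_diff_Suc)
    then show ?case using Suc by simp
  qed
  from this[of "d - s"] c[of "d - s"] show "s \<le> d \<Longrightarrow> ?thesis" by simp
qed

text \<open>Hasse derivative of order (\<alpha>, \<beta>) of the monomial with exponents
  \<open>pq\<close>, usable in every characteristic. The truncated exponents are harmless, since the
  binomial coefficient is 0 where truncation occurs.\<close>

definition tay :: "'a::comm_ring_1 \<Rightarrow> 'a \<Rightarrow> nat \<Rightarrow> nat \<Rightarrow> nat \<times> nat \<Rightarrow> 'a"
  where "tay x y \<alpha> \<beta> pq = of_nat (fst pq choose \<alpha>) * of_nat (snd pq choose \<beta>) * x ^ (fst pq - \<alpha>) * y ^ (snd pq - \<beta>)"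

lemma taylor_expand:
  fixes x y u v :: "'a::comm_ring_1"
  assumes "p \<le> d" "q \<le> d"
  shows "(x + u) ^ p * (y + v) ^ q = (\<Sum>\<alpha>\<le>d. \<Sum>\<beta>\<le>d. tay x y \<alpha> \<beta> (p, q) * u ^ \<alpha> * v ^ \<beta>)"
proof -
  have *: "(x + u) ^ p = (\<Sum>\<alpha>\<le>d. of_nat (p choose \<alpha>) * x ^ (p - \<alpha>) * u ^ \<alpha>)" if "p \<le> d" for x u :: 'a and p
  proof -
    have "(x + u) ^ p = (\<Sum>\<alpha>\<le>p. of_nat (p choose \<alpha>) * x ^ (p - \<alpha>) * u ^ \<alpha>)"
      using binomial_ring[of u x p] by (simp add: add.commute mult_ac)
    also have "\<dots> = (\<Sum>\<alpha>\<le>d. of_nat (p choose \<alpha>) * x ^ (p - \<alpha>) * u ^ \<alpha>)"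
      using that by (intro sum.mono_neutral_left) (auto simp: binomial_eq_0)
    finally show ?thesis .
  qed
  show ?thesis unfolding *[OF assms(1)] *[OF assms(2)] sum_product
    by (intro sum.cong refl) (simp add: tay_def mult_ac)
qed

section \<open>Substitution into polynomials in X, Z and t\<close>

type_synonym 'k ppp = "'k poly poly poly"

definition scal :: "'k::field \<Rightarrow> 'k ppp" where "scal c = [:[:[:c:]:]:]"

definition par :: "'k::field poly \<Rightarrow> 'k ppp" where "par = map_poly (\<lambda>c. [:[:c:]:])"

definition sev :: "'k ppp \<Rightarrow> 'k::field poly \<Rightarrow> 'k ppp" where "sev x p = poly (map_poly scal p) x"

lemma scal_hom [simp]: "scal 0 = 0" "scal 1 = 1" "scal (a + b) = scal a + scal b" "scal (a * b) = scal a * scal b"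
  by (simp_all add: scal_def one_pCons)

lemma sev_hom: "sev x 0 = 0" "sev x 1 = 1" "sev x (p + q) = sev x p + sev x q" "sev x (p * q) = sev x p * sev x q"
  "sev x (p ^ n) = sev x p ^ n"
  by (simp_all add: sev_def map_poly_add_hom map_poly_mult_hom map_poly_power_hom)

lemma sev_diff: "sev x (p - q) = sev x p - sev x q"
  using sev_hom(3)[of x "p - q" q] by simp

lemma sev_sum: "sev x (sum f A) = (\<Sum>i\<in>A. sev x (f i))"
  by (induction A rule: infinite_finite_induct) (auto simp: sev_hom)

lemma sev_monom: "sev x (monom c n) = scal c * x ^ n"
  by (simp add: sev_def map_poly_monom poly_monom)

lemma sev_dvd: "p dvd q \<Longrightarrow> sev x p dvd sev x q"
  unfolding dvd_def by (auto simp: sev_hom)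

lemma sev_altdef: "degree p \<le> n \<Longrightarrow> sev x p = (\<Sum>i\<le>n. scal (coeff p i) * x ^ i)"
proof -
  assume n: "degree p \<le> n"
  have "sev x p = sev x (\<Sum>i\<le>n. monom (coeff p i) i)" using poly_as_sum_of_monoms'[OF n] by simp
  then show ?thesis by (simp add: sev_sum sev_monom)
qed

lemma sev_diff_dvd: "x - y dvd sev x p - sev y p"
proof (induction p)
  case (pCons a p)
  have s: "sev z (pCons a p) = scal a + z * sev z p" for z by (simp add: sev_def map_poly_pCons)
  have "sev x (pCons a p) - sev y (pCons a p) = (x - y) * sev x p + y * (sev x p - sev y p)"
    by (simp add: s algebra_simps)
  then show ?case using pCons by simp
qed (simp add: sev_hom)

lemma par_hom: "par 0 = 0" "par 1 = 1" "par (p + q) = par p + par q" "par (p * q) = par p * par q"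
  "par (p ^ n) = par p ^ n"
  by (simp_all add: par_def map_poly_add_hom map_poly_mult_hom map_poly_power_hom map_poly_pCons one_pCons)

lemma par_sum: "par (sum f A) = (\<Sum>i\<in>A. par (f i))"
  by (induction A rule: infinite_finite_induct) (auto simp: par_hom)

lemma par_of_nat: "par (of_nat n) = of_nat n"
  by (induction n) (simp_all add: par_hom)

lemma par_const: "par [:c:] = scal c"
  by (simp add: par_def scal_def map_poly_pCons)

lemma par_monom: "par (monom c n) = scal c * monom 1 n"
  by (simp add: par_def scal_def map_poly_monom smult_monom)

lemma coeff_par: "coeff (par p) n = [:[:coeff p n:]:]"
  by (simp add: par_def coeff_map_poly)

lemma par_pcompose: "par (pcompose p q) = sev (par q) p"
proof (induction p)
  case (pCons a p)
  have s: "sev z (pCons a p) = scal a + z * sev z p" for z by (simp add: sev_def map_poly_pCons)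
  show ?case by (simp only: pcompose_pCons par_hom pCons.IH s par_const)
qed (simp add: par_hom sev_hom)

lemma par_tay: "par (tay x y \<alpha> \<beta> pq) = tay (par x) (par y) \<alpha> \<beta> pq"
  by (simp add: tay_def par_hom par_of_nat)

text \<open>The coefficients lie in k and do not depend on the arguments. So one table of
  coefficients describes a basis function of a row at all points and for all values of t.\<close>

definition rep :: "(nat \<times> nat) set \<Rightarrow> ('k::field ppp \<Rightarrow> 'k ppp \<Rightarrow> 'k ppp) \<Rightarrow> bool"
  where "rep D F \<longleftrightarrow> (\<exists>c. \<forall>x y. F x y = (\<Sum>(p, q)\<in>D. scal (c (p, q)) * x ^ p * y ^ q))"

lemma rep_zero: "rep D (\<lambda>x y. 0)"
  unfolding rep_def by (rule exI[of _ "\<lambda>_. 0"]) simp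

lemma rep_add: "rep D F \<Longrightarrow> rep D G \<Longrightarrow> rep D (\<lambda>x y. F x y + G x y)"
  unfolding rep_def
proof (elim exE)
  fix c c' assume "\<forall>x y. F x y = (\<Sum>(p, q)\<in>D. scal (c (p, q)) * x ^ p * y ^ q)"
    "\<forall>x y. G x y = (\<Sum>(p, q)\<in>D. scal (c' (p, q)) * x ^ p * y ^ q)"
  then show "\<exists>c. \<forall>x y. F x y + G x y = (\<Sum>(p, q)\<in>D. scal (c (p, q)) * x ^ p * y ^ q)"
    by (intro exI[of _ "\<lambda>pq. c pq + c' pq"]) (simp add: sum.distrib[symmetric] case_prod_beta algebra_simps)
qed

lemma rep_sum: "(\<And>i. i \<in> A \<Longrightarrow> rep D (F i)) \<Longrightarrow> rep D (\<lambda>x y. \<Sum>i\<in>A. F i x y)"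
  by (induction A rule: infinite_finite_induct) (auto intro: rep_zero rep_add)

lemma rep_monom: "finite D \<Longrightarrow> (p, q) \<in> D \<Longrightarrow> rep D (\<lambda>x y. scal c * x ^ p * y ^ q)"
  unfolding rep_def
proof (intro exI allI)
  fix x y assume "finite D" "(p, q) \<in> D"
  then have "(\<Sum>(p', q')\<in>D. scal ((if (p', q') = (p, q) then c else 0)) * x ^ p' * y ^ q') =
     (\<Sum>pq\<in>{(p, q)}. scal c * x ^ p * y ^ q)"
    by (intro sum.mono_neutral_cong_right) (auto split: if_splits)
  then show "scal c * x ^ p * y ^ q = (\<Sum>(p', q')\<in>D. scal ((\<lambda>pq. if pq = (p, q) then c else 0) (p', q')) * x ^ p' * y ^ q')"
    by simp
qed

lemma rep_mult:
  assumes "rep D1 F" "rep D2 G" "finite D"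
    and D: "\<And>p q p' q'. (p, q) \<in> D1 \<Longrightarrow> (p', q') \<in> D2 \<Longrightarrow> (p + p', q + q') \<in> D"
  shows "rep D (\<lambda>x y. F x y * G x y)"
proof -
  obtain c c' where F: "\<And>x y. F x y = (\<Sum>(p, q)\<in>D1. scal (c (p, q)) * x ^ p * y ^ q)"
    and G: "\<And>x y. G x y = (\<Sum>(p, q)\<in>D2. scal (c' (p, q)) * x ^ p * y ^ q)"
    using assms(1,2) unfolding rep_def by blast
  have "F x y * G x y = (\<Sum>pq\<in>D1. \<Sum>pq'\<in>D2. scal (c pq * c' pq') * x ^ (fst pq + fst pq') * y ^ (snd pq + snd pq'))" for x y
    unfolding F G sum_product by (intro sum.cong refl) (simp add: case_prod_beta power_add mult_ac)
  moreover have "rep D (\<lambda>x y. (\<Sum>pq\<in>D1. \<Sum>pq'\<in>D2. scal (c pq * c' pq') * x ^ (fst pq + fst pq') * y ^ (snd pq + snd pq')))"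
    using D assms(3) by (intro rep_sum rep_monom) auto
  ultimately show ?thesis by simp
qed

lemma rep_row:
  assumes "\<And>j i. coeff (u j) i \<noteq> 0 \<Longrightarrow> i + j \<le> d \<and> j \<le> q"
  shows "rep (exps d q) (\<lambda>x y. \<Sum>j\<le>n. sev x (u j) * y ^ j)"
proof (rule rep_sum)
  fix j
  have "rep (exps d q) (\<lambda>x y. \<Sum>i\<le>degree (u j). scal (coeff (u j) i) * x ^ i * y ^ j)"
  proof (rule rep_sum)
    fix i
    show "rep (exps d q) (\<lambda>x y. scal (coeff (u j) i) * x ^ i * y ^ j)"
    proof (cases "coeff (u j) i = 0")
      case True
      then show ?thesis by (simp add: rep_zero)
    next
      case False
      then show ?thesis using assms by (intro rep_monom finite_exps) (auto simp: exps_def)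
    qed
  qed
  then show "rep (exps d q) (\<lambda>x y. sev x (u j) * y ^ j)"
    by (simp add: sev_altdef[OF order_refl] sum_distrib_right)
qed

lemma rep_curve_power:
  assumes "degree A < k"
  shows "rep (exps (k * b) b) (\<lambda>x y. (y * sev x A - 1) ^ b)"
proof (induction b)
  case 0
  have "rep (exps 0 0) (\<lambda>x y. scal 1 * x ^ 0 * y ^ 0)" by (intro rep_monom finite_exps) (auto simp: exps_def)
  then show ?case by simp
next
  case (Suc b)
  have "rep (exps k 1) (\<lambda>x y. (\<Sum>i\<le>degree A. scal (coeff A i) * x ^ i * y ^ 1) + scal (-1) * x ^ 0 * y ^ 0)"
    using assms by (intro rep_add rep_sum rep_monom finite_exps) (auto simp: exps_def)
  moreover have "(\<Sum>i\<le>degree A. scal (coeff A i) * x ^ i * y ^ 1) + scal (-1) * x ^ 0 * y ^ 0 = y * sev x A - 1" for x y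
    by (simp add: sev_altdef[OF order_refl] sum_distrib_left mult_ac) (simp add: scal_def one_pCons)
  ultimately have "rep (exps k 1) (\<lambda>x y. y * sev x A - 1)" by simp
  then have "rep (exps (k * Suc b) (Suc b)) (\<lambda>x y. (y * sev x A - 1) * (y * sev x A - 1) ^ b)"
    using Suc.IH finite_exps by (rule rep_mult) (auto simp: exps_def)
  then show ?case by simp
qed

section \<open>Leading terms near the curve\<close>

text \<open>In the hypotheses p P' is the leading part of P with relative error \<tau>. In this form
  leading parts multiply.\<close>

lemma cong_mult:
  fixes P Q p q \<tau> :: "'a::comm_ring_1"
  assumes "\<tau> * p dvd P - p * P'" "\<tau> * q dvd Q - q * Q'"
  shows "\<tau> * (p * q) dvd P * Q - p * q * (P' * Q')"
proof -
  obtain a b where "P = p * P' + \<tau> * p * a" "Q = q * Q' + \<tau> * q * b"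
    using assms unfolding dvd_def by (metis diff_add_cancel add.commute)
  then have "P * Q - p * q * (P' * Q') = \<tau> * (p * q) * (P' * b + a * Q' + \<tau> * a * b)"
    by (simp add: algebra_simps)
  then show ?thesis by simp
qed

lemma cong_power:
  fixes P p \<tau> :: "'a::comm_ring_1"
  assumes "\<tau> * p dvd P - p * P'"
  shows "\<tau> * p ^ n dvd P ^ n - p ^ n * P' ^ n"
proof (induction n)
  case (Suc n)
  then show ?case using cong_mult[OF assms Suc] by (simp add: mult_ac)
qed simp

abbreviation tp :: "nat \<Rightarrow> 'k::field ppp" where "tp n \<equiv> monom 1 n"

definition XX :: "'k::field ppp" where "XX = [:[:[:0, 1:]:]:]"
definition ZZ :: "'k::field ppp" where "ZZ = [:[:0, 1:]:]"

lemma tp_add: "tp (m + n) = tp m * tp n"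
  by (simp add: mult_monom)

lemma tp_power: "tp m ^ n = tp (m * n)"
  by (simp add: monom_power)

lemma tp_dvd: "m \<le> n \<Longrightarrow> tp m dvd tp n"
  by (metis dvd_triv_left le_add_diff_inverse tp_add)

text \<open>Near the curve y A - 1 is (\<phi> A - 1) + t^w A (1 + Z), where \<phi> A - 1 is
  divisible by a high power of x, hence of t, and A is 1 modulo x. In the factor of the row, y may
  be replaced by \<phi>(x) at the cost of t^w, and x^a remains. The lower bound on \<open>w\<close>
  makes this cost negligible against x^a, and the bound on \<open>N\<close> does the same for the
  truncation of 1 / A.\<close>

lemma row_cong:
  fixes A :: "'k::field poly" and u :: "nat \<Rightarrow> 'k poly"
  assumes A: "coeff A 0 = 1" and \<phi>: "\<phi> = (\<Sum>i\<le>N. (1 - A) ^ i)"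
    and M: "1 \<le> M" and w: "M * (a + 1) \<le> w" and N: "w + M \<le> N" and a: "a < h"
    and u: "monom 1 h dvd (\<Sum>j\<le>d. u j * \<phi> ^ j) - monom 1 a"
    and x: "x = tp M * (scal \<xi> + XX)" and y: "y = sev x \<phi> + tp w * (1 + ZZ)"
  shows "tp M * tp (M * a + w * b) dvd (\<Sum>j\<le>d. sev x (u j) * y ^ j) * (y * sev x A - 1) ^ b -
      tp (M * a + w * b) * ((scal \<xi> + XX) ^ a * (1 + ZZ) ^ b)"
proof -
  have xn: "x ^ n = tp (M * n) * (scal \<xi> + XX) ^ n" for n
    by (simp only: x power_mult_distrib tp_power)
  have xdvd: "tp m dvd x ^ n" if "m \<le> M * n" for m n
    using tp_dvd[OF that] xn[of n] by (metis dvd_mult2)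
  have "monom 1 1 dvd (1 - A)" using A by (simp add: monom_1_dvd_iff')
  then have "monom 1 1 ^ Suc N dvd (1 - A) ^ Suc N" by (rule dvd_power_same)
  then have "monom 1 (Suc N) dvd (1 - A) ^ Suc N" by (simp only: monom_power power_one mult_1)
  then have "sev x (monom 1 (Suc N)) dvd sev x ((1 - A) ^ Suc N)" by (rule sev_dvd)
  then have 1: "x ^ Suc N dvd sev x ((1 - A) ^ Suc N)" by (simp only: sev_monom scal_hom mult_1)
  have "A * \<phi> = 1 - (1 - A) ^ Suc N" using sum_gp_basic[of "1 - A" N] by (simp add: \<phi>)
  then have "sev x A * sev x \<phi> = 1 - sev x ((1 - A) ^ Suc N)" by (metis sev_hom(2,4) sev_diff)
  moreover have "w + M \<le> M * Suc N"
  proof -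
    have "w + M \<le> Suc N" using N by simp
    also have "Suc N \<le> M * Suc N" using mult_le_mono1[OF M, of "Suc N"] by simp
    finally show ?thesis .
  qed
  ultimately have c1: "tp (M + w) dvd sev x \<phi> * sev x A - 1"
    using dvd_trans[OF xdvd 1, of "M + w"] by (simp add: mult.commute add.commute)
  have "monom 1 1 dvd A - 1" using A by (simp add: monom_1_dvd_iff')
  then have "sev x (monom 1 1) dvd sev x (A - 1)" by (rule sev_dvd)
  then have "x dvd sev x A - 1" by (simp add: sev_monom sev_diff sev_hom)
  then have c2: "tp M dvd sev x A - 1" using xdvd[of M 1] by (simp add: dvd_trans)
  have C: "tp M * tp w dvd (y * sev x A - 1) - tp w * (1 + ZZ)"
  proof -
    have "(y * sev x A - 1) - tp w * (1 + ZZ) = (sev x \<phi> * sev x A - 1) + tp w * (sev x A - 1) * (1 + ZZ)"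
      by (simp add: y algebra_simps)
    moreover have "tp M * tp w dvd tp w * (sev x A - 1) * (1 + ZZ)"
      using c2 by (simp add: mult.commute[of "tp M"] mult.assoc mult_dvd_mono dvd_mult2)
    ultimately show ?thesis using c1 unfolding tp_add by (simp only: dvd_add)
  qed
  define S where "S = (\<Sum>j\<le>d. sev x (u j) * y ^ j)"
  have "tp M * tp (M * a) dvd S - tp (M * a) * (scal \<xi> + XX) ^ a"
  proof -
    have wd: "tp (M * (a + 1)) dvd tp w" by (rule tp_dvd[OF w])
    have "y - sev x \<phi> dvd y ^ j - sev x \<phi> ^ j" for j
      by (simp only: power_diff_sumr2 dvd_triv_left)
    moreover have "tp (M * (a + 1)) dvd y - sev x \<phi>" unfolding y add_diff_cancel_left' using wd by (rule dvd_mult2)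
    ultimately have "tp (M * (a + 1)) dvd (\<Sum>j\<le>d. sev x (u j) * (y ^ j - sev x \<phi> ^ j))"
      by (intro dvd_sum dvd_mult) (metis dvd_trans)
    moreover have "(\<Sum>j\<le>d. sev x (u j) * (y ^ j - sev x \<phi> ^ j)) = S - sev x (\<Sum>j\<le>d. u j * \<phi> ^ j)"
      by (simp add: S_def sev_sum sev_hom sum_subtractf algebra_simps)
    ultimately have s1: "tp (M * (a + 1)) dvd S - sev x (\<Sum>j\<le>d. u j * \<phi> ^ j)" by simp
    have "sev x (monom 1 h) dvd sev x ((\<Sum>j\<le>d. u j * \<phi> ^ j) - monom 1 a)" by (rule sev_dvd[OF u])
    then have "x ^ h dvd sev x (\<Sum>j\<le>d. u j * \<phi> ^ j) - x ^ a" by (simp add: sev_monom sev_diff)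
    moreover have "tp (M * (a + 1)) dvd x ^ h" using a by (intro xdvd mult_le_mono2) simp
    ultimately have "tp (M * (a + 1)) dvd sev x (\<Sum>j\<le>d. u j * \<phi> ^ j) - x ^ a" by (rule dvd_trans[rotated])
    then have "tp (M * (a + 1)) dvd (S - sev x (\<Sum>j\<le>d. u j * \<phi> ^ j)) + (sev x (\<Sum>j\<le>d. u j * \<phi> ^ j) - x ^ a)"
      using s1 by (intro dvd_add)
    then have "tp (M * (a + 1)) dvd S - x ^ a" by (simp only: diff_add_cancel diff_add_eq add_diff_eq)
    moreover have "tp M * tp (M * a) = (tp (M * (a + 1)) :: 'k ppp)" by (simp add: mult_monom add.commute)
    ultimately show ?thesis by (simp only: xn)
  qed
  from cong_mult[OF this cong_power[OF C, of b]]
  have "tp M * (tp (M * a) * tp w ^ b) dvd S * (y * sev x A - 1) ^ b -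
      tp (M * a) * tp w ^ b * ((scal \<xi> + XX) ^ a * (1 + ZZ) ^ b)" .
  then show ?thesis by (simp only: S_def tp_power tp_add)
qed

text \<open>The combination \<open>G\<close> of all rows, evaluated near the point, is computed
  twice. Taylor expansion and \<open>ker\<close> put it into the ideal (X, Z)^em; the leading terms
  show its coefficient at t^(L + C b). There only rows b' with C b' \<le> C b occur, which by
  \<open>int\<close> form em - mm + 1 consecutive powers of 1 + Z, and \<open>low_stack\<close>
  gives order mm in X for row b. Cheaper rows enter with higher coefficients of \<open>v\<close>;
  row b enters with its value at t = 0.\<close>

lemma point_order:
  fixes v :: "nat \<times> nat \<Rightarrow> 'k::field poly" and B :: "nat \<Rightarrow> nat \<Rightarrow> nat \<times> nat \<Rightarrow> 'k"
    and h C :: "nat \<Rightarrow> nat" and R :: nat and E :: "nat \<Rightarrow> nat \<Rightarrow> nat"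
  defines "I \<equiv> SIGMA b:{..R}. {..<h b}"
  assumes rep: "\<And>b a. b \<le> R \<Longrightarrow> a < h b \<Longrightarrow> F b a = (\<Sum>(p, q)\<in>D. scal (B b a (p, q)) * x ^ p * y ^ q)"
    and D: "D \<subseteq> {..d} \<times> {..d}"
    and x: "x = tp M * (scal \<xi> + XX)" and y: "y = sev x \<phi> + tp w * (1 + ZZ)"
    and cong: "\<And>b a. b \<le> R \<Longrightarrow> a < h b \<Longrightarrow> tp M * tp (M * a + w * b) dvd
       F b a - tp (M * a + w * b) * ((scal \<xi> + XX) ^ a * (1 + ZZ) ^ b)"
    and E: "\<And>b a. b \<le> R \<Longrightarrow> a < h b \<Longrightarrow> E b a + M * a + w * b = L + C b"
    and xt: "xt = monom \<xi> M" and yt: "yt = pcompose \<phi> xt + monom 1 w"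
    and ker: "\<And>\<alpha> \<beta>. \<alpha> + \<beta> < em \<Longrightarrow>
       (\<Sum>(b, a)\<in>I. (\<Sum>pq\<in>D. [:B b a pq:] * monom 1 (E b a) * tay xt yt \<alpha> \<beta> pq) * v (b, a)) = 0"
    and CM: "\<And>b. b \<le> R \<Longrightarrow> C b < M"
    and b: "b \<le> R" and mm: "mm \<le> em"
    and int: "{b'. b' \<le> R \<and> C b' \<le> C b} = {l..l + (em - mm)}"
  shows "[:- \<xi>, 1:] ^ mm dvd (\<Sum>a<h b. monom (coeff (v (b, a)) 0) a)"
proof -
  define U :: "'k ppp" where "U = tp M * XX"
  \<comment> \<open>The difference in y comes also from \<phi>(x), but this part is divisible by
    \<open>U\<close>, so V still vanishes at X = Z = 0.\<close>
  define V :: "'k ppp" where "V = (sev x \<phi> - sev (par xt) \<phi>) + tp w * ZZ"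
  have parx: "par xt = tp M * scal \<xi>" by (simp add: xt par_monom mult.commute)
  have xU: "x = par xt + U" by (simp add: x parx U_def algebra_simps)
  have yV: "y = par yt + V"
    by (simp add: y yt V_def par_hom par_pcompose par_monom algebra_simps)
  have "low 1 (coeff XX c :: 'k poly poly)" for c
    unfolding XX_def low_def by (cases c) (auto simp: coeff_pCons split: nat.splits)
  then have LX: "Low 1 (XX :: 'k ppp)" by (simp add: Low_def)
  have "low 1 (coeff ZZ c :: 'k poly poly)" for c
    unfolding ZZ_def low_def by (cases c) (auto simp: coeff_pCons split: nat.splits)
  then have LZ: "Low 1 (ZZ :: 'k ppp)" by (simp add: Low_def)
  have LU: "Low 1 U" unfolding U_def by (rule Low_mult_left[OF LX])
  have "x - par xt dvd sev x \<phi> - sev (par xt) \<phi>" by (rule sev_diff_dvd)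
  then obtain q where "sev x \<phi> - sev (par xt) \<phi> = q * U" unfolding xU by (auto simp: dvd_def mult.commute)
  then have LV: "Low 1 V" unfolding V_def using LU LZ by (auto intro!: Low_add Low_mult_left)
  define G :: "'k ppp" where "G = (\<Sum>(b, a)\<in>I. par (v (b, a)) * tp (E b a) * F b a)"
  define m where "m \<alpha> \<beta> ba = (case ba of (b, a) \<Rightarrow>
     (\<Sum>pq\<in>D. [:B b a pq:] * monom 1 (E b a) * tay xt yt \<alpha> \<beta> pq) * v (b, a))" for \<alpha> \<beta> ba
  have summand: "par (v (b, a)) * tp (E b a) * F b a = (\<Sum>\<alpha>\<le>d. \<Sum>\<beta>\<le>d. par (m \<alpha> \<beta> (b, a)) * U ^ \<alpha> * V ^ \<beta>)"
    if "b \<le> R" "a < h b" for a b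
  proof -
    have "F b a = (\<Sum>(p, q)\<in>D. scal (B b a (p, q)) * (\<Sum>\<alpha>\<le>d. \<Sum>\<beta>\<le>d. tay (par xt) (par yt) \<alpha> \<beta> (p, q) * U ^ \<alpha> * V ^ \<beta>))"
      unfolding rep[OF that]
    proof (intro sum.cong refl, clarify)
      fix p q assume "(p, q) \<in> D"
      then have "p \<le> d" "q \<le> d" using D by auto
      then show "scal (B b a (p, q)) * x ^ p * y ^ q =
        scal (B b a (p, q)) * (\<Sum>\<alpha>\<le>d. \<Sum>\<beta>\<le>d. tay (par xt) (par yt) \<alpha> \<beta> (p, q) * U ^ \<alpha> * V ^ \<beta>)"
        using taylor_expand[of p d q "par xt" U "par yt" V] by (simp only: xU yV mult.assoc)
    qed
    also have "\<dots> = (\<Sum>pq\<in>D. \<Sum>\<alpha>\<le>d. \<Sum>\<beta>\<le>d. scal (B b a pq) * tay (par xt) (par yt) \<alpha> \<beta> pq * U ^ \<alpha> * V ^ \<beta>)"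
      by (intro sum.cong refl) (simp add: case_prod_beta sum_distrib_left mult.assoc)
    also have "\<dots> = (\<Sum>\<alpha>\<le>d. \<Sum>pq\<in>D. \<Sum>\<beta>\<le>d. scal (B b a pq) * tay (par xt) (par yt) \<alpha> \<beta> pq * U ^ \<alpha> * V ^ \<beta>)"
      by (rule sum.swap)
    also have "\<dots> = (\<Sum>\<alpha>\<le>d. \<Sum>\<beta>\<le>d. \<Sum>pq\<in>D. scal (B b a pq) * tay (par xt) (par yt) \<alpha> \<beta> pq * U ^ \<alpha> * V ^ \<beta>)"
      by (intro sum.cong refl sum.swap)
    finally have Fe: "F b a = (\<Sum>\<alpha>\<le>d. \<Sum>\<beta>\<le>d. \<Sum>pq\<in>D. scal (B b a pq) * tay (par xt) (par yt) \<alpha> \<beta> pq * U ^ \<alpha> * V ^ \<beta>)" .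
    have pm: "par (m \<alpha> \<beta> (b, a)) = (\<Sum>pq\<in>D. scal (B b a pq) * tp (E b a) * tay (par xt) (par yt) \<alpha> \<beta> pq) * par (v (b, a))" for \<alpha> \<beta>
      unfolding m_def prod.case by (simp only: par_hom par_sum par_const par_monom par_tay scal_hom mult_1)
    show ?thesis unfolding Fe pm
      by (simp add: sum_distrib_left sum_distrib_right mult_ac)
  qed
  have "G = (\<Sum>ba\<in>I. \<Sum>\<alpha>\<le>d. \<Sum>\<beta>\<le>d. par (m \<alpha> \<beta> ba) * U ^ \<alpha> * V ^ \<beta>)"
    unfolding G_def by (intro sum.cong refl) (auto simp: I_def summand simp del: sum.atMost_Suc)
  also have "\<dots> = (\<Sum>\<alpha>\<le>d. \<Sum>ba\<in>I. \<Sum>\<beta>\<le>d. par (m \<alpha> \<beta> ba) * U ^ \<alpha> * V ^ \<beta>)" by (rule sum.swap)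
  also have "\<dots> = (\<Sum>\<alpha>\<le>d. \<Sum>\<beta>\<le>d. \<Sum>ba\<in>I. par (m \<alpha> \<beta> ba) * U ^ \<alpha> * V ^ \<beta>)"
    by (intro sum.cong refl sum.swap)
  also have "\<dots> = (\<Sum>\<alpha>\<le>d. \<Sum>\<beta>\<le>d. par (\<Sum>ba\<in>I. m \<alpha> \<beta> ba) * U ^ \<alpha> * V ^ \<beta>)"
    by (simp only: par_sum sum_distrib_right)
  finally have Ge: "G = (\<Sum>\<alpha>\<le>d. \<Sum>\<beta>\<le>d. par (\<Sum>ba\<in>I. m \<alpha> \<beta> ba) * U ^ \<alpha> * V ^ \<beta>)" .
  have LG: "Low em G"
    unfolding Ge
  proof (intro Low_sum)
    fix \<alpha> \<beta>
    show "Low em (par (\<Sum>ba\<in>I. m \<alpha> \<beta> ba) * U ^ \<alpha> * V ^ \<beta>)"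
    proof (cases "\<alpha> + \<beta> < em")
      case True
      have "(\<Sum>ba\<in>I. m \<alpha> \<beta> ba) = 0"
        using ker[OF True] unfolding m_def by (simp add: case_prod_beta)
      then show ?thesis by (simp add: par_hom)
    next
      case False
      have "Low (\<alpha> + \<beta>) (U ^ \<alpha> * V ^ \<beta>)" by (intro Low_mult Low_power LU LV)
      then have "Low em (U ^ \<alpha> * V ^ \<beta>)" using False by (auto intro: Low_mono)
      then show ?thesis unfolding mult.assoc by (rule Low_mult_left)
    qed
  qed
  define g :: "nat \<Rightarrow> nat \<Rightarrow> 'k poly poly" where "g b a = [:[:\<xi>, 1:]:] ^ a * [:1, 1 :: 'k poly:] ^ b" for b a :: nat
  have gconst: "(scal \<xi> + XX) ^ a * (1 + ZZ) ^ b = [:g b a:]" for b a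
  proof -
    have "scal \<xi> + XX = [:[:[:\<xi>, 1:]:]:]" by (simp add: scal_def XX_def)
    moreover have "1 + ZZ = [:[:1, 1 :: 'k poly:]:]" by (simp add: ZZ_def one_pCons)
    moreover have cp: "[:p:] ^ n = [:p ^ n:]" for p :: "'k poly poly" and n
      by (induction n) (simp_all add: one_pCons)
    ultimately show ?thesis by (simp add: g_def)
  qed
  have Gcong: "tp (L + M) dvd G - (\<Sum>(b, a)\<in>I. par (v (b, a)) * tp (L + C b) * [:g b a:])"
  proof -
    have "tp (L + M) dvd par (v (b, a)) * tp (E b a) * F b a - par (v (b, a)) * tp (L + C b) * [:g b a:]"
      if ba: "b \<le> R" "a < h b" for a b
    proof -
      have "tp (E b a) * (tp M * tp (M * a + w * b)) dvd tp (E b a) * (F b a - tp (M * a + w * b) * [:g b a:])"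
        using cong[OF ba] unfolding gconst by (intro mult_dvd_mono dvd_refl)
      note 1 = this
      have e: "tp (E b a) * tp (M * a + w * b) = (tp (L + C b) :: 'k ppp)"
        using E[OF ba] by (simp add: mult_monom add.assoc)
      have "tp (E b a) * (tp M * tp (M * a + w * b)) = (tp (L + C b) * tp M :: 'k ppp)"
        unfolding e[symmetric] by (simp only: mult_ac)
      then have "tp (L + M) dvd (tp (E b a) * (tp M * tp (M * a + w * b)) :: 'k ppp)"
        by (simp only: tp_dvd add_le_mono1 le_add1 flip: tp_add)
      from dvd_trans[OF this 1]
      have "tp (L + M) dvd tp (E b a) * F b a - tp (L + C b) * [:g b a:]"
        by (simp only: right_diff_distrib mult.assoc[symmetric] e)
      then have "tp (L + M) dvd par (v (b, a)) * (tp (E b a) * F b a - tp (L + C b) * [:g b a:])" by (rule dvd_mult)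
      then show ?thesis by (simp only: right_diff_distrib mult.assoc)
    qed
    then show ?thesis unfolding G_def sum_subtractf[symmetric]
      by (intro dvd_sum) (auto simp: I_def)
  qed
  define c where "c = C b"
  define \<rho> where "\<rho> = em - mm"
  define \<gamma> where "\<gamma> b = (\<Sum>a<h b. smult (coeff (v (b, a)) (c - C b)) ([:\<xi>, 1:] ^ a))" for b
  \<comment> \<open>\<open>Gcong\<close> determines G below t^(L + M), and C b < M.\<close>
  have "coeff G (L + c) = coeff (\<Sum>(b, a)\<in>I. par (v (b, a)) * tp (L + C b) * [:g b a:]) (L + c)"
    using Gcong CM[OF b] by (simp add: monom_1_dvd_iff' c_def)
  also have "\<dots> = (\<Sum>(b, a)\<in>I. if C b \<le> c then [:[:coeff (v (b, a)) (c - C b):]:] * g b a else 0)"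
    unfolding coeff_sum
    by (intro sum.cong refl) (auto simp: coeff_mult_monom_right coeff_par mult.commute)
  also have "\<dots> = (\<Sum>b\<le>R. \<Sum>a<h b. if C b \<le> c then [:[:coeff (v (b, a)) (c - C b):]:] * g b a else 0)"
    unfolding I_def by (rule sum.Sigma[symmetric]) auto
  also have "\<dots> = (\<Sum>b\<le>R. if C b \<le> c then [:1, 1:] ^ b * [:\<gamma> b:] else 0)"
  proof (intro sum.cong refl)
    fix b
    have cp: "[:p:] ^ n = [:p ^ n:]" for p :: "'k poly" and n
      by (induction n) (simp_all add: one_pCons)
    have cs: "(\<Sum>i\<in>J. [:f i:]) = [:sum f J:]" for f :: "nat \<Rightarrow> 'k poly" and J
      by (induction J rule: infinite_finite_induct) auto
    have "(\<Sum>a<h b. [:[:coeff (v (b, a)) (c - C b):]:] * g b a) =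
       (\<Sum>a<h b. [:1, 1:] ^ b * [:smult (coeff (v (b, a)) (c - C b)) ([:\<xi>, 1:] ^ a):])"
      by (intro sum.cong refl) (simp add: g_def cp mult.commute)
    also have "\<dots> = [:1, 1:] ^ b * [:\<gamma> b:]" by (simp only: sum_distrib_left[symmetric] cs \<gamma>_def)
    finally show "(\<Sum>a<h b. if C b \<le> c then [:[:coeff (v (b, a)) (c - C b):]:] * g b a else 0) =
       (if C b \<le> c then [:1, 1:] ^ b * [:\<gamma> b:] else 0)" by simp
  qed
  also have "\<dots> = (\<Sum>b\<in>{l..l + \<rho>}. [:1, 1:] ^ b * [:\<gamma> b:])"
    unfolding int[folded \<rho>_def, symmetric] c_def
    by (intro sum.mono_neutral_cong_right) auto
  also have "\<dots> = (\<Sum>s\<le>\<rho>. [:1, 1:] ^ (l + s) * [:\<gamma> (l + s):])"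
    by (rule sum.reindex_bij_witness[of _ "\<lambda>s. l + s" "\<lambda>b. b - l"]) auto
  finally have "low em (\<Sum>s\<le>\<rho>. [:1, 1:] ^ (l + s) * [:\<gamma> (l + s):])"
    using LG unfolding Low_def by metis
  note stack = low_stack[OF this]
  have bl: "b \<in> {l..l + \<rho>}" unfolding \<rho>_def int[symmetric] using b by simp
  have "coeff (\<gamma> b) i = 0" if "i < mm" for i
  proof -
    have "b - l \<le> \<rho>" "l + (b - l) = b" "i + \<rho> < em" using bl that mm by (auto simp: \<rho>_def)
    then show ?thesis using stack[of "b - l" i] by simp
  qed
  moreover have "\<gamma> b = pcompose (\<Sum>a<h b. monom (coeff (v (b, a)) 0) a) [:\<xi>, 1:]"
  proof -
    have pm: "pcompose (monom z s) [:\<xi>, 1:] = smult z ([:\<xi>, 1:] ^ s)" for z :: 'k and s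
      by (induction s) (simp_all add: monom_0 monom_Suc pcompose_pCons)
    show ?thesis by (simp add: \<gamma>_def c_def pcompose_sum pm)
  qed
  ultimately show ?thesis by (intro taylor_shift_dvd) simp
qed

lemma poly_tay: "poly (tay x y \<alpha> \<beta> pq) t = tay (poly x t) (poly y t) \<alpha> \<beta> pq"
  by (simp add: tay_def)

text \<open>The weights t^(E b a) make point i see row b with the exponent L + C i b. One choice of
  \<open>E\<close> serves all points, because the exponents w i = c0 + v i differ from
  \<open>c0\<close> only by the speeds, and these are part of the costs. Hermite interpolation on
  each row then kills the constant terms of every kernel vector.\<close>

theorem degenerate_injective:
  fixes A :: "'k::field poly" and h em :: "nat \<Rightarrow> nat" and mm C :: "nat \<Rightarrow> nat \<Rightarrow> nat"
    and \<pi> v :: "nat \<Rightarrow> int" and n R k d s :: nat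
  assumes inf: "infinite (UNIV :: 'k set)" and A0: "coeff A 0 = 1" and Ak: "degree A < k"
    and rows: "\<And>b a. b \<le> R \<Longrightarrow> a < h b \<Longrightarrow> \<exists>u. (\<forall>j i. coeff (u j) i \<noteq> 0 \<longrightarrow> i + j \<le> d - k * b \<and> (b = 0 \<longrightarrow> j \<le> d - s)) \<and>
        (\<forall>N\<ge>h b. monom 1 (h b) dvd (\<Sum>j\<le>d. u j * (\<Sum>i\<le>N. (1 - A) ^ i) ^ j) - monom 1 a)"
    and kb: "\<And>b. b \<le> R \<Longrightarrow> 0 < h b \<Longrightarrow> k * b \<le> d" and sk: "s = 0 \<or> s + 1 \<le> k"
    and cardD: "card (exps d (d - s)) \<le> (\<Sum>b\<le>R. h b)"
    and C: "\<And>i b. i < n \<Longrightarrow> b \<le> R \<Longrightarrow> int (C i b) = \<pi> b + v i * int b"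
    and int: "\<And>i b. i < n \<Longrightarrow> b \<le> R \<Longrightarrow> 0 < mm i b \<Longrightarrow>
        mm i b \<le> em i \<and> (\<exists>l. {b'. b' \<le> R \<and> C i b' \<le> C i b} = {l..l + (em i - mm i b)})"
    and hm: "\<And>b. b \<le> R \<Longrightarrow> h b \<le> (\<Sum>i<n. mm i b)"
  shows "\<exists>x y :: nat \<Rightarrow> 'k. \<forall>c. (\<forall>i<n. \<forall>\<alpha> \<beta>. \<alpha> + \<beta> < em i \<longrightarrow>
      (\<Sum>pq\<in>exps d (d - s). c pq * tay (x i) (y i) \<alpha> \<beta> pq) = 0) \<longrightarrow> (\<forall>pq\<in>exps d (d - s). c pq = 0)"
proof -
  define D :: "(nat \<times> nat) set" where "D = exps d (d - s)"
  have finD: "finite D" and Dsub: "D \<subseteq> {..d} \<times> {..d}"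
    unfolding D_def by (simp, auto simp: exps_def)
  define I where "I = (SIGMA b:{..R}. {..<h b})"
  have finI: "finite I" and cardI: "card I = (\<Sum>b\<le>R. h b)" by (auto simp: I_def)
  obtain \<xi> :: "nat \<Rightarrow> 'k" where \<xi>: "inj \<xi>" using inf infinite_countable_subset by blast
  define M where "M = Suc (\<Sum>i<n. \<Sum>b\<le>R. C i b)"
  define Hm where "Hm = (\<Sum>b\<le>R. h b)"
  define V where "V = (\<Sum>i<n. nat \<bar>v i\<bar>)"
  \<comment> \<open>Large enough that w i \<ge> M (a + 1) holds on every row, whatever the sign of
    the speed.\<close>
  define c0 where "c0 = M * (Hm + 1) + V"
  define w where "w i = nat (int c0 + v i)" for i
  define N where "N = c0 + V + M + Hm"
  define \<phi> where "\<phi> = (\<Sum>i\<le>N. (1 - A) ^ i)"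
  define L where "L = c0 * R + M * Hm + (\<Sum>b\<le>R. nat \<bar>\<pi> b\<bar>)"
  define E where "E b a = nat (int L + \<pi> b - int c0 * int b - int M * int a)" for b a
  define xt where "xt i = monom (\<xi> i) M" for i :: nat
  define yt where "yt i = pcompose \<phi> (xt i) + monom 1 (w i)" for i
  have CM: "C i b < M" if "i < n" "b \<le> R" for i b
  proof -
    have "C i b \<le> (\<Sum>b\<le>R. C i b)" using that by (intro member_le_sum) auto
    also have "\<dots> \<le> (\<Sum>i<n. \<Sum>b\<le>R. C i b)" using that by (intro member_le_sum[of i "{..<n}" "\<lambda>i. \<Sum>b\<le>R. C i b"]) auto
    finally show ?thesis by (simp add: M_def)
  qed
  have hH: "h b \<le> Hm" if "b \<le> R" for b
    unfolding Hm_def using that by (intro member_le_sum) auto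
  have vV: "\<bar>v i\<bar> \<le> int V" if "i < n" for i
  proof -
    have "nat \<bar>v i\<bar> \<le> V" unfolding V_def using that by (intro member_le_sum[of i "{..<n}" "\<lambda>i. nat \<bar>v i\<bar>"]) auto
    then show ?thesis by linarith
  qed
  have wi: "int (w i) = int c0 + v i" if "i < n" for i
  proof -
    have "int V \<le> int c0" by (simp add: c0_def)
    then show ?thesis using vV[OF that] unfolding w_def by linarith
  qed
  have w_lower: "M * (a + 1) \<le> w i" if "i < n" "a \<le> Hm" for i a
  proof -
    have "M * (a + 1) \<le> M * (Hm + 1)" using that by (intro mult_le_mono2) simp
    moreover have "int (M * (Hm + 1)) \<le> int (w i)" using wi[OF that(1)] vV[OF that(1)] by (simp add: c0_def)
    ultimately show ?thesis by linarith
  qed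
  have w_upper: "w i + M \<le> N" if "i < n" for i
  proof -
    have "int (w i) \<le> int (c0 + V)" using wi[OF that] vV[OF that] by simp
    then show ?thesis unfolding N_def by linarith
  qed
  have E: "E b a + M * a + w i * b = L + C i b" if "i < n" "b \<le> R" "a < h b" for i b a
  proof -
    have "nat \<bar>\<pi> b\<bar> \<le> (\<Sum>b\<le>R. nat \<bar>\<pi> b\<bar>)" using that by (intro member_le_sum) auto
    moreover have "c0 * b \<le> c0 * R" using that by (intro mult_le_mono2)
    moreover have "M * a \<le> M * Hm" using that hH[of b] by (intro mult_le_mono2) simp
    ultimately have "nat \<bar>\<pi> b\<bar> + c0 * b + M * a \<le> L" unfolding L_def by linarith
    then have "int (nat \<bar>\<pi> b\<bar>) + int c0 * int b + int M * int a \<le> int L"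
      by (simp only: flip: of_nat_mult of_nat_add)
    then have "int (E b a) = int L + \<pi> b - int c0 * int b - int M * int a"
      unfolding E_def by linarith
    then have "int (E b a + M * a + w i * b) = int (L + C i b)"
      by (simp add: wi[OF that(1)] C[OF that(1,2)] algebra_simps)
    then show ?thesis by linarith
  qed
  obtain u where u1: "\<And>b a j i. b \<le> R \<Longrightarrow> a < h b \<Longrightarrow> coeff (u b a j) i \<noteq> 0 \<Longrightarrow> i + j \<le> d - k * b \<and> (b = 0 \<longrightarrow> j \<le> d - s)"
    and u2: "\<And>b a. b \<le> R \<Longrightarrow> a < h b \<Longrightarrow> monom 1 (h b) dvd (\<Sum>j\<le>d. u b a j * \<phi> ^ j) - monom 1 a"
  proof -
    have "\<exists>u. b \<le> R \<longrightarrow> a < h b \<longrightarrow> (\<forall>j i. coeff (u j) i \<noteq> 0 \<longrightarrow> i + j \<le> d - k * b \<and> (b = 0 \<longrightarrow> j \<le> d - s)) \<and>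
        monom 1 (h b) dvd (\<Sum>j\<le>d. u j * \<phi> ^ j) - monom 1 a" for b a
    proof (cases "b \<le> R \<and> a < h b")
      case True
      then have "h b \<le> N" using hH by (auto simp: N_def intro: trans_le_add2)
      then show ?thesis using rows[of b a] True unfolding \<phi>_def by blast
    qed blast
    then show ?thesis using that by metis
  qed
  define F where "F b a x y = (\<Sum>j\<le>d. sev x (u b a j) * y ^ j) * (y * sev x A - 1) ^ b" for b a x y
  obtain B where B: "\<And>b a x y. b \<le> R \<Longrightarrow> a < h b \<Longrightarrow>
      F b a x y = (\<Sum>(p, q)\<in>D. scal (B b a (p, q)) * x ^ p * y ^ q)"
  proof -
    have "rep D (F b a)" if "b \<le> R" "a < h b" for b a
      unfolding F_def
    proof (rule rep_mult)
      show "rep (exps (d - k * b) (if b = 0 then d - s else d - k * b)) (\<lambda>x y. \<Sum>j\<le>d. sev x (u b a j) * y ^ j)"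
        using u1[OF that] by (intro rep_row) (auto intro: add_leD2)
      show "rep (exps (k * b) b) (\<lambda>x y. (y * sev x A - 1) ^ b)" by (rule rep_curve_power[OF Ak])
      fix p q p' q'
      assume p: "(p, q) \<in> exps (d - k * b) (if b = 0 then d - s else d - k * b)" "(p', q') \<in> exps (k * b) b"
      have kb': "k * b \<le> d" using kb[OF that(1)] that(2) by simp
      show "(p + p', q + q') \<in> D"
      proof (cases "b = 0")
        case False
        \<comment> \<open>The factor (y A - 1)^b raises the exponent of y by at most b, while the
          degree left for the jet is smaller by k b. As s + 1 \<le> k, no exponent of y above d - s
          arises.\<close>
        have "b + s \<le> k * b"
        proof -
          have "s + 1 \<le> k" using sk Ak by auto
          then have "(s + 1) * b \<le> k * b" by (rule mult_le_mono1)
          moreover have "s * 1 \<le> s * b" using False by (intro mult_le_mono2) simp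
          ultimately show ?thesis unfolding add_mult_distrib mult_1 mult_1_right by linarith
        qed
        then show ?thesis using p False kb' by (auto simp: D_def exps_def)
      qed (use p in \<open>auto simp: D_def exps_def\<close>)
    qed (rule finD)
    then have ex: "\<exists>c. b \<le> R \<longrightarrow> a < h b \<longrightarrow> (\<forall>x y. F b a x y = (\<Sum>(p, q)\<in>D. scal (c (p, q)) * x ^ p * y ^ q))" for b a
      unfolding rep_def by blast
    have "\<forall>b. \<exists>c. \<forall>a. b \<le> R \<longrightarrow> a < h b \<longrightarrow> (\<forall>x y. F b a x y = (\<Sum>(p, q)\<in>D. scal (c a (p, q)) * x ^ p * y ^ q))"
      by (rule allI, rule choice, rule allI, rule ex)
    from choice[OF this] that show ?thesis by blast
  qed
  define J where "J = {(i, \<alpha>, \<beta>). i < n \<and> \<alpha> + \<beta> < em i}"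
  define m where "m j ba = (case j of (i, \<alpha>, \<beta>) \<Rightarrow> case ba of (b, a) \<Rightarrow>
      (\<Sum>pq\<in>D. [:B b a pq:] * monom 1 (E b a) * tay (xt i) (yt i) \<alpha> \<beta> pq))" for j :: "nat \<times> nat \<times> nat" and ba
  have kernel: "\<forall>ba\<in>I. coeff (z ba) 0 = 0" if z: "\<forall>j\<in>J. (\<Sum>ba\<in>I. m j ba * z ba) = 0" for z
  proof -
    have "(\<Sum>a<h b. monom (coeff (z (b, a)) 0) a) = 0" if b: "b \<le> R" for b
    proof (rule hermite_zero)
      show "inj_on \<xi> {..<n}" using \<xi> by (rule inj_on_subset) simp
      show "h b \<le> (\<Sum>i<n. mm i b)" using hm[OF b] .
      show "coeff (\<Sum>a<h b. monom (coeff (z (b, a)) 0) a) a = 0" if "h b \<le> a" for a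
        using that by (simp add: coeff_sum)
      fix i assume i: "i < n"
      show "[:- \<xi> i, 1:] ^ mm i b dvd (\<Sum>a<h b. monom (coeff (z (b, a)) 0) a)"
      proof (cases "mm i b = 0")
        case False
        then obtain l where l: "mm i b \<le> em i" "{b'. b' \<le> R \<and> C i b' \<le> C i b} = {l..l + (em i - mm i b)}"
          using int[OF i b] by blast
        define x where "x = tp M * (scal (\<xi> i) + XX)"
        define y where "y = sev x \<phi> + tp (w i) * (1 + ZZ)"
        show ?thesis
        proof (rule point_order)
          show "F b a x y = (\<Sum>(p, q)\<in>D. scal (B b a (p, q)) * x ^ p * y ^ q)" if "b \<le> R" "a < h b" for b a
            using B[OF that] .
          show "tp M * tp (M * a + w i * b) dvd F b a x y - tp (M * a + w i * b) * ((scal (\<xi> i) + XX) ^ a * (1 + ZZ) ^ b)"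
            if "b \<le> R" "a < h b" for b a
            unfolding F_def
          proof (rule row_cong[OF A0 \<phi>_def _ _ w_upper[OF i] that(2) u2[OF that] x_def y_def])
            show "1 \<le> M" by (simp add: M_def)
            show "M * (a + 1) \<le> w i" using hH[OF that(1)] that(2) by (intro w_lower[OF i]) simp
          qed
          show "E b a + M * a + w i * b = L + C i b" if "b \<le> R" "a < h b" for b a
            using E[OF i that] .
          show "(\<Sum>(b, a)\<in>(SIGMA b:{..R}. {..<h b}). (\<Sum>pq\<in>D. [:B b a pq:] * monom 1 (E b a) * tay (xt i) (yt i) \<alpha> \<beta> pq) * z (b, a)) = 0"
            if "\<alpha> + \<beta> < em i" for \<alpha> \<beta>
          proof -
            have "(\<Sum>ba\<in>I. m (i, \<alpha>, \<beta>) ba * z ba) = 0" using z that i by (auto simp: J_def)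
            then show ?thesis unfolding I_def m_def by (simp add: case_prod_beta)
          qed
        qed (use CM i b l Dsub in \<open>auto simp: x_def y_def xt_def yt_def\<close>)
      qed simp
    qed
    then have "coeff (\<Sum>a'<h b. monom (coeff (z (b, a')) 0) a') a = 0" if "b \<le> R" for a b using that by simp
    moreover have "coeff (\<Sum>a'<h b. monom (coeff (z (b, a')) 0) a') a = coeff (z (b, a)) 0" if "a < h b" for a b
      using that by (simp add: coeff_sum)
    ultimately show ?thesis unfolding I_def by auto metis
  qed
  have "finite {t. \<not> (\<forall>z. (\<forall>j\<in>J. (\<Sum>ba\<in>I. poly (m j ba) t * z ba) = 0) \<longrightarrow> (\<forall>ba\<in>I. z ba = 0))}"
    by (rule generic_injective[OF finI]) (use kernel in blast)
  then obtain t where t: "\<And>z. (\<forall>j\<in>J. (\<Sum>ba\<in>I. poly (m j ba) t * z ba) = 0) \<Longrightarrow> (\<forall>ba\<in>I. z ba = 0)"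
    using inf ex_new_if_finite by fastforce
  define x where "x i = poly (xt i) t" for i
  define y where "y i = poly (yt i) t" for i
  \<comment> \<open>The change from row coordinates to coefficients of monomials. That the rows span
    is not shown beforehand: \<open>T\<close> is injective because the conditions on
    \<open>z\<close> are, and the count \<open>cardD\<close> then makes it surjective.\<close>
  define T where "T pq ba = (case ba of (b, a) \<Rightarrow> B b a pq * t ^ E b a)" for pq ba
  have comp: "(\<Sum>ba\<in>I. poly (m (i, \<alpha>, \<beta>) ba) t * z ba) = (\<Sum>pq\<in>D. (\<Sum>ba\<in>I. T pq ba * z ba) * tay (x i) (y i) \<alpha> \<beta> pq)" for i \<alpha> \<beta> z
  proof -
    have "(\<Sum>ba\<in>I. poly (m (i, \<alpha>, \<beta>) ba) t * z ba) = (\<Sum>ba\<in>I. \<Sum>pq\<in>D. T pq ba * z ba * tay (x i) (y i) \<alpha> \<beta> pq)"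
      by (intro sum.cong refl)
        (simp add: m_def T_def case_prod_beta poly_sum poly_monom poly_tay x_def y_def sum_distrib_left sum_distrib_right mult_ac)
    also have "\<dots> = (\<Sum>pq\<in>D. \<Sum>ba\<in>I. T pq ba * z ba * tay (x i) (y i) \<alpha> \<beta> pq)" by (rule sum.swap)
    finally show ?thesis by (simp only: sum_distrib_right)
  qed
  have "\<forall>pq\<in>D. c pq = 0" if c: "\<forall>i<n. \<forall>\<alpha> \<beta>. \<alpha> + \<beta> < em i \<longrightarrow> (\<Sum>pq\<in>D. c pq * tay (x i) (y i) \<alpha> \<beta> pq) = 0" for c
  proof -
    have "\<exists>z. \<forall>pq\<in>D. (\<Sum>ba\<in>I. T pq ba * z ba) = c pq"
    proof (rule square_system_solvable[OF finI finD])
      show "card D \<le> card I" using cardD by (simp add: cardI D_def)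
      fix z assume "\<And>pq. pq \<in> D \<Longrightarrow> (\<Sum>ba\<in>I. T pq ba * z ba) = 0"
      then have "(\<Sum>ba\<in>I. poly (m (i, \<alpha>, \<beta>) ba) t * z ba) = 0" for i \<alpha> \<beta>
        unfolding comp by (intro sum.neutral ballI) simp
      then show "\<forall>ba\<in>I. z ba = 0" by (intro t) auto
    qed
    then obtain z where z: "\<And>pq. pq \<in> D \<Longrightarrow> (\<Sum>ba\<in>I. T pq ba * z ba) = c pq" by blast
    have "\<forall>ba\<in>I. z ba = 0"
    proof (rule t, clarify)
      fix i \<alpha> \<beta> assume "(i, \<alpha>, \<beta>) \<in> J"
      then have "(\<Sum>pq\<in>D. c pq * tay (x i) (y i) \<alpha> \<beta> pq) = 0" using c by (auto simp: J_def)
      then show "(\<Sum>ba\<in>I. poly (m (i, \<alpha>, \<beta>) ba) t * z ba) = 0" by (simp add: comp z)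
    qed
    then show ?thesis using z by (metis (no_types, lifting) mult_zero_right sum.neutral)
  qed
  then show ?thesis unfolding D_def by blast
qed

section \<open>Distribution of the multiplicities over the rows\<close>

text \<open>Only the two outer rows carry an extra cost; if it is large, points of small speed stay
  on the inner rows.\<close>

definition base_cost :: "nat \<Rightarrow> int \<Rightarrow> nat \<Rightarrow> int"
  where "base_cost e P b = (if b = 0 \<or> b = e + 1 then P else 0)"

text \<open>The hypothesis of \<open>point_order\<close> in terms of costs: a row receives
  \<open>f\<close> minus the number of other rows that are at most as expensive, and the rows up to
  the cost of a served row must be consecutive.\<close>

definition allots :: "nat \<Rightarrow> int \<Rightarrow> nat \<Rightarrow> int \<Rightarrow> (nat \<Rightarrow> nat) \<Rightarrow> bool"
  where "allots e P f v mm \<longleftrightarrow> (\<forall>b\<le>e + 1. 0 < mm b \<longrightarrow> mm b \<le> f \<and>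
    (\<exists>l. {b'. b' \<le> e + 1 \<and> base_cost e P b' + v * int b' \<le> base_cost e P b + v * int b} = {l..l + (f - mm b)}))"

text \<open>At speed 2 w, row 0 with cost (2 \<tau> + 1) w comes after rows 1, ..., \<tau> and
  before row \<tau> + 1; the multiplicities e, e - 1, ..., 1 are given out in this order. Odd
  against even multiples of w exclude ties.\<close>

definition rising :: "nat \<Rightarrow> nat \<Rightarrow> nat \<Rightarrow> nat"
  where "rising e \<tau> b = (if b = 0 then e - \<tau> else if b \<le> \<tau> then e + 1 - b else e - b)"

lemma allots_rising:
  assumes P: "P = (2 * int \<tau> + 1) * w" and w: "0 < w" and \<tau>: "\<tau> < e"
  shows "allots e P e (2 * w) (rising e \<tau>)"
  unfolding allots_def
proof (intro allI impI)
  fix b assume b: "b \<le> e + 1" and mm: "0 < rising e \<tau> b"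
  define \<kappa> where "\<kappa> b = base_cost e (2 * int \<tau> + 1) b + 2 * int b" for b
  have "base_cost e P b + 2 * w * int b = w * \<kappa> b" for b
    by (simp add: base_cost_def \<kappa>_def P algebra_simps)
  then have cost: "base_cost e P b' + 2 * w * int b' \<le> base_cost e P b + 2 * w * int b \<longleftrightarrow> \<kappa> b' \<le> \<kappa> b" for b' b
    using w by simp
  have be: "b \<le> e" using mm b by (auto simp: rising_def split: if_splits)
  have "{b'. b' \<le> e + 1 \<and> \<kappa> b' \<le> \<kappa> b} = (if b = 0 then {0..\<tau>} else if b \<le> \<tau> then {1..b} else {0..b})"
    using be \<tau> by (auto simp: \<kappa>_def base_cost_def split: if_splits)
  also have "\<dots> = {(if b \<noteq> 0 \<and> b \<le> \<tau> then 1 else 0)..(if b \<noteq> 0 \<and> b \<le> \<tau> then 1 else 0) + (e - rising e \<tau> b)}"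
    using be \<tau> by (auto simp: rising_def)
  finally show "rising e \<tau> b \<le> e \<and> (\<exists>l. {b'. b' \<le> e + 1 \<and> base_cost e P b' + 2 * w * int b' \<le> base_cost e P b + 2 * w * int b} =
      {l..l + (e - rising e \<tau> b)})"
    unfolding cost by (intro conjI exI) (auto simp: rising_def)
qed

text \<open>The reflection from b to e + 1 - b exchanges the outer rows and reverses the
  speed.\<close>

lemma allots_falling:
  assumes P: "P = (2 * int \<tau> + 1) * w" and w: "0 < w" and \<tau>: "\<tau> < e"
  shows "allots e P e (- 2 * w) (\<lambda>b. rising e \<tau> (e + 1 - b))"
  unfolding allots_def
proof (intro allI impI)
  fix b assume b: "b \<le> e + 1" and mm: "0 < rising e \<tau> (e + 1 - b)"
  define \<kappa> where "\<kappa> b = base_cost e (2 * int \<tau> + 1) b - 2 * int b" for b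
  have "base_cost e P b + - 2 * w * int b = w * \<kappa> b" for b
    by (simp add: base_cost_def \<kappa>_def P algebra_simps)
  then have cost: "base_cost e P b' + - 2 * w * int b' \<le> base_cost e P b + - 2 * w * int b \<longleftrightarrow> \<kappa> b' \<le> \<kappa> b" for b' b
    using w by simp
  have be: "1 \<le> b" using mm b by (auto simp: rising_def split: if_splits)
  have "{b'. b' \<le> e + 1 \<and> \<kappa> b' \<le> \<kappa> b} =
      (if b = e + 1 then {e + 1 - \<tau>..e + 1} else if e + 1 - b \<le> \<tau> then {b..e} else {b..e + 1})"
    using be b \<tau> by (auto simp: \<kappa>_def base_cost_def split: if_splits)
  also have "\<dots> = {(if b = e + 1 then e + 1 - \<tau> else b)..(if b = e + 1 then e + 1 - \<tau> else b) + (e - rising e \<tau> (e + 1 - b))}"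
    using be b \<tau> by (auto simp: rising_def)
  finally show "rising e \<tau> (e + 1 - b) \<le> e \<and> (\<exists>l. {b'. b' \<le> e + 1 \<and> base_cost e P b' + - 2 * w * int b' \<le> base_cost e P b + - 2 * w * int b} =
      {l..l + (e - rising e \<tau> (e + 1 - b))})"
    unfolding cost by (intro conjI exI) (auto simp: rising_def)
qed

text \<open>At speed 1 every inner row costs at most e, hence less than either outer row, so the
  whole multiplicity is spent on the inner rows.\<close>

lemma allots_middle_rising:
  assumes P: "int e < P"
  shows "allots e P e 1 (\<lambda>b. if b = 0 then 0 else e + 1 - b)"
  unfolding allots_def
proof (intro allI impI)
  fix b assume "b \<le> e + 1" and "0 < (if b = 0 then 0 else e + 1 - b)"
  then have b: "1 \<le> b" "b \<le> e" by (auto split: if_splits)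
  then have "{b'. b' \<le> e + 1 \<and> base_cost e P b' + 1 * int b' \<le> base_cost e P b + 1 * int b} = {1..1 + (e - (if b = 0 then 0 else e + 1 - b))}"
    using P by (auto simp: base_cost_def split: if_splits)
  then show "(if b = 0 then 0 else e + 1 - b) \<le> e \<and> (\<exists>l. {b'. b' \<le> e + 1 \<and> base_cost e P b' + 1 * int b' \<le> base_cost e P b + 1 * int b} =
      {l..l + (e - (if b = 0 then 0 else e + 1 - b))})" using b by (intro conjI exI) auto
qed

lemma allots_middle_falling:
  assumes P: "int e < P"
  shows "allots e P e (- 1) (\<lambda>b. if b = e + 1 then 0 else b)"
  unfolding allots_def
proof (intro allI impI)
  fix b assume "b \<le> e + 1" and "0 < (if b = e + 1 then 0 else b)"
  then have b: "1 \<le> b" "b \<le> e" by (auto split: if_splits)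
  then have "{b'. b' \<le> e + 1 \<and> base_cost e P b' + - 1 * int b' \<le> base_cost e P b + - 1 * int b} = {b..b + (e - (if b = e + 1 then 0 else b))}"
    using P by (auto simp: base_cost_def split: if_splits)
  then show "(if b = e + 1 then 0 else b) \<le> e \<and> (\<exists>l. {b'. b' \<le> e + 1 \<and> base_cost e P b' + - 1 * int b' \<le> base_cost e P b + - 1 * int b} =
      {l..l + (e - (if b = e + 1 then 0 else b))})" using b by (intro conjI exI) auto
qed

text \<open>At speed 2 P row 0 is strictly the cheapest, and the single condition falls
  there.\<close>

lemma allots_simple:
  assumes P: "0 < P"
  shows "allots e P 1 (2 * P) (\<lambda>b. if b = 0 then 1 else 0)"
  unfolding allots_def
proof (intro allI impI)
  fix b assume "b \<le> e + 1" and "0 < (if b = 0 then 1 else 0 :: nat)"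
  then have b: "b = 0" by (auto split: if_splits)
  have lower: "P < base_cost e P b' + 2 * P * int b'" if "b' \<noteq> 0" for b'
  proof -
    have "2 * P * 1 \<le> 2 * P * int b'" using P that by (intro mult_left_mono) auto
    then show ?thesis using P by (simp add: base_cost_def)
  qed
  have b_cost: "base_cost e P b + 2 * P * int b = P" using b by (simp add: base_cost_def)
  have "b' \<le> e + 1 \<and> base_cost e P b' + 2 * P * int b' \<le> P \<longleftrightarrow> b' = b" for b'
  proof (cases "b' = 0")
    case True
    then show ?thesis using b b_cost by simp
  next
    case False
    then show ?thesis using lower[of b'] b by linarith
  qed
  then have "{b'. b' \<le> e + 1 \<and> base_cost e P b' + 2 * P * int b' \<le> base_cost e P b + 2 * P * int b} = {b}"
    unfolding b_cost by blast
  then have "{b'. b' \<le> e + 1 \<and> base_cost e P b' + 2 * P * int b' \<le> base_cost e P b + 2 * P * int b} = {0..0 + (1 - (if b = 0 then 1 else 0))}"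
    using b by simp
  then show "(if b = 0 then 1 else 0) \<le> (1 :: nat) \<and> (\<exists>l. {b'. b' \<le> e + 1 \<and> base_cost e P b' + 2 * P * int b' \<le> base_cost e P b + 2 * P * int b} =
      {l..l + (1 - (if b = 0 then 1 else 0))})" using b by (intro conjI exI) auto
qed

theorem injective_from_allotments:
  fixes pts :: "(nat \<times> int \<times> (nat \<Rightarrow> nat)) list" and d k e r s :: nat
  assumes inf: "infinite (UNIV :: 'k::field set)"
    and d: "d + 1 = k * (e + 1) + r" and r: "r < k \<or> r \<le> 1" and k: "1 \<le> k"
    and s: "s = 0 \<or> (s = e \<and> e + 1 \<le> k)" and ts: "tri s \<le> tri (d + 1) - tri (d + 1 - k)"
    and pts: "\<And>f v mm. (f, v, mm) \<in> set pts \<Longrightarrow> allots e P f v mm"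
    and total: "\<And>b. b \<le> e + 1 \<Longrightarrow> row_size d k e s b \<le> (\<Sum>(f, v, mm)\<leftarrow>pts. mm b)"
  shows "\<exists>x y :: nat \<Rightarrow> 'k. \<forall>c. (\<forall>i<length pts. \<forall>\<alpha> \<beta>. \<alpha> + \<beta> < fst (pts ! i) \<longrightarrow>
      (\<Sum>pq\<in>exps d (d - s). c pq * tay (x i) (y i) \<alpha> \<beta> pq) = 0) \<longrightarrow> (\<forall>pq\<in>exps d (d - s). c pq = 0)"
proof -
  obtain A :: "'k poly" where A: "coeff A 0 = 1" "degree A < k" and rows:
    "\<forall>b\<le>e+1. \<forall>a<row_size d k e s b. \<exists>u.
      (\<forall>j i. coeff (u j) i \<noteq> 0 \<longrightarrow> i + j \<le> d - k * b \<and> (b = 0 \<longrightarrow> j \<le> d - s)) \<and>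
      (\<forall>N\<ge>row_size d k e s b.
         monom 1 (row_size d k e s b) dvd (\<Sum>j\<le>d. u j * (\<Sum>i\<le>N. (1 - A) ^ i) ^ j) - monom 1 a)"
    using curve_rows[OF inf d r k s] by blast
  define v where "v i = fst (snd (pts ! i))" for i
  define mm where "mm i = snd (snd (pts ! i))" for i
  \<comment> \<open>A common shift that makes all costs natural numbers without changing their
    order.\<close>
  define K where "K = \<bar>P\<bar> + (\<Sum>i<length pts. \<bar>v i\<bar>) * (int e + 1)"
  define C where "C i b = nat (base_cost e P b + K + v i * int b)" for i b
  have C: "int (C i b) = base_cost e P b + K + v i * int b" if "i < length pts" "b \<le> e + 1" for i b
  proof -
    have "\<bar>v i\<bar> \<le> (\<Sum>i<length pts. \<bar>v i\<bar>)" using that by (intro member_le_sum) auto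
    then have "\<bar>v i\<bar> * int b \<le> (\<Sum>i<length pts. \<bar>v i\<bar>) * (int e + 1)"
      using that by (intro mult_mono) auto
    moreover have "\<bar>v i * int b\<bar> = \<bar>v i\<bar> * int b" by (simp add: abs_mult)
    moreover have "\<bar>base_cost e P b\<bar> \<le> \<bar>P\<bar>" by (simp add: base_cost_def)
    ultimately show ?thesis unfolding C_def K_def by linarith
  qed
  have al: "allots e P (fst (pts ! i)) (v i) (mm i)" if "i < length pts" for i
    using pts[of "fst (pts ! i)" "v i" "mm i"] nth_mem[OF that] by (simp add: v_def mm_def)
  have "s \<le> d"
  proof (cases "s = 0")
    case False
    then have "e + 1 \<le> k" "s = e" using s by auto
    moreover have "k * 1 \<le> k * (e + 1)" by (intro mult_le_mono2) simp
    ultimately show ?thesis using d by linarith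
  qed simp
  have card: "card (exps d (d - s)) \<le> (\<Sum>b\<le>e+1. row_size d k e s b)"
    using card_exps[OF \<open>s \<le> d\<close>] sum_row_size[OF d ts] by linarith
  have kb: "k * b \<le> d" if "b \<le> e + 1" "0 < row_size d k e s b" for b
  proof (cases "b = e + 1")
    case True
    then have "0 < tri (d + 1 - k * (e + 1))" using that by (simp add: row_size_def)
    then have "0 < d + 1 - k * (e + 1)" by (metis gr0I less_irrefl tri_0)
    then show ?thesis unfolding True by linarith
  next
    case False
    then have "k * (b + 1) \<le> k * (e + 1)" using that by (intro mult_le_mono2) simp
    moreover have "k * (b + 1) = k * b + k" by simp
    ultimately show ?thesis using d k by linarith
  qed
  show ?thesis
  proof (rule degenerate_injective[OF inf A _ kb _ card, where v = v and \<pi> = "\<lambda>b. base_cost e P b + K" and mm = mm and C = C])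
    show "\<exists>u. (\<forall>j i. coeff (u j) i \<noteq> 0 \<longrightarrow> i + j \<le> d - k * b \<and> (b = 0 \<longrightarrow> j \<le> d - s)) \<and>
        (\<forall>N\<ge>row_size d k e s b. monom 1 (row_size d k e s b) dvd (\<Sum>j\<le>d. u j * (\<Sum>i\<le>N. (1 - A) ^ i) ^ j) - monom 1 a)"
      if "b \<le> e + 1" "a < row_size d k e s b" for b a
      using rows that by blast
    show "s = 0 \<or> s + 1 \<le> k" using s by auto
    show "int (C i b) = base_cost e P b + K + v i * int b" if "i < length pts" "b \<le> e + 1" for i b
      using C[OF that] .
    show "mm i b \<le> fst (pts ! i) \<and> (\<exists>l. {b'. b' \<le> e + 1 \<and> C i b' \<le> C i b} = {l..l + (fst (pts ! i) - mm i b)})"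
      if "i < length pts" "b \<le> e + 1" "0 < mm i b" for i b
    proof -
      have "{b'. b' \<le> e + 1 \<and> C i b' \<le> C i b} = {b'. b' \<le> e + 1 \<and> base_cost e P b' + v i * int b' \<le> base_cost e P b + v i * int b}"
        using C[OF that(1)] that(2) by (intro Collect_cong conj_cong refl) (smt (verit) zle_int)
      moreover have "mm i b \<le> fst (pts ! i) \<and> (\<exists>l. {b'. b' \<le> e + 1 \<and> base_cost e P b' + v i * int b' \<le> base_cost e P b + v i * int b} =
          {l..l + (fst (pts ! i) - mm i b)})"
        using al[OF that(1), unfolded allots_def, rule_format, OF that(2,3)] .
      ultimately show ?thesis by (simp only:)
    qed
    show "row_size d k e s b \<le> (\<Sum>i<length pts. mm i b)" if "b \<le> e + 1" for b
      using total[OF that] by (simp add: sum_list_sum_nth mm_def case_prod_beta atLeast0LessThan)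
  qed
qed

section \<open>The numbers of points of each kind\<close>

text \<open>p points serve row 0 and p' serve row e + 1; q rising and N - p - p' - q falling points
  stay on the inner rows. p and p' are the ceilings of c0 / e and cl / e; the excesses \<sigma> and
  \<sigma>' are handed to the inner rows by one point at each end. The row sizes decrease by k^2
  from row to row, and equating this with the decrease of the multiplicities gives 2 q = N + k^2 - 2
  p, whence the parity assumption. For e = 1 there is a single inner row and no such
  equation.\<close>

lemma balanced_numbers:
  fixes e k r n \<epsilon> D E c0 cl p \<sigma> p' \<sigma>' m N q :: int
  assumes e: "1 \<le> e" and k: "2 * e - 1 \<le> k" and r: "0 \<le> r" "r \<le> e" and \<epsilon>: "0 \<le> \<epsilon>" "\<epsilon> \<le> 1" "e = 1 \<Longrightarrow> \<epsilon> = 0"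
    and D: "0 \<le> D" "2 * D + 2 \<le> e * (e + 1)" and E: "0 \<le> E" "2 * E + 2 \<le> e * (e + 1)"
    and m: "m = k * (e + 1) + r" and count: "m * (m + 1) + 2 * E = n * (e * (e + 1)) + 2 * D"
    and c0: "2 * c0 = k * (2 * m - k + 1) - \<epsilon> * (e * (e + 1)) - 2 * D" and cl: "2 * cl = r * (r + 1) + 2 * E"
    and p: "p * e = c0 + \<sigma>" "0 \<le> \<sigma>" "\<sigma> < e" and p': "p' * e = cl + \<sigma>'" "0 \<le> \<sigma>'" "\<sigma>' < e"
    and N: "N = n - \<epsilon>" and even: "1 < e \<Longrightarrow> even (N + k * k)" and q: "q = (N + k * k - 2 * p) div 2"
  shows "0 \<le> c0" "0 \<le> q" "p + p' + q \<le> N"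
    "1 \<le> b \<Longrightarrow> b \<le> e \<Longrightarrow> k * (2 * (m - k * b) - k + 1) \<le>
      2 * (p * (e - b) + q * (e + 1 - b) + (N - p - p' - q) * b + p' * (b - 1) + of_bool (b \<le> \<sigma>) + of_bool (e + 1 - b \<le> \<sigma>'))"
proof -
  have k1: "1 \<le> k" using e k by simp
  have "(2 * e - 1) * (2 * e - 1) \<le> k * k" using k e by (intro mult_mono) auto
  then have kk: "4 * (e * e) - 4 * e + 1 \<le> k * k" by (simp add: algebra_simps)
  have ee: "2 * e \<le> e * e + 1" using zero_le_square[of "e - 1"] by (simp add: algebra_simps)
  have \<epsilon>e: "\<epsilon> * (e * (e + 1)) \<le> e * (e + 1)" using \<epsilon> e by (intro mult_left_le_one_le) auto
  have c: "N * (e * (e + 1)) = m * (m + 1) + 2 * E - 2 * D - \<epsilon> * (e * (e + 1))"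
    using count by (simp add: N left_diff_distrib)
  show c0_ge: "0 \<le> c0"
  proof -
    have "k * ((2 * e + 1) * k + 1) \<le> k * (2 * m - k + 1)"
      using k1 r by (intro mult_left_mono) (auto simp: m algebra_simps)
    moreover have "3 * (k * k) \<le> (2 * e + 1) * (k * k)" using e by (intro mult_right_mono) auto
    ultimately have "3 * (k * k) + k \<le> k * (2 * m - k + 1)" by (simp add: distrib_left mult_ac)
    moreover have "e * (e + 1) = e * e + e" by (simp add: distrib_left)
    then have "2 * D + 2 \<le> e * e + e" "\<epsilon> * (e * (e + 1)) \<le> e * e + e" using D \<epsilon>e by metis+
    ultimately show ?thesis using c0 kk D k ee e by smt
  qed
  \<comment> \<open>This leads to 2 p \<le> N + k^2, that is q \<ge> 0.\<close>
  have A: "2 * c0 \<le> e * (N + k * k)"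
  proof -
    have "(e + 1) * (e * (N + k * k) - 2 * c0) = N * (e * (e + 1)) + (e + 1) * e * (k * k) - (e + 1) * (2 * c0)"
      by (simp add: algebra_simps)
    also have "\<dots> = r * (r + 1) + 2 * E + e * (\<epsilon> * (e * (e + 1)) + 2 * D)"
      unfolding c c0 m by (simp add: algebra_simps)
    also have "\<dots> \<ge> 0" using r E e \<epsilon> D by (intro add_nonneg_nonneg mult_nonneg_nonneg) auto
    finally show ?thesis using e by (simp add: zero_le_mult_iff)
  qed
  \<comment> \<open>For e > 1 this leads to 2 p' \<le> N - k^2, that is p + p' + q \<le> N. The
    bound k \<ge> 2 e - 1 enters through e^2 + 2 e \<le> k^2 + k + 1.\<close>
  have B: "2 * cl \<le> e * (N - k * k) + 1"
  proof -
    have 1: "(e + 1) * (e * (N - k * k) + 1 - 2 * cl) = N * (e * (e + 1)) - (e + 1) * e * (k * k) + (e + 1) - (e + 1) * (2 * cl)"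
      by (simp add: algebra_simps)
    have 2: "N * (e * (e + 1)) - (e + 1) * e * (k * k) + (e + 1) - (e + 1) * (2 * cl) =
      (e + 1) * (k * k + k + 1) + (2 * k * r * (e + 1) - e * (r * (r + 1))) - \<epsilon> * (e * (e + 1)) - 2 * D - e * (2 * E)"
      unfolding c cl m by (simp add: algebra_simps)
    have 3: "e * (r * (r + 1)) \<le> 2 * k * r * (e + 1)"
    proof -
      have "e * (r * (r + 1)) \<le> (e + 1) * (r * (2 * k))" using r k e by (intro mult_mono) auto
      then show ?thesis by (simp add: mult_ac)
    qed
    have 4: "e * (2 * E) \<le> e * (e * (e + 1))" using E e by (intro mult_left_mono) auto
    have "2 * e + e * e \<le> k * k + k + 1"
      using kk k ee e by linarith
    then have "(e + 1) * (2 * e + e * e) \<le> (e + 1) * (k * k + k + 1)" using e by (intro mult_left_mono) auto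
    moreover have "(e + 1) * (2 * e + e * e) = e * (e + 1) + e * (e + 1) + e * (e * (e + 1))" by (simp add: algebra_simps)
    ultimately have "0 \<le> (e + 1) * (e * (N - k * k) + 1 - 2 * cl)"
      unfolding 1 2 using 3 4 \<epsilon>e D by linarith
    then show ?thesis using e by (simp add: zero_le_mult_iff)
  qed
  have e1: "2 * N = m * (m + 1)" "m = 2 * k + r" "p = c0" "p' = cl" "\<sigma> = 0" "\<sigma>' = 0" "r \<le> 1" "D = 0" "E = 0"
    "2 * c0 = k * (2 * m - k + 1)" "2 * cl = r * (r + 1)" if "e = 1"
  proof -
    show "\<sigma> = 0" "\<sigma>' = 0" using p p' that by auto
    then show "p = c0" "p' = cl" using p p' that by auto
    show "D = 0" "E = 0" using D E that by auto
    then show "2 * N = m * (m + 1)" using c \<epsilon>(3)[OF that] that by simp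
    show "m = 2 * k + r" using m that by simp
    show "r \<le> 1" using r that by simp
    show "2 * c0 = k * (2 * m - k + 1)" using c0 \<open>D = 0\<close> \<epsilon>(3)[OF that] by simp
    show "2 * cl = r * (r + 1)" using cl \<open>E = 0\<close> by simp
  qed
  have q2: "2 * q = N + k * k - 2 * p" if "1 < e"
    using even[OF that] unfolding q by (intro dvd_mult_div_cancel) auto
  have q2': "N + k * k - 2 * p - 1 \<le> 2 * q" "2 * q \<le> N + k * k - 2 * p" unfolding q by linarith+
  have pA: "2 * p \<le> N + k * k"
  proof (cases "e = 1")
    case True
    then show ?thesis using A e1 by simp
  next
    case False
    have "e * (2 * p) = 2 * c0 + 2 * \<sigma>" using p by (simp add: mult.commute)
    then have "e * (2 * p) < e * (N + k * k + 2)" using A p by (simp add: distrib_left)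
    then have "2 * p < N + k * k + 2" using e by (simp add: mult_less_cancel_left)
    moreover have "even (N + k * k - 2 * p)" using even False e by simp
    ultimately show ?thesis by presburger
  qed
  then show "0 \<le> q" unfolding q by simp
  have pB: "p + q + p' \<le> N"
  proof (cases "e = 1")
    case True
    have rr: "r * r = r" using r e1(7)[OF True] by (cases "r = 0") auto
    have "2 * cl = 2 * r" using e1(11)[OF True] rr by (simp add: algebra_simps)
    moreover have "2 * N = 4 * (k * k) + 4 * (k * r) + 2 * k + 2 * r"
      unfolding e1(1)[OF True] e1(2)[OF True] using rr by (simp add: algebra_simps)
    moreover have "0 \<le> k * r" "1 \<le> k * k" using r k1 mult_mono[of 1 k 1 k] by auto
    ultimately have "2 * p' \<le> N - k * k" using e1(4)[OF True] k1 e1(7)[OF True] by linarith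
    then show ?thesis using q2' by linarith
  next
    case False
    have "e * (2 * p') = 2 * cl + 2 * \<sigma>'" using p' by (simp add: mult.commute)
    then have "e * (2 * p') < e * (N - k * k + 2)" using B p' unfolding distrib_left[of e "N - k * k" 2] by smt
    then have "2 * p' < N - k * k + 2" using e by (simp add: mult_less_cancel_left)
    moreover have "even (N - k * k)" using even False e by simp
    ultimately have "2 * p' \<le> N - k * k" by presburger
    then show ?thesis using q2' by linarith
  qed
  then show "p + p' + q \<le> N" by simp
  show "k * (2 * (m - k * b) - k + 1) \<le>
      2 * (p * (e - b) + q * (e + 1 - b) + (N - p - p' - q) * b + p' * (b - 1) + of_bool (b \<le> \<sigma>) + of_bool (e + 1 - b \<le> \<sigma>'))"
    (is "?l \<le> 2 * ?X") if b: "1 \<le> b" "b \<le> e"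
  proof (cases "e = 1")
    case True
    then have b1: "b = 1" using b by simp
    have "2 * (N - p - p') = m * (m + 1) - k * (2 * m - k + 1) - r * (r + 1)"
      using e1[OF True] by (simp add: algebra_simps)
    also have "\<dots> = ?l" unfolding e1(2)[OF True] b1 by (simp add: algebra_simps)
    finally show ?thesis using e1(5,6)[OF True] True by (simp add: b1)
  next
    case False
    have e_gt: "1 < e" using False e by simp
    define \<delta> where "\<delta> = of_bool (b \<le> \<sigma>) + (of_bool (e + 1 - b \<le> \<sigma>') :: int)"
    define \<tau> where "\<tau> = k * (k - 1) div 2"
    have t: "2 * \<tau> = k * (k - 1)" unfolding \<tau>_def by (intro dvd_mult_div_cancel) auto
    \<comment> \<open>The surplus of multiplicity on row b. Since the totals agree, e Y depends only
      on the excesses and on \<delta>; it is greater than -e, so the integer Y is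
      nonnegative.\<close>
    define Y where "Y = ?X - (k * (m - k * b) - \<tau>)"
    have lY: "2 * ?X - ?l = 2 * Y" using t by (simp add: Y_def algebra_simps)
    have "2 * ?X = 2 * p * (e - b) + 2 * q * (e + 1 - 2 * b) + 2 * (N - p - p') * b + 2 * p' * (b - 1) + 2 * \<delta>"
      by (simp add: \<delta>_def algebra_simps)
    also have "\<dots> = N * (e + 1) + k * k * (e + 1 - 2 * b) - 2 * p - 2 * p' + 2 * \<delta>"
      unfolding q2[OF e_gt]
      by (simp add: algebra_simps)
    finally have X: "2 * ?X = N * (e + 1) + k * k * (e + 1 - 2 * b) - 2 * p - 2 * p' + 2 * \<delta>" .
    have "e * (2 * ?X) = N * (e * (e + 1)) + e * (k * k * (e + 1 - 2 * b)) - 2 * (p * e) - 2 * (p' * e) + 2 * (e * \<delta>)"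
      unfolding X by (simp add: algebra_simps)
    also have "\<dots> = N * (e * (e + 1)) + e * (k * k * (e + 1 - 2 * b)) - 2 * c0 - 2 * cl - 2 * \<sigma> - 2 * \<sigma>' + 2 * (e * \<delta>)"
      unfolding p(1) p'(1) by (simp add: algebra_simps)
    also have "N * (e * (e + 1)) + e * (k * k * (e + 1 - 2 * b)) - 2 * c0 - 2 * cl = e * ?l"
      unfolding c c0 cl m by (simp add: algebra_simps)
    finally have "e * (2 * ?X - ?l) = 2 * (e * \<delta> - \<sigma> - \<sigma>')" by (simp add: right_diff_distrib)
    then have eY: "e * Y = e * \<delta> - \<sigma> - \<sigma>'" unfolding lY by simp
    have "e * (- 1) < e * Y"
    proof (cases "\<sigma> + \<sigma>' < e")
      case True
      have "0 \<le> e * \<delta>" using e by (simp add: \<delta>_def)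
      then show ?thesis using eY True by simp
    next
      case False
      \<comment> \<open>Otherwise b \<ge> \<sigma> + 1 and e + 1 - b \<ge> \<sigma>' + 1 would add
        up to \<sigma> + \<sigma>' < e.\<close>
      then have "1 \<le> \<delta>" by (auto simp: \<delta>_def)
      then have "e * 1 \<le> e * \<delta>" using e by (intro mult_left_mono) auto
      then show ?thesis using p p' unfolding eY by linarith
    qed
    then have "- 1 < Y" using e by (simp only: mult_less_cancel_left)
    then show ?thesis using lY by simp
  qed
qed

lemma int_tri: "2 * int (tri n) = int n * (int n + 1)"
proof -
  have "int (2 * tri n) = int (n * Suc n)" by (simp only: tri_double)
  then show ?thesis by (simp add: algebra_simps)
qed

text \<open>The surplus \<open>E\<close> of conditions is spent on the last row and the
  \<open>D\<close> simple points on row 0. \<open>\<epsilon>\<close> counts the point that is still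
  to be placed at infinity.\<close>

theorem balanced_points:
  fixes e d n D E :: nat
  assumes inf: "infinite (UNIV :: 'k::field set)" and e: "1 \<le> e" and d: "(2 * e - 1) * (e + 1) \<le> d + 1"
    and count: "tri (d + 1) + E = n * tri e + D" and E: "E < tri e" and D: "D < tri e"
  shows "\<exists>\<epsilon>\<le>n. (\<epsilon> = 0 \<or> \<epsilon> = 1 \<and> e \<le> d) \<and> (\<exists>x y :: nat \<Rightarrow> 'k. \<forall>c.
      (\<forall>i<n - \<epsilon>. \<forall>\<alpha> \<beta>. \<alpha> + \<beta> < e \<longrightarrow> (\<Sum>pq\<in>exps d (d - \<epsilon> * e). c pq * tay (x i) (y i) \<alpha> \<beta> pq) = 0) \<longrightarrow>
      (\<forall>i<D. (\<Sum>pq\<in>exps d (d - \<epsilon> * e). c pq * tay (x (n - \<epsilon> + i)) (y (n - \<epsilon> + i)) 0 0 pq) = 0) \<longrightarrow>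
      (\<forall>pq\<in>exps d (d - \<epsilon> * e). c pq = 0))"
proof -
  define k where "k = (d + 1) div (e + 1)"
  define r where "r = (d + 1) mod (e + 1)"
  have dk: "d + 1 = k * (e + 1) + r" unfolding k_def r_def by (rule div_mult_mod_eq[symmetric])
  have re: "r \<le> e" using mod_less_divisor[of "e + 1" "d + 1"] unfolding r_def by linarith
  have ke: "2 * e - 1 \<le> k" unfolding k_def using d less_eq_div_iff_mult_less_eq[of "e + 1" "2 * e - 1" "d + 1"] by (simp only: zero_less_Suc Suc_eq_plus1[symmetric])
  have k1: "1 \<le> k" using ke e by linarith
  have km: "k * b + k \<le> d + 1" if "b \<le> e" for b
  proof -
    have "k * (b + 1) \<le> k * (e + 1)" using that by (intro mult_le_mono2) simp
    then have "k * b + k \<le> k * (e + 1)" by simp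
    then show ?thesis using dk by linarith
  qed
  \<comment> \<open>Removing one point corrects the parity of N + k^2, k and k^2 having the same
    parity.\<close>
  define \<epsilon> :: nat where "\<epsilon> = (if e = 1 then 0 else (n + k) mod 2)"
  have \<epsilon>01: "\<epsilon> = 0 \<or> \<epsilon> = 1" by (auto simp: \<epsilon>_def)
  have "e + 1 \<le> (2 * e - 1) * (e + 1)" using e mult_le_mono1[of 1 "2 * e - 1" "e + 1"] by simp
  then have de: "e \<le> d" using d by linarith
  have "n \<noteq> 0"
  proof
    assume "n = 0"
    then have "tri (d + 1) < tri e" using count D by simp
    then show False using tri_mono[of e "d + 1"] de by simp
  qed
  then have \<epsilon>n: "\<epsilon> \<le> n" using \<epsilon>01 by auto
  define N where "N = n - \<epsilon>"
  define c0 where "c0 = int (tri (d + 1)) - int (tri (d + 1 - k)) - int \<epsilon> * int (tri e) - int D"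
  define cl where "cl = int (tri r) + int E"
  define p where "p = (c0 + int e - 1) div int e"
  define \<sigma> where "\<sigma> = p * int e - c0"
  define p' where "p' = (cl + int e - 1) div int e"
  define \<sigma>' where "\<sigma>' = p' * int e - cl"
  have \<sigma>: "0 \<le> \<sigma>" "\<sigma> < int e"
    using div_mult_mod_eq[of "c0 + int e - 1" "int e"] pos_mod_bound[of "int e" "c0 + int e - 1"]
      pos_mod_sign[of "int e" "c0 + int e - 1"] e unfolding \<sigma>_def p_def by linarith+
  have \<sigma>': "0 \<le> \<sigma>'" "\<sigma>' < int e"
    using div_mult_mod_eq[of "cl + int e - 1" "int e"] pos_mod_bound[of "int e" "cl + int e - 1"]
      pos_mod_sign[of "int e" "cl + int e - 1"] e unfolding \<sigma>'_def p'_def by linarith+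
  define q where "q = (int N + int k * int k - 2 * p) div 2"
  have iD: "2 * int D + 2 \<le> int e * (int e + 1)" "2 * int E + 2 \<le> int e * (int e + 1)"
    using D E int_tri[of e] by linarith+
  have icount: "int (d + 1) * (int (d + 1) + 1) + 2 * int E = int n * (int e * (int e + 1)) + 2 * int D"
  proof -
    have "2 * (int (tri (d + 1)) + int E) = 2 * (int n * int (tri e) + int D)"
      using arg_cong[OF count, of int] by simp
    then show ?thesis using int_tri[of "d + 1"] int_tri[of e] by (simp add: algebra_simps)
  qed
  have itri: "2 * (int (tri (d + 1 - k * b)) - int (tri (d + 1 - k * b - k))) = int k * (2 * (int (d + 1) - int k * int b) - int k + 1)"
    if "b \<le> e" for b
  proof -
    have z: "int (d + 1 - k * b) = int (d + 1) - int k * int b" "int (d + 1 - k * b - k) = int (d + 1) - int k * int b - int k"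
      using km[OF that] by (simp_all add: of_nat_diff)
    then show ?thesis unfolding right_diff_distrib int_tri z by (simp add: algebra_simps)
  qed
  have i0: "2 * c0 = int k * (2 * int (d + 1) - int k + 1) - int \<epsilon> * (int e * (int e + 1)) - 2 * int D"
    using itri[of 0] int_tri[of e] unfolding c0_def by (simp add: algebra_simps)
  have il: "2 * cl = int r * (int r + 1) + 2 * int E" unfolding cl_def distrib_left int_tri ..
  have idk: "int (d + 1) = int k * (int e + 1) + int r" using arg_cong[OF dk, of int] by (simp add: algebra_simps)
  have par: "even (int N + int k * int k)" if "1 < int e"
  proof -
    have "even (N + k)" using that \<epsilon>n unfolding N_def \<epsilon>_def by (auto simp: mod2_eq_if split: if_splits)
    then show ?thesis by auto
  qed
  note numbers = balanced_numbers[of "int e" "int k" "int r" "int \<epsilon>" "int D" "int E" "int (d + 1)" "int n" c0 cl p \<sigma> p' \<sigma>' "int N" q,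
    OF _ _ _ _ _ _ _ _ iD(1) _ iD(2) idk icount i0 il _ \<sigma> _ \<sigma>' _ par q_def]
  have "1 \<le> int e" "2 * int e - 1 \<le> int k" "0 \<le> int r" "int r \<le> int e" "0 \<le> int \<epsilon>" "int \<epsilon> \<le> 1" "int e = 1 \<Longrightarrow> int \<epsilon> = 0"
    "0 \<le> int D" "0 \<le> int E" "p * int e = c0 + \<sigma>" "p' * int e = cl + \<sigma>'" "int N = int n - int \<epsilon>"
    using e ke re \<epsilon>01 \<epsilon>n by (auto simp: \<sigma>_def \<sigma>'_def N_def \<epsilon>_def of_nat_diff)
  note numbers = numbers[OF this]
  have c0: "0 \<le> c0" and q0: "0 \<le> q" and pq: "p + p' + q \<le> int N" using numbers(1-3) by blast+
  have p0: "0 \<le> p" unfolding p_def using c0 e by (simp add: pos_imp_zdiv_nonneg_iff)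
  have p0': "0 \<le> p'" unfolding p'_def cl_def using e by (simp add: pos_imp_zdiv_nonneg_iff)
  have p1: "1 \<le> p" if "0 < \<sigma>" using that c0 p0 unfolding \<sigma>_def by (cases "p = 0") auto
  have p1': "1 \<le> p'" if "0 < \<sigma>'" using that p0' unfolding \<sigma>'_def cl_def by (cases "p' = 0") auto
  define \<tau> where "\<tau> = nat \<sigma>"
  define \<tau>' where "\<tau>' = nat \<sigma>'"
  have \<tau>: "int \<tau> = \<sigma>" "\<tau> < e" "int \<tau>' = \<sigma>'" "\<tau>' < e" using \<sigma> \<sigma>' by (auto simp: \<tau>_def \<tau>'_def)
  \<comment> \<open>The single cost P has to be (2 \<sigma> + 1) w for the rising point with the
    remainder, (2 \<sigma>' + 1) w' for the falling one, and larger than e for the points on the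
    inner rows.\<close>
  define w where "w = (2 * \<sigma>' + 1) * (int e + 1)"
  define w' where "w' = (2 * \<sigma> + 1) * (int e + 1)"
  define P where "P = (2 * \<sigma> + 1) * w"
  have P': "P = (2 * \<sigma>' + 1) * w'" by (simp add: P_def w_def w'_def)
  have w: "0 < w" "0 < w'" using \<sigma> \<sigma>' by (auto simp: w_def w'_def)
  have eP: "int e < P"
  proof -
    have "1 * (1 * (int e + 1)) \<le> P" unfolding P_def w_def using \<sigma> \<sigma>' by (intro mult_mono) auto
    then show ?thesis by simp
  qed
  \<comment> \<open>One of the p points carries the remainder if it is nonzero; the others are used
    with \<tau> = 0.\<close>
  define a where "a = nat p - of_bool (0 < \<tau>)"
  define a' where "a' = nat p' - of_bool (0 < \<tau>')"
  have ia: "int a = p - of_bool (0 < \<tau>)" using p0 p1 \<tau> by (cases "0 < \<tau>") (auto simp: a_def \<tau>_def)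
  have ia': "int a' = p' - of_bool (0 < \<tau>')" using p0' p1' \<tau> by (cases "0 < \<tau>'") (auto simp: a'_def \<tau>'_def)
  define u where "u = nat (int N - p - p' - q)"
  have iu: "int u = int N - p - p' - q" using pq by (simp add: u_def)
  define pts1 where "pts1 = replicate a (e, 2 * P, rising e 0) @ replicate (of_bool (0 < \<tau>)) (e, 2 * w, rising e \<tau>) @
    replicate (nat q) (e, 1, \<lambda>b. if b = 0 then 0 else e + 1 - b) @ replicate u (e, - 1, \<lambda>b. if b = e + 1 then 0 else b) @
    replicate a' (e, - 2 * P, \<lambda>b. rising e 0 (e + 1 - b)) @ replicate (of_bool (0 < \<tau>')) (e, - 2 * w', \<lambda>b. rising e \<tau>' (e + 1 - b))"
  define pts where "pts = pts1 @ replicate D (1, 2 * P, \<lambda>b. if b = 0 then 1 else 0)"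
  have "int (length pts1) = int N" unfolding pts1_def using ia ia' iu q0 by simp
  then have len1: "length pts1 = N" by simp
  have fst1: "fst (pts ! i) = e" if "i < N" for i
  proof -
    have "pts ! i \<in> set pts1" using that len1 by (auto simp: pts_def nth_append)
    then show ?thesis by (auto simp: pts1_def split: if_splits)
  qed
  have fst2: "fst (pts ! (N + i)) = 1" if "i < D" for i
    using that len1 by (simp add: pts_def nth_append)
  define s where "s = \<epsilon> * e"
  have tris: "tri s = \<epsilon> * tri e" using \<epsilon>01 by (auto simp: s_def)
  have "\<exists>x y :: nat \<Rightarrow> 'k. \<forall>c. (\<forall>i<length pts. \<forall>\<alpha> \<beta>. \<alpha> + \<beta> < fst (pts ! i) \<longrightarrow>
      (\<Sum>pq\<in>exps d (d - s). c pq * tay (x i) (y i) \<alpha> \<beta> pq) = 0) \<longrightarrow> (\<forall>pq\<in>exps d (d - s). c pq = 0)"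
  proof (rule injective_from_allotments[OF inf dk _ k1])
    show "r < k \<or> r \<le> 1" using re ke e by linarith
    show "s = 0 \<or> s = e \<and> e + 1 \<le> k" using \<epsilon>01 ke e by (auto simp: s_def \<epsilon>_def split: if_splits)
    show "tri s \<le> tri (d + 1) - tri (d + 1 - k)"
    proof -
      have "int (tri s) \<le> int (tri (d + 1)) - int (tri (d + 1 - k))" using c0 by (simp add: c0_def tris)
      then show ?thesis by linarith
    qed
    show "allots e P f v mm" if "(f, v, mm) \<in> set pts" for f v mm
    proof -
      have "allots e P e (2 * P) (rising e 0)" using eP e by (intro allots_rising) auto
      moreover have "allots e P e (2 * w) (rising e \<tau>)" using \<tau> w by (intro allots_rising) (auto simp: P_def)
      moreover have "allots e P e (- 2 * P) (\<lambda>b. rising e 0 (e + 1 - b))" using eP e by (intro allots_falling) auto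
      moreover have "allots e P e (- 2 * w') (\<lambda>b. rising e \<tau>' (e + 1 - b))" using \<tau> w by (intro allots_falling) (auto simp: P')
      moreover note allots_middle_rising[OF eP] allots_middle_falling[OF eP]
      moreover have "allots e P 1 (2 * P) (\<lambda>b. if b = 0 then 1 else 0)" using eP by (intro allots_simple) auto
      ultimately show ?thesis using that unfolding pts_def pts1_def by (auto split: if_splits)
    qed
    fix b assume b: "b \<le> e + 1"
    have sum: "int (\<Sum>(f, v, mm)\<leftarrow>pts. mm b) = int a * int (rising e 0 b) + of_bool (0 < \<tau>) * int (rising e \<tau> b) +
        q * int (if b = 0 then 0 else e + 1 - b) + int u * int (if b = e + 1 then 0 else b) +
        int a' * int (rising e 0 (e + 1 - b)) + of_bool (0 < \<tau>') * int (rising e \<tau>' (e + 1 - b)) + int D * of_bool (b = 0)"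
      using q0 by (simp add: pts_def pts1_def map_replicate sum_list_replicate)
    have "int (row_size d k e s b) \<le> int (\<Sum>(f, v, mm)\<leftarrow>pts. mm b)"
    proof -
      consider "b = 0" | "1 \<le> b" "b \<le> e" | "b = e + 1" using b by linarith
      then show ?thesis
      proof cases
        case 1
        have "tri (d + 1 - k) + \<epsilon> * tri e \<le> tri (d + 1)"
          using c0 unfolding c0_def of_nat_mult[symmetric] by linarith
        then have "int (row_size d k e s b) = c0 + int D"
          using 1 unfolding row_size_def c0_def tris of_nat_mult[symmetric] by simp
        moreover have "int (\<Sum>(f, v, mm)\<leftarrow>pts. mm b) = c0 + int D"
          unfolding sum ia using 1 \<tau> \<sigma> by (auto simp: rising_def of_nat_diff \<sigma>_def algebra_simps)
        ultimately show ?thesis by simp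
      next
        case 2
        have "2 * int (row_size d k e s b) = int k * (2 * (int (d + 1) - int k * int b) - int k + 1)"
          using 2 itri[of b] by (simp add: row_size_def of_nat_diff tri_mono algebra_simps)
        also have "\<dots> \<le> 2 * (p * (int e - int b) + q * (int e + 1 - int b) + (int N - p - p' - q) * int b + p' * (int b - 1) +
            of_bool (int b \<le> \<sigma>) + of_bool (int e + 1 - int b \<le> \<sigma>'))"
          using 2 by (intro numbers(4)) auto
        also have "p * (int e - int b) + q * (int e + 1 - int b) + (int N - p - p' - q) * int b + p' * (int b - 1) +
            of_bool (int b \<le> \<sigma>) + of_bool (int e + 1 - int b \<le> \<sigma>') = int (\<Sum>(f, v, mm)\<leftarrow>pts. mm b)"
        proof -
          have f: "int (rising e 0 b) = int e - int b" "int (rising e 0 (e + 1 - b)) = int b - 1"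
            "of_bool (0 < \<tau>) * int (rising e \<tau> b) = of_bool (0 < \<tau>) * (int e - int b) + of_bool (int b \<le> \<sigma>)"
            "of_bool (0 < \<tau>') * int (rising e \<tau>' (e + 1 - b)) = of_bool (0 < \<tau>') * (int b - 1) + of_bool (int e + 1 - int b \<le> \<sigma>')"
            using 2 unfolding \<tau>(1,3)[symmetric] by (auto simp: rising_def of_nat_diff)
          then show ?thesis unfolding sum f ia ia' iu using 2 by (simp add: of_nat_diff algebra_simps)
        qed
        finally show ?thesis by simp
      next
        case 3
        have "int (row_size d k e s b) = int (tri r)" using 3 dk by (simp add: row_size_def)
        moreover have "int (\<Sum>(f, v, mm)\<leftarrow>pts. mm b) = cl"
          unfolding sum ia' using 3 \<tau> \<sigma>' by (auto simp: rising_def of_nat_diff \<sigma>'_def algebra_simps)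
        ultimately show ?thesis by (simp add: cl_def)
      qed
    qed
    then show "row_size d k e s b \<le> (\<Sum>(f, v, mm)\<leftarrow>pts. mm b)" by linarith
  qed
  then obtain x y :: "nat \<Rightarrow> 'k" where xy: "\<And>c. (\<forall>i<length pts. \<forall>\<alpha> \<beta>. \<alpha> + \<beta> < fst (pts ! i) \<longrightarrow>
      (\<Sum>pq\<in>exps d (d - s). c pq * tay (x i) (y i) \<alpha> \<beta> pq) = 0) \<Longrightarrow> (\<forall>pq\<in>exps d (d - s). c pq = 0)" by blast
  have "\<forall>pq\<in>exps d (d - s). c pq = 0"
    if 1: "\<forall>i<N. \<forall>\<alpha> \<beta>. \<alpha> + \<beta> < e \<longrightarrow> (\<Sum>pq\<in>exps d (d - s). c pq * tay (x i) (y i) \<alpha> \<beta> pq) = 0"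
      and 2: "\<forall>i<D. (\<Sum>pq\<in>exps d (d - s). c pq * tay (x (N + i)) (y (N + i)) 0 0 pq) = 0" for c
  proof (rule xy, intro allI impI)
    fix i \<alpha> \<beta> assume i: "i < length pts" and ab: "\<alpha> + \<beta> < fst (pts ! i)"
    show "(\<Sum>pq\<in>exps d (d - s). c pq * tay (x i) (y i) \<alpha> \<beta> pq) = 0"
    proof (cases "i < N")
      case True
      then show ?thesis using 1 ab fst1 by simp
    next
      case False
      then have "N + (i - N) = i" "i - N < D" using i len1 by (auto simp: pts_def)
      then show ?thesis using 2 ab fst2[of "i - N"] by (metis add_is_0 less_one)
    qed
  qed
  note main = this
  have "\<forall>c. (\<forall>i<n - \<epsilon>. \<forall>\<alpha> \<beta>. \<alpha> + \<beta> < e \<longrightarrow> (\<Sum>pq\<in>exps d (d - \<epsilon> * e). c pq * tay (x i) (y i) \<alpha> \<beta> pq) = 0) \<longrightarrow>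
      (\<forall>i<D. (\<Sum>pq\<in>exps d (d - \<epsilon> * e). c pq * tay (x (n - \<epsilon> + i)) (y (n - \<epsilon> + i)) 0 0 pq) = 0) \<longrightarrow>
      (\<forall>pq\<in>exps d (d - \<epsilon> * e). c pq = 0)"
    by (intro allI impI) (rule main[unfolded N_def s_def])
  moreover have "\<epsilon> = 0 \<or> \<epsilon> = 1 \<and> e \<le> d" using \<epsilon>01 de by simp
  ultimately show ?thesis using \<epsilon>n by (intro exI[of _ \<epsilon>] conjI exI[of _ x] exI[of _ y]) assumption+
qed

section \<open>Moving a point to infinity\<close>

text \<open>The Hasse derivatives at \<open>s\<close> are the coefficients of the polynomial shifted
  by \<open>s\<close>, in every characteristic.\<close>

lemma hasse_dvd_iff:
  fixes c :: "nat \<Rightarrow> 'k::field"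
  shows "[:- s, 1:] ^ \<rho> dvd (\<Sum>b\<le>D. monom (c b) b) \<longleftrightarrow> (\<forall>\<beta><\<rho>. (\<Sum>b\<le>D. c b * (of_nat (b choose \<beta>) * s ^ (b - \<beta>))) = 0)"
proof -
  define p where "p = (\<Sum>b\<le>D. monom (c b) b)"
  have "pcompose (monom z b) [:s, 1:] = smult z ([:s, 1:] ^ b)" for z :: 'k and b
    by (induction b) (simp_all add: monom_0 monom_Suc pcompose_pCons)
  moreover have "coeff ([:s, 1:] ^ b) \<beta> = of_nat (b choose \<beta>) * s ^ (b - \<beta>)" for b \<beta>
  proof (cases "\<beta> \<le> b")
    case False
    then have "degree ([:s, 1:] ^ b) < \<beta>" by (simp only: degree_linear_power not_le)
    then show ?thesis using False by (simp add: coeff_eq_0 binomial_eq_0)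
  qed (simp add: coeff_linear_poly_power)
  ultimately have cf: "coeff (pcompose p [:s, 1:]) \<beta> = (\<Sum>b\<le>D. c b * (of_nat (b choose \<beta>) * s ^ (b - \<beta>)))" for \<beta>
    by (simp add: p_def pcompose_sum coeff_sum)
  have "coeff (pcompose p [:s, 1:]) \<beta> = 0" if dv: "[:- s, 1:] ^ \<rho> dvd p" and "\<beta> < \<rho>" for \<beta>
  proof -
    obtain g where "p = [:- s, 1:] ^ \<rho> * g" using dv by (rule dvdE)
    moreover have "pcompose ([:- s, 1:] ^ n) [:s, 1:] = monom 1 n" for n
    proof (induction n)
      case (Suc n)
      have "pcompose [:- s, 1:] [:s, 1:] = [:0, 1:]" by (simp add: pcompose_pCons)
      then show ?case by (simp only: power_Suc pcompose_mult Suc.IH) (simp add: monom_Suc)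
    qed (simp add: pcompose_1)
    ultimately have "pcompose p [:s, 1:] = monom 1 \<rho> * pcompose g [:s, 1:]" by (simp add: pcompose_mult)
    then show ?thesis using that by (simp add: coeff_monom_mult)
  qed
  then show ?thesis using taylor_shift_dvd[of \<rho> p s] unfolding cf p_def[symmetric] by blast
qed

text \<open>Inversion of the coordinate takes a root s to 1 / s with the same multiplicity. Reversal
  is with respect to \<open>D\<close> rather than to the degree, which merely adds a power of the
  variable.\<close>

lemma hasse_reverse:
  fixes c :: "nat \<Rightarrow> 'k::field"
  assumes s: "s \<noteq> 0" and z: "\<And>\<beta>. \<beta> < \<rho> \<Longrightarrow> (\<Sum>b\<le>D. c b * (of_nat (b choose \<beta>) * s ^ (b - \<beta>))) = 0" and \<gamma>: "\<gamma> < \<rho>"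
  shows "(\<Sum>b\<le>D. c b * (of_nat ((D - b) choose \<gamma>) * (1 / s) ^ (D - b - \<gamma>))) = 0"
proof -
  define p where "p = (\<Sum>b\<le>D. monom (c b) b)"
  define q where "q = (\<Sum>b\<le>D. monom (c (D - b)) b)"
  have cp: "coeff p b = (if b \<le> D then c b else 0)" for b by (simp add: p_def coeff_sum)
  have cq: "coeff q b = (if b \<le> D then c (D - b) else 0)" for b by (simp add: q_def coeff_sum)
  have dp: "degree p \<le> D" by (rule degree_le) (simp add: cp)
  have "[:- s, 1:] ^ \<rho> dvd p" unfolding p_def hasse_dvd_iff using z by blast
  then obtain g where g: "p = [:- s, 1:] ^ \<rho> * g" by (rule dvdE)
  have "reflect_poly [:- s, 1:] = [:1, - s:]" by (simp add: reflect_poly_pCons' monom_altdef one_pCons)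
  also have "\<dots> = [:- s:] * [:- (1 / s), 1:]" using s by simp
  finally have "reflect_poly p = [:- s:] ^ \<rho> * [:- (1 / s), 1:] ^ \<rho> * reflect_poly g"
    unfolding g by (simp only: reflect_poly_mult reflect_poly_power power_mult_distrib)
  then have "[:- (1 / s), 1:] ^ \<rho> dvd reflect_poly p" by simp
  moreover have "q = monom 1 (D - degree p) * reflect_poly p"
  proof (rule poly_eqI)
    fix b
    show "coeff q b = coeff (monom 1 (D - degree p) * reflect_poly p) b"
      using dp coeff_eq_0[of p "D - b"] by (auto simp: cq cp coeff_monom_mult coeff_reflect_poly coeff_eq_0 not_le intro!: arg_cong[of _ _ c])
  qed
  ultimately have "[:- (1 / s), 1:] ^ \<rho> dvd q" by simp
  then have "(\<Sum>b\<le>D. c (D - b) * (of_nat (b choose \<gamma>) * (1 / s) ^ (b - \<gamma>))) = 0"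
    unfolding q_def hasse_dvd_iff using \<gamma> by blast
  also have "(\<Sum>b\<le>D. c (D - b) * (of_nat (b choose \<gamma>) * (1 / s) ^ (b - \<gamma>))) =
      (\<Sum>b\<le>D. c b * (of_nat ((D - b) choose \<gamma>) * (1 / s) ^ (D - b - \<gamma>)))"
    by (rule sum.reindex_bij_witness[of _ "\<lambda>b. D - b" "\<lambda>b. D - b"]) auto
  finally show ?thesis .
qed

lemma sum_exps_column:
  assumes "\<alpha> \<le> d"
  shows "(\<Sum>pq\<in>exps d d. if fst pq = \<alpha> then f pq else 0) = (\<Sum>b\<le>d - \<alpha>. f (\<alpha>, b))"
proof -
  have "(\<Sum>pq\<in>exps d d. if fst pq = \<alpha> then f pq else 0) = (\<Sum>pq\<in>exps d d \<inter> {pq. fst pq = \<alpha>}. f pq)"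
    by (subst sum.inter_restrict) auto
  also have "\<dots> = (\<Sum>b\<le>d - \<alpha>. f (\<alpha>, b))"
    by (rule sum.reindex_bij_witness[of _ "\<lambda>b. (\<alpha>, b)" snd]) (use assms in \<open>auto simp: exps_def\<close>)
  finally show ?thesis .
qed

text \<open>The point \<open>(0, 1 / t)\<close> tends to \<open>(0 : 1 : 0)\<close> as \<open>t\<close> tends to \<open>0\<close>; in the limit, multiplicity \<open>e\<close> there
  means that no exponent of \<open>y\<close> above \<open>d - e\<close> occurs.\<close>

lemma add_point_at_infinity:
  fixes g :: "'j \<Rightarrow> nat \<times> nat \<Rightarrow> 'k::field"
  assumes inf: "infinite (UNIV :: 'k set)" and ed: "e \<le> d"
    and inj: "\<And>c. (\<And>j. j \<in> J \<Longrightarrow> (\<Sum>pq\<in>exps d (d - e). c pq * g j pq) = 0) \<Longrightarrow> \<forall>pq\<in>exps d (d - e). c pq = 0"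
  shows "\<exists>s. \<forall>c. (\<forall>j\<in>J. (\<Sum>pq\<in>exps d d. c pq * g j pq) = 0) \<longrightarrow>
      (\<forall>\<alpha> \<beta>. \<alpha> + \<beta> < e \<longrightarrow> (\<Sum>pq\<in>exps d d. c pq * tay 0 s \<alpha> \<beta> pq) = 0) \<longrightarrow> (\<forall>pq\<in>exps d d. c pq = 0)"
proof -
  \<comment> \<open>The conditions at (0, 1 / t), seen from infinity. As x = 0 they separate by the
    exponent \<alpha> of x, and each column of coefficients, reversed, satisfies Hasse conditions at
    t. These entries are polynomial in t, and at t = 0 only the exponent d - \<alpha> - \<gamma> of
    y survives.\<close>
  define m where "m j pq = (case j of Inl j \<Rightarrow> [:g j pq:]
    | Inr (\<alpha>, \<gamma>) \<Rightarrow> (if fst pq = \<alpha> then monom (of_nat ((d - \<alpha> - snd pq) choose \<gamma>)) (d - \<alpha> - snd pq - \<gamma>) else 0))"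
    for j :: "'j + nat \<times> nat" and pq
  define J' where "J' = Inl ` J \<union> Inr ` {(\<alpha>, \<gamma>). \<alpha> + \<gamma> < e}"
  have "finite {t. \<not> (\<forall>v. (\<forall>j\<in>J'. (\<Sum>pq\<in>exps d d. poly (m j pq) t * v pq) = 0) \<longrightarrow> (\<forall>pq\<in>exps d d. v pq = 0))}"
  proof (rule generic_injective[OF finite_exps])
    fix v pq assume ker: "\<And>j. j \<in> J' \<Longrightarrow> (\<Sum>pq\<in>exps d d. m j pq * v pq) = 0" and pq: "pq \<in> exps d d"
    have top: "coeff (v (\<alpha>, d - \<alpha> - \<gamma>)) 0 = 0" if "\<alpha> + \<gamma> < e" for \<alpha> \<gamma>
    proof -
      have \<gamma>: "\<gamma> \<le> d - \<alpha>" "\<alpha> \<le> d" using that ed by auto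
      have "(\<Sum>pq\<in>exps d d. m (Inr (\<alpha>, \<gamma>)) pq * v pq) = 0" using that by (intro ker) (auto simp: J'_def)
      also have "(\<Sum>pq\<in>exps d d. m (Inr (\<alpha>, \<gamma>)) pq * v pq) = (\<Sum>pq\<in>exps d d. if fst pq = \<alpha>
          then monom (of_nat ((d - \<alpha> - snd pq) choose \<gamma>)) (d - \<alpha> - snd pq - \<gamma>) * v pq else 0)"
        by (intro sum.cong) (auto simp: m_def)
      also have "\<dots> = (\<Sum>b\<le>d - \<alpha>. monom (of_nat ((d - \<alpha> - b) choose \<gamma>)) (d - \<alpha> - b - \<gamma>) * v (\<alpha>, b))"
        using \<gamma> by (subst sum_exps_column) auto
      finally have "(\<Sum>b\<le>d - \<alpha>. coeff (monom (of_nat ((d - \<alpha> - b) choose \<gamma>)) (d - \<alpha> - b - \<gamma>) * v (\<alpha>, b)) 0) = 0"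
        by (simp flip: coeff_sum)
      also have "(\<Sum>b\<le>d - \<alpha>. coeff (monom (of_nat ((d - \<alpha> - b) choose \<gamma>)) (d - \<alpha> - b - \<gamma>) * v (\<alpha>, b)) 0) =
          (\<Sum>b\<in>{d - \<alpha> - \<gamma>}. coeff (v (\<alpha>, b)) 0)"
      proof (rule sum.mono_neutral_cong_right)
        show "\<forall>b\<in>{..d - \<alpha>} - {d - \<alpha> - \<gamma>}. coeff (monom (of_nat ((d - \<alpha> - b) choose \<gamma>)) (d - \<alpha> - b - \<gamma>) * v (\<alpha>, b)) 0 = 0"
        proof
          fix b assume b: "b \<in> {..d - \<alpha>} - {d - \<alpha> - \<gamma>}"
          show "coeff (monom (of_nat ((d - \<alpha> - b) choose \<gamma>)) (d - \<alpha> - b - \<gamma>) * v (\<alpha>, b)) 0 = 0"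
          proof (cases "d - \<alpha> - b < \<gamma>")
            case False
            then have "0 < d - \<alpha> - b - \<gamma>" using b by auto
            then show ?thesis by (simp add: coeff_monom_mult)
          qed (simp add: binomial_eq_0)
        qed
      qed (use \<gamma> in \<open>auto simp: coeff_monom_mult\<close>)
      finally show ?thesis by simp
    qed
    have high: "coeff (v (a, b)) 0 = 0" if "(a, b) \<in> exps d d - exps d (d - e)" for a b
      using top[of a "d - a - b"] that ed by (auto simp: exps_def)
    have sub: "exps d (d - e) \<subseteq> exps d d" by (auto simp: exps_def)
    have "\<forall>pq\<in>exps d (d - e). coeff (v pq) 0 = 0"
    proof (rule inj)
      fix j assume j: "j \<in> J"
      have "(\<Sum>pq\<in>exps d (d - e). coeff (v pq) 0 * g j pq) = (\<Sum>pq\<in>exps d d. coeff (v pq) 0 * g j pq)"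
        using high by (intro sum.mono_neutral_left sub finite_exps) auto
      also have "\<dots> = coeff (\<Sum>pq\<in>exps d d. m (Inl j) pq * v pq) 0" by (simp add: m_def coeff_sum mult.commute)
      also have "\<dots> = 0" using ker[of "Inl j"] j by (simp add: J'_def)
      finally show "(\<Sum>pq\<in>exps d (d - e). coeff (v pq) 0 * g j pq) = 0" .
    qed
    then show "coeff (v pq) 0 = 0" using high[of "fst pq" "snd pq"] pq by (cases "pq \<in> exps d (d - e)") auto
  qed
  then have "finite (insert 0 {t. \<not> (\<forall>v. (\<forall>j\<in>J'. (\<Sum>pq\<in>exps d d. poly (m j pq) t * v pq) = 0) \<longrightarrow> (\<forall>pq\<in>exps d d. v pq = 0))})"
    by simp
  from ex_new_if_finite[OF inf this] obtain t where
    "t \<notin> insert 0 {t. \<not> (\<forall>v. (\<forall>j\<in>J'. (\<Sum>pq\<in>exps d d. poly (m j pq) t * v pq) = 0) \<longrightarrow> (\<forall>pq\<in>exps d d. v pq = 0))}" ..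
  then have t0: "t \<noteq> 0" and t: "(\<forall>j\<in>J'. (\<Sum>pq\<in>exps d d. poly (m j pq) t * v pq) = 0) \<Longrightarrow> (\<forall>pq\<in>exps d d. v pq = 0)" for v
    by blast+
  have "\<forall>pq\<in>exps d d. c pq = 0"
    if c1: "\<forall>j\<in>J. (\<Sum>pq\<in>exps d d. c pq * g j pq) = 0"
      and c2: "\<forall>\<alpha> \<beta>. \<alpha> + \<beta> < e \<longrightarrow> (\<Sum>pq\<in>exps d d. c pq * tay 0 (1 / t) \<alpha> \<beta> pq) = 0" for c
  proof (rule t, rule ballI)
    fix j assume j: "j \<in> J'"
    show "(\<Sum>pq\<in>exps d d. poly (m j pq) t * c pq) = 0"
    proof (cases j)
      case (Inl j')
      then show ?thesis using c1 j by (auto simp: J'_def m_def mult.commute)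
    next
      case (Inr \<alpha>\<gamma>)
      then obtain \<alpha> \<gamma> where j: "j = Inr (\<alpha>, \<gamma>)" and \<alpha>: "\<alpha> + \<gamma> < e" using j by (auto simp: J'_def)
      have \<alpha>d: "\<alpha> \<le> d" using \<alpha> ed by simp
      have "(\<Sum>b\<le>d - \<alpha>. c (\<alpha>, b) * (of_nat (b choose \<beta>) * (1 / t) ^ (b - \<beta>))) = 0" if "\<beta> < e - \<alpha>" for \<beta>
      proof -
        have "tay 0 (1 / t) \<alpha> \<beta> pq = (if fst pq = \<alpha> then of_nat (snd pq choose \<beta>) * (1 / t) ^ (snd pq - \<beta>) else 0)" for pq
          by (cases "fst pq < \<alpha>") (auto simp: tay_def binomial_eq_0 power_0_left)
        then have "(\<Sum>pq\<in>exps d d. c pq * tay 0 (1 / t) \<alpha> \<beta> pq) =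
          (\<Sum>pq\<in>exps d d. if fst pq = \<alpha> then c pq * (of_nat (snd pq choose \<beta>) * (1 / t) ^ (snd pq - \<beta>)) else 0)"
          by (intro sum.cong) auto
        then show ?thesis using c2[rule_format, of \<alpha> \<beta>] that sum_exps_column[OF \<alpha>d, of "\<lambda>pq. c pq * (of_nat (snd pq choose \<beta>) * (1 / t) ^ (snd pq - \<beta>))"]
          by (simp del: power_one_over)
      qed
      then have "(\<Sum>b\<le>d - \<alpha>. c (\<alpha>, b) * (of_nat ((d - \<alpha> - b) choose \<gamma>) * (1 / (1 / t)) ^ (d - \<alpha> - b - \<gamma>))) = 0"
        using t0 \<alpha> by (intro hasse_reverse[of "1 / t" "e - \<alpha>"]) auto
      then have rev: "(\<Sum>b\<le>d - \<alpha>. c (\<alpha>, b) * (of_nat ((d - \<alpha> - b) choose \<gamma>) * t ^ (d - \<alpha> - b - \<gamma>))) = 0"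
        by simp
      have "(\<Sum>pq\<in>exps d d. poly (m j pq) t * c pq) = (\<Sum>pq\<in>exps d d. if fst pq = \<alpha>
          then c pq * (of_nat ((d - \<alpha> - snd pq) choose \<gamma>) * t ^ (d - \<alpha> - snd pq - \<gamma>)) else 0)"
        by (intro sum.cong) (auto simp: m_def j poly_monom)
      also have "\<dots> = (\<Sum>b\<le>d - \<alpha>. c (\<alpha>, b) * (of_nat ((d - \<alpha> - b) choose \<gamma>) * t ^ (d - \<alpha> - b - \<gamma>)))"
        by (subst sum_exps_column[OF \<alpha>d]) simp
      finally show ?thesis using rev by simp
    qed
  qed
  then show ?thesis by blast
qed

text \<open>The additional conditions are returned as functionals \<open>g\<close> and not as
  points: they come from old points, one of whose indices may now be taken by the point moved in
  from infinity. Later only their number matters.\<close>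

theorem affine_points:
  fixes e d n D E :: nat
  assumes inf: "infinite (UNIV :: 'k::field set)" and e: "1 \<le> e" and d: "(2 * e - 1) * (e + 1) \<le> d + 1"
    and count: "tri (d + 1) + E = n * tri e + D" and E: "E < tri e" and D: "D < tri e"
  shows "\<exists>(x :: nat \<Rightarrow> 'k) y g. \<forall>c.
      (\<forall>i<n. \<forall>\<alpha> \<beta>. \<alpha> + \<beta> < e \<longrightarrow> (\<Sum>pq\<in>exps d d. c pq * tay (x i) (y i) \<alpha> \<beta> pq) = 0) \<longrightarrow>
      (\<forall>i<D. (\<Sum>pq\<in>exps d d. c pq * g i pq) = 0) \<longrightarrow> (\<forall>pq\<in>exps d d. c pq = 0)"
proof -
  obtain \<epsilon> x y where \<epsilon>n: "\<epsilon> \<le> n" and \<epsilon>: "\<epsilon> = 0 \<or> \<epsilon> = 1 \<and> e \<le> d" and xy: "\<forall>c :: nat \<times> nat \<Rightarrow> 'k.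
      (\<forall>i<n - \<epsilon>. \<forall>\<alpha> \<beta>. \<alpha> + \<beta> < e \<longrightarrow> (\<Sum>pq\<in>exps d (d - \<epsilon> * e). c pq * tay (x i) (y i) \<alpha> \<beta> pq) = 0) \<longrightarrow>
      (\<forall>i<D. (\<Sum>pq\<in>exps d (d - \<epsilon> * e). c pq * tay (x (n - \<epsilon> + i)) (y (n - \<epsilon> + i)) 0 0 pq) = 0) \<longrightarrow>
      (\<forall>pq\<in>exps d (d - \<epsilon> * e). c pq = 0)"
    using balanced_points[OF assms] by (elim exE conjE) (rule that)
  define g where "g i = tay (x (n - \<epsilon> + i)) (y (n - \<epsilon> + i)) 0 0" for i
  show ?thesis
  proof (cases "\<epsilon> = 0")
    case True
    then show ?thesis using xy by (intro exI[of _ x] exI[of _ y] exI[of _ g]) (simp add: g_def)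
  next
    case False
    then have \<epsilon>1: "\<epsilon> = 1" and ed: "e \<le> d" using \<epsilon> by auto
    define J where "J = Inl ` {(i, \<alpha>, \<beta>). i < n - 1 \<and> \<alpha> + \<beta> < e} \<union> Inr ` {..<D}"
    define G where "G j = (case j of Inl (i, \<alpha>, \<beta>) \<Rightarrow> tay (x i) (y i) \<alpha> \<beta> | Inr i \<Rightarrow> g i)" for j :: "nat \<times> nat \<times> nat + nat"
    have "\<exists>s. \<forall>c. (\<forall>j\<in>J. (\<Sum>pq\<in>exps d d. c pq * G j pq) = 0) \<longrightarrow>
      (\<forall>\<alpha> \<beta>. \<alpha> + \<beta> < e \<longrightarrow> (\<Sum>pq\<in>exps d d. c pq * tay 0 s \<alpha> \<beta> pq) = 0) \<longrightarrow> (\<forall>pq\<in>exps d d. c pq = 0)"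
    proof (rule add_point_at_infinity[OF inf ed])
      fix c assume c: "\<And>j. j \<in> J \<Longrightarrow> (\<Sum>pq\<in>exps d (d - e). c pq * G j pq) = 0"
      have h1: "(\<Sum>pq\<in>exps d (d - e). c pq * tay (x i) (y i) \<alpha> \<beta> pq) = 0" if "i < n - 1" "\<alpha> + \<beta> < e" for i \<alpha> \<beta>
        using c[of "Inl (i, \<alpha>, \<beta>)"] that by (simp add: J_def G_def)
      have h2: "(\<Sum>pq\<in>exps d (d - e). c pq * g i pq) = 0" if "i < D" for i
        using c[of "Inr i"] that by (simp add: J_def G_def)
      show "\<forall>pq\<in>exps d (d - e). c pq = 0"
      proof (rule xy[unfolded \<epsilon>1 mult_1, THEN spec, THEN mp, THEN mp])
        show "\<forall>i<n - 1. \<forall>\<alpha> \<beta>. \<alpha> + \<beta> < e \<longrightarrow> (\<Sum>pq\<in>exps d (d - e). c pq * tay (x i) (y i) \<alpha> \<beta> pq) = 0"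
          using h1 by simp
        show "\<forall>i<D. (\<Sum>pq\<in>exps d (d - e). c pq * tay (x (n - 1 + i)) (y (n - 1 + i)) 0 0 pq) = 0"
          using h2 unfolding g_def \<epsilon>1 by simp
      qed
    qed
    then obtain s where s: "\<And>c. (\<forall>j\<in>J. (\<Sum>pq\<in>exps d d. c pq * G j pq) = 0) \<Longrightarrow>
      (\<forall>\<alpha> \<beta>. \<alpha> + \<beta> < e \<longrightarrow> (\<Sum>pq\<in>exps d d. c pq * tay 0 s \<alpha> \<beta> pq) = 0) \<Longrightarrow> (\<forall>pq\<in>exps d d. c pq = 0)" by blast
    define x' where "x' = x(n - 1 := 0)"
    define y' where "y' = y(n - 1 := s)"
    have "\<forall>pq\<in>exps d d. c pq = 0"
      if c1: "\<forall>i<n. \<forall>\<alpha> \<beta>. \<alpha> + \<beta> < e \<longrightarrow> (\<Sum>pq\<in>exps d d. c pq * tay (x' i) (y' i) \<alpha> \<beta> pq) = 0"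
        and c2: "\<forall>i<D. (\<Sum>pq\<in>exps d d. c pq * g i pq) = 0" for c
    proof (rule s)
      have "n - 1 < n" using \<epsilon>n \<epsilon>1 by simp
      then show "\<forall>\<alpha> \<beta>. \<alpha> + \<beta> < e \<longrightarrow> (\<Sum>pq\<in>exps d d. c pq * tay 0 s \<alpha> \<beta> pq) = 0"
        using c1[rule_format, of "n - 1"] by (simp add: x'_def y'_def)
      have "(\<Sum>pq\<in>exps d d. c pq * tay (x i) (y i) \<alpha> \<beta> pq) = 0" if "i < n - 1" "\<alpha> + \<beta> < e" for i \<alpha> \<beta>
        using c1[rule_format, of i \<alpha> \<beta>] that by (simp add: x'_def y'_def)
      then show "\<forall>j\<in>J. (\<Sum>pq\<in>exps d d. c pq * G j pq) = 0" using c2 by (auto simp: J_def G_def)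
    qed
    note main = this
    show ?thesis
      by (rule exI[of _ x'], rule exI[of _ y'], rule exI[of _ g], intro allI impI) (rule main)
  qed
qed

section \<open>Plane curves and affine charts\<close>

definition mon_eval :: "('v \<Rightarrow> 'r::comm_ring_1) \<Rightarrow> ('v \<Rightarrow>\<^sub>0 nat) \<Rightarrow> 'r"
  where "mon_eval f m = (\<Prod>v\<in>Poly_Mapping.keys m. f v ^ Poly_Mapping.lookup m v)"

definition ring_map :: "('a::comm_ring_1 \<Rightarrow> 'r::comm_ring_1) \<Rightarrow> bool"
  where "ring_map \<phi> \<longleftrightarrow> \<phi> 0 = 0 \<and> \<phi> 1 = 1 \<and> (\<forall>a b. \<phi> (a + b) = \<phi> a + \<phi> b) \<and> (\<forall>a b. \<phi> (a * b) = \<phi> a * \<phi> b)"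

lemma ring_mapD: "ring_map \<phi> \<Longrightarrow> \<phi> 0 = 0" "ring_map \<phi> \<Longrightarrow> \<phi> 1 = 1" "ring_map \<phi> \<Longrightarrow> \<phi> (a + b) = \<phi> a + \<phi> b"
  "ring_map \<phi> \<Longrightarrow> \<phi> (a * b) = \<phi> a * \<phi> b"
  by (auto simp: ring_map_def)

lemma ring_map_power: "ring_map \<phi> \<Longrightarrow> \<phi> (a ^ n) = \<phi> a ^ n"
  by (induction n) (auto simp: ring_mapD)

lemma ring_map_sum: "ring_map \<phi> \<Longrightarrow> \<phi> (sum f A) = (\<Sum>x\<in>A. \<phi> (f x))"
  by (induction A rule: infinite_finite_induct) (auto simp: ring_mapD)

lemma ring_map_of_nat: "ring_map \<phi> \<Longrightarrow> \<phi> (of_nat n) = of_nat n"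
  by (induction n) (auto simp: ring_mapD)

lemma ring_map_diff: "ring_map \<phi> \<Longrightarrow> \<phi> (a - b) = \<phi> a - \<phi> b"
  using ring_mapD(3)[of \<phi> "a - b" b] by simp

lemma mon_eval_superset:
  assumes "finite S" "Poly_Mapping.keys m \<subseteq> S"
  shows "mon_eval f m = (\<Prod>v\<in>S. f v ^ Poly_Mapping.lookup m v)"
  unfolding mon_eval_def using assms
  by (intro prod.mono_neutral_left) (auto simp: in_keys_iff)

lemma mon_eval_0 [simp]: "mon_eval f 0 = 1"
  by (simp add: mon_eval_def)

lemma mon_eval_single [simp]: "mon_eval f (Poly_Mapping.single v n) = f v ^ n"
  by (subst mon_eval_superset[of "{v}"]) auto

lemma mon_eval_add: "mon_eval f (m + m') = mon_eval f m * mon_eval f m'"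
proof -
  let ?S = "Poly_Mapping.keys m \<union> Poly_Mapping.keys m'"
  have "mon_eval f (m + m') = (\<Prod>v\<in>?S. f v ^ Poly_Mapping.lookup (m + m') v)"
    by (intro mon_eval_superset keys_add) auto
  also have "\<dots> = (\<Prod>v\<in>?S. f v ^ Poly_Mapping.lookup m v) * (\<Prod>v\<in>?S. f v ^ Poly_Mapping.lookup m' v)"
    by (simp add: lookup_add power_add prod.distrib)
  also have "\<dots> = mon_eval f m * mon_eval f m'"
    by (intro arg_cong2[of _ _ _ _ times] mon_eval_superset[symmetric]) auto
  finally show ?thesis .
qed

lemma mp_subst_superset:
  assumes "\<phi> 0 = 0" "finite S" "Poly_Mapping.keys F \<subseteq> S"
  shows "mp_subst \<phi> f F = (\<Sum>m\<in>S. \<phi> (Poly_Mapping.lookup F m) * mon_eval f m)"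
  unfolding mp_subst_def mon_eval_def using assms
  by (intro sum.mono_neutral_left) (auto simp: in_keys_iff)

lemma mp_subst_0 [simp]: "mp_subst \<phi> f 0 = 0"
  by (simp add: mp_subst_def)

lemma mp_subst_single: "\<phi> 0 = 0 \<Longrightarrow> mp_subst \<phi> f (Poly_Mapping.single m c) = \<phi> c * mon_eval f m"
  by (subst mp_subst_superset[of _ "{m}"]) auto

lemma mp_subst_add:
  assumes "ring_map \<phi>"
  shows "mp_subst \<phi> f (F + G) = mp_subst \<phi> f F + mp_subst \<phi> f G"
proof -
  let ?S = "Poly_Mapping.keys F \<union> Poly_Mapping.keys G"
  have 0: "\<phi> 0 = 0" using assms by (rule ring_mapD)
  have "mp_subst \<phi> f H = (\<Sum>m\<in>?S. \<phi> (Poly_Mapping.lookup H m) * mon_eval f m)" if "H \<in> {F, G, F + G}" for H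
    using that keys_add[of F G] by (intro mp_subst_superset[of \<phi>, OF 0]) auto
  then show ?thesis by (simp add: lookup_add ring_mapD[OF assms] distrib_right sum.distrib)
qed

lemma mp_subst_sum:
  assumes "ring_map \<phi>"
  shows "mp_subst \<phi> f (\<Sum>x\<in>A. F x) = (\<Sum>x\<in>A. mp_subst \<phi> f (F x))"
  by (induction A rule: infinite_finite_induct) (auto simp: mp_subst_add[OF assms])

lemma sum_singles: "F = (\<Sum>m\<in>Poly_Mapping.keys F. Poly_Mapping.single m (Poly_Mapping.lookup F m))"
proof (rule poly_mapping_eqI)
  fix m
  have "Poly_Mapping.lookup (\<Sum>m\<in>Poly_Mapping.keys F. Poly_Mapping.single m (Poly_Mapping.lookup F m)) m =
      (\<Sum>m'\<in>Poly_Mapping.keys F. if m = m' then Poly_Mapping.lookup F m' else 0)"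
    unfolding lookup_sum by (intro sum.cong) (auto simp: lookup_single when_def)
  then show "Poly_Mapping.lookup F m = Poly_Mapping.lookup (\<Sum>m\<in>Poly_Mapping.keys F. Poly_Mapping.single m (Poly_Mapping.lookup F m)) m"
    by (simp add: in_keys_iff)
qed

lemma mp_subst_mult:
  assumes "ring_map \<phi>"
  shows "mp_subst \<phi> f (F * G) = mp_subst \<phi> f F * mp_subst \<phi> f G"
proof -
  have 0: "\<phi> 0 = 0" using assms by (rule ring_mapD)
  let ?s = "\<lambda>F. \<Sum>m\<in>Poly_Mapping.keys F. Poly_Mapping.single m (Poly_Mapping.lookup F m)"
  have "mp_subst \<phi> f (?s F * ?s G) = mp_subst \<phi> f (?s F) * mp_subst \<phi> f (?s G)"
    unfolding sum_product mp_subst_sum[OF assms] mult_single mp_subst_single[of \<phi>, OF 0]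
    by (intro sum.cong refl) (simp add: ring_mapD[OF assms] mon_eval_add mult_ac)
  then show ?thesis by (simp flip: sum_singles)
qed

lemma mp_subst_Const: "ring_map \<phi> \<Longrightarrow> mp_subst \<phi> f (Const c) = \<phi> c"
  by (simp add: Const_def mp_subst_single ring_mapD)

lemma mp_subst_Var: "ring_map \<phi> \<Longrightarrow> mp_subst \<phi> f (Var v) = f v"
  by (simp add: Var_def mp_subst_single ring_mapD)

lemma ring_map_mp_subst:
  assumes r: "ring_map \<phi>"
  shows "ring_map (mp_subst \<phi> f)"
proof -
  have "mp_subst \<phi> f (Poly_Mapping.single 0 1) = 1"
    unfolding mp_subst_single[of \<phi>, OF ring_mapD(1)[OF r]] ring_mapD(2)[OF r] by simp
  then show ?thesis unfolding ring_map_def[of "mp_subst \<phi> f"] mp_subst_add[OF r] mp_subst_mult[OF r] by simp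
qed

lemma ring_map_Const: "ring_map (Const :: 'a::comm_ring_1 \<Rightarrow> ('v, 'a) mpoly)"
  by (auto simp: ring_map_def Const_def single_add mult_single)

lemma ring_map_id: "ring_map (\<lambda>c. c)"
  by (simp add: ring_map_def)

lemma mdeg_superset: "finite S \<Longrightarrow> Poly_Mapping.keys m \<subseteq> S \<Longrightarrow> mdeg m = (\<Sum>v\<in>S. Poly_Mapping.lookup m v)"
  unfolding mdeg_def by (intro sum.mono_neutral_left) (auto simp: in_keys_iff)

lemma mdeg_add: "mdeg (m + m') = mdeg m + mdeg m'"
proof -
  let ?S = "Poly_Mapping.keys m \<union> Poly_Mapping.keys m'"
  have "mdeg h = (\<Sum>v\<in>?S. Poly_Mapping.lookup h v)" if "h \<in> {m, m', m + m'}" for h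
    using that keys_add[of m m'] by (intro mdeg_superset) auto
  then show ?thesis by (simp add: lookup_add sum.distrib)
qed

lemma mdeg_single [simp]: "mdeg (Poly_Mapping.single v n) = n"
  by (subst mdeg_superset[of "{v}"]) auto

lemma mdeg_3: "mdeg (m :: 3 \<Rightarrow>\<^sub>0 nat) = Poly_Mapping.lookup m 1 + Poly_Mapping.lookup m 2 + Poly_Mapping.lookup m 3"
  by (subst mdeg_superset[of UNIV]) (auto simp: sum_3)

section \<open>Ternary forms and their order of vanishing in charts\<close>

definition plane_mono :: "nat \<Rightarrow> nat \<times> nat \<Rightarrow> 3 \<Rightarrow>\<^sub>0 nat"
  where "plane_mono d pq = Poly_Mapping.single 1 (fst pq) + Poly_Mapping.single 2 (snd pq) + Poly_Mapping.single 3 (d - fst pq - snd pq)"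

lemma lookup_plane_mono: "Poly_Mapping.lookup (plane_mono d pq) 1 = fst pq" "Poly_Mapping.lookup (plane_mono d pq) 2 = snd pq"
  "Poly_Mapping.lookup (plane_mono d pq) 3 = d - fst pq - snd pq"
  by (auto simp: plane_mono_def lookup_add lookup_single when_def)

lemma plane_mono_inj: "inj (plane_mono d)"
  by (rule injI) (metis lookup_plane_mono(1,2) prod_eqI)

lemma mdeg_plane_mono: "pq \<in> exps d d \<Longrightarrow> mdeg (plane_mono d pq) = d"
  by (auto simp: mdeg_3 lookup_plane_mono exps_def)

lemma plane_mono_surj: "mdeg m = d \<Longrightarrow> m = plane_mono d (Poly_Mapping.lookup m 1, Poly_Mapping.lookup m 2) \<and>
   (Poly_Mapping.lookup m 1, Poly_Mapping.lookup m 2) \<in> exps d d"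
proof
  assume m: "mdeg m = d"
  show "m = plane_mono d (Poly_Mapping.lookup m 1, Poly_Mapping.lookup m 2)"
  proof (rule poly_mapping_eqI)
    fix k :: 3
    show "Poly_Mapping.lookup m k = Poly_Mapping.lookup (plane_mono d (Poly_Mapping.lookup m 1, Poly_Mapping.lookup m 2)) k"
      using exhaust_3[of k] m by (auto simp: lookup_plane_mono mdeg_3)
  qed
qed (auto simp: exps_def mdeg_3)

definition form :: "nat \<Rightarrow> (nat \<times> nat \<Rightarrow> 'k::comm_ring_1) \<Rightarrow> (3, 'k) mpoly"
  where "form d c = (\<Sum>pq\<in>exps d d. Poly_Mapping.single (plane_mono d pq) (c pq))"

lemma lookup_form: "Poly_Mapping.lookup (form d c) m = (\<Sum>pq\<in>exps d d. if m = plane_mono d pq then c pq else 0)"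
  unfolding form_def lookup_sum by (intro sum.cong) (auto simp: lookup_single when_def)

lemma lookup_form_mono: "pq \<in> exps d d \<Longrightarrow> Poly_Mapping.lookup (form d c) (plane_mono d pq) = c pq"
  by (simp add: lookup_form inj_eq[OF plane_mono_inj])

lemma homogeneous_form: "homogeneous d (form d c)"
  unfolding homogeneous_def
proof
  fix m assume "m \<in> Poly_Mapping.keys (form d c)"
  then have "(\<Sum>pq\<in>exps d d. if m = plane_mono d pq then c pq else 0) \<noteq> 0" by (simp add: in_keys_iff lookup_form)
  then obtain pq where "pq \<in> exps d d" "(if m = plane_mono d pq then c pq else 0) \<noteq> 0"
    by (rule sum.not_neutral_contains_not_neutral)
  then show "mdeg m = d" by (simp add: mdeg_plane_mono split: if_splits)
qed

lemma homogeneous_is_form: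
  assumes "homogeneous d F"
  shows "F = form d (\<lambda>pq. Poly_Mapping.lookup F (plane_mono d pq))"
proof (rule poly_mapping_eqI)
  fix m
  show "Poly_Mapping.lookup F m = Poly_Mapping.lookup (form d (\<lambda>pq. Poly_Mapping.lookup F (plane_mono d pq))) m"
  proof (cases "mdeg m = d")
    case True
    then obtain pq where "m = plane_mono d pq" "pq \<in> exps d d" using plane_mono_surj by blast
    then show ?thesis by (simp add: lookup_form_mono)
  next
    case False
    then have "m \<notin> Poly_Mapping.keys F" "m \<notin> Poly_Mapping.keys (form d (\<lambda>pq. Poly_Mapping.lookup F (plane_mono d pq)))"
      using assms homogeneous_form unfolding homogeneous_def by blast+
    then show ?thesis by (simp add: in_keys_iff)
  qed
qed

lemma mp_subst_form:
  assumes "ring_map \<phi>"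
  shows "mp_subst \<phi> f (form d c) = (\<Sum>(p, q)\<in>exps d d. \<phi> (c (p, q)) * (f 1 ^ p * f 2 ^ q * f 3 ^ (d - p - q)))"
  unfolding form_def mp_subst_sum[OF assms]
  by (intro sum.cong) (auto simp: mp_subst_single ring_mapD[OF assms] plane_mono_def mon_eval_add)

definition mord :: "nat \<Rightarrow> ('v, 'a::comm_ring_1) mpoly \<Rightarrow> bool"
  where "mord e F \<longleftrightarrow> (\<forall>m\<in>Poly_Mapping.keys F. e \<le> mdeg m)"

lemma mord_0: "mord e 0" "mord 0 F"
  by (auto simp: mord_def)

lemma mord_add: "mord e F \<Longrightarrow> mord e G \<Longrightarrow> mord e (F + G)"
  by (auto simp: mord_def dest!: subsetD[OF keys_add])

lemma mord_sum: "(\<And>x. x \<in> A \<Longrightarrow> mord e (f x)) \<Longrightarrow> mord e (sum f A)"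
  by (induction A rule: infinite_finite_induct) (auto intro: mord_0 mord_add)

lemma mord_mult: "mord a F \<Longrightarrow> mord b G \<Longrightarrow> mord (a + b) (F * G)"
  unfolding mord_def
proof
  fix m assume F: "\<forall>m\<in>Poly_Mapping.keys F. a \<le> mdeg m" and G: "\<forall>m\<in>Poly_Mapping.keys G. b \<le> mdeg m"
    and "m \<in> Poly_Mapping.keys (F * G)"
  then obtain m1 m2 where "m = m1 + m2" "m1 \<in> Poly_Mapping.keys F" "m2 \<in> Poly_Mapping.keys G"
    using keys_mult[of F G] by auto
  then show "a + b \<le> mdeg m" using F G by (simp add: mdeg_add add_mono)
qed

lemma mord_mult_left: "mord b G \<Longrightarrow> mord b (F * G)"
  using mord_mult[OF mord_0(2), of b G F] by simp

lemma mord_power: "mord 1 F \<Longrightarrow> mord n (F ^ n)"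
proof (induction n)
  case (Suc n)
  then show ?case using mord_mult[of 1 F n "F ^ n"] by simp
qed (simp add: mord_0)

lemma mord_mono: "mord b F \<Longrightarrow> a \<le> b \<Longrightarrow> mord a F"
  by (auto simp: mord_def)

lemma mord_Var: "mord 1 (Var v :: ('v, 'a::comm_ring_1) mpoly)"
  by (simp add: mord_def Var_def)

text \<open>Taylor expansion at (v1 : v2 : 1) with the third coordinate \<open>U\<close> kept as a
  variable, so that it can be used in every chart; the affine expansion is the case \<open>U\<close>
  = 1.\<close>

lemma form_expansion:
  fixes \<kappa> :: "'k::comm_ring_1 \<Rightarrow> 'r::comm_ring_1"
  assumes \<kappa>: "ring_map \<kappa>"
  shows "(\<Sum>(p, q)\<in>exps d d. \<kappa> (c (p, q)) * ((\<kappa> v1 * U + Y1) ^ p * (\<kappa> v2 * U + Y2) ^ q * U ^ (d - p - q))) =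
    (\<Sum>\<alpha>\<le>d. \<Sum>\<beta>\<le>d. \<kappa> (\<Sum>pq\<in>exps d d. c pq * tay v1 v2 \<alpha> \<beta> pq) * (U ^ (d - \<alpha> - \<beta>) * Y1 ^ \<alpha> * Y2 ^ \<beta>))"
proof -
  \<comment> \<open>Both sides vanish when \<alpha> > p or \<beta> > q; otherwise the exponents of
    \<open>U\<close> add up to d - \<alpha> - \<beta> without truncation.\<close>
  have t: "tay (\<kappa> v1 * U) (\<kappa> v2 * U) \<alpha> \<beta> (p, q) * U ^ (d - p - q) = \<kappa> (tay v1 v2 \<alpha> \<beta> (p, q)) * U ^ (d - \<alpha> - \<beta>)"
    if "(p, q) \<in> exps d d" for p q \<alpha> \<beta>
  proof (cases "\<alpha> \<le> p \<and> \<beta> \<le> q")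
    case True
    then have "p - \<alpha> + (q - \<beta>) + (d - p - q) = d - \<alpha> - \<beta>" using that by (auto simp: exps_def)
    then have "U ^ (d - \<alpha> - \<beta>) = U ^ (p - \<alpha>) * U ^ (q - \<beta>) * U ^ (d - p - q)" by (metis power_add)
    then show ?thesis
      by (simp add: tay_def ring_mapD[OF \<kappa>] ring_map_power[OF \<kappa>] ring_map_of_nat[OF \<kappa>] power_mult_distrib mult_ac)
  qed (auto simp: tay_def binomial_eq_0 ring_mapD[OF \<kappa>] not_le)
  have "(\<Sum>(p, q)\<in>exps d d. \<kappa> (c (p, q)) * ((\<kappa> v1 * U + Y1) ^ p * (\<kappa> v2 * U + Y2) ^ q * U ^ (d - p - q))) =
    (\<Sum>pq\<in>exps d d. \<Sum>\<alpha>\<le>d. \<Sum>\<beta>\<le>d. \<kappa> (c pq) * \<kappa> (tay v1 v2 \<alpha> \<beta> pq) * (U ^ (d - \<alpha> - \<beta>) * Y1 ^ \<alpha> * Y2 ^ \<beta>))"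
  proof (intro sum.cong refl, clarify)
    fix p q assume pq: "(p, q) \<in> exps d d"
    then have "p \<le> d" "q \<le> d" by (auto simp: exps_def)
    have "\<kappa> (c (p, q)) * ((\<kappa> v1 * U + Y1) ^ p * (\<kappa> v2 * U + Y2) ^ q * U ^ (d - p - q)) =
      (\<Sum>\<alpha>\<le>d. \<Sum>\<beta>\<le>d. \<kappa> (c (p, q)) * (tay (\<kappa> v1 * U) (\<kappa> v2 * U) \<alpha> \<beta> (p, q) * U ^ (d - p - q)) * (Y1 ^ \<alpha> * Y2 ^ \<beta>))"
      unfolding taylor_expand[OF \<open>p \<le> d\<close> \<open>q \<le> d\<close>] by (simp add: sum_distrib_left sum_distrib_right mult_ac)
    then show "\<kappa> (c (p, q)) * ((\<kappa> v1 * U + Y1) ^ p * (\<kappa> v2 * U + Y2) ^ q * U ^ (d - p - q)) =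
      (\<Sum>\<alpha>\<le>d. \<Sum>\<beta>\<le>d. \<kappa> (c (p, q)) * \<kappa> (tay v1 v2 \<alpha> \<beta> (p, q)) * (U ^ (d - \<alpha> - \<beta>) * Y1 ^ \<alpha> * Y2 ^ \<beta>))"
      unfolding t[OF pq] by (simp only: mult.assoc)
  qed
  also have "\<dots> = (\<Sum>\<alpha>\<le>d. \<Sum>pq\<in>exps d d. \<Sum>\<beta>\<le>d. \<kappa> (c pq) * \<kappa> (tay v1 v2 \<alpha> \<beta> pq) * (U ^ (d - \<alpha> - \<beta>) * Y1 ^ \<alpha> * Y2 ^ \<beta>))"
    by (rule sum.swap)
  also have "\<dots> = (\<Sum>\<alpha>\<le>d. \<Sum>\<beta>\<le>d. \<Sum>pq\<in>exps d d. \<kappa> (c pq) * \<kappa> (tay v1 v2 \<alpha> \<beta> pq) * (U ^ (d - \<alpha> - \<beta>) * Y1 ^ \<alpha> * Y2 ^ \<beta>))"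
    by (intro sum.cong refl sum.swap)
  finally show ?thesis by (simp only: ring_map_sum[OF \<kappa>] ring_mapD(4)[OF \<kappa>] sum_distrib_right)
qed

lemma translate_dehomogenize_form:
  "mp_translate w (dehomogenize i (form d c)) = (\<Sum>(p, q)\<in>exps d d. Const (c (p, q)) *
     ((if 1 = i then 1 else Const (w 1) + Var 1) ^ p * (if 2 = i then 1 else Const (w 2) + Var 2) ^ q *
      (if 3 = i then 1 else Const (w 3) + Var 3) ^ (d - p - q)))"
proof -
  note r = ring_map_mp_subst[OF ring_map_Const]
  show ?thesis
    unfolding mp_translate_def dehomogenize_def mp_subst_form[OF ring_map_Const] ring_map_sum[OF r] case_prod_beta
    by (intro sum.cong refl)
      (auto simp: ring_mapD[OF r] ring_map_power[OF r] mp_subst_Const[OF ring_map_Const] mp_subst_Var[OF ring_map_Const])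
qed

text \<open>In any chart the linear forms z_1 - v1 z_3 and z_2 - v2 z_3 vanish at the point, so a
  Taylor term with exponents \<alpha> and \<beta> has order at least \<alpha> + \<beta>.\<close>

lemma chart_vanishing:
  fixes c :: "nat \<times> nat \<Rightarrow> 'k::field"
  assumes w: "w i = 1" "w 1 = w 3 * v1" "w 2 = w 3 * v2"
    and z: "\<And>\<alpha> \<beta>. \<alpha> + \<beta> < e \<Longrightarrow> (\<Sum>pq\<in>exps d d. c pq * tay v1 v2 \<alpha> \<beta> pq) = 0"
  shows "vanishes_to_order e (dehomogenize i (form d c)) w"
proof -
  define z where "z j = (if j = i then 1 else Const (w j) + Var j :: (3, 'k) mpoly)" for j
  define Y where "Y v j = z j - Const v * z 3" for v j
  have Y: "mord 1 (Y v j)" if "w j = w 3 * v" "j \<noteq> 3" for v j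
  proof -
    have C1: "Const 1 = (1 :: (3, 'k) mpoly)" by (rule ring_mapD(2)[OF ring_map_Const])
    have Cm: "Const (a * b) = (Const a * Const b :: (3, 'k) mpoly)" for a b by (rule ring_mapD(4)[OF ring_map_Const])
    consider "i = 3" | "i \<noteq> 3" "j = i" | "i \<noteq> 3" "j \<noteq> i" by blast
    then show ?thesis
    proof cases
      case 1
      then have "Y v j = Var j" using that w(1) by (simp add: Y_def z_def)
      then show ?thesis by (simp only: mord_Var)
    next
      case 2
      then have "Const (w 3) * Const v = (1 :: (3, 'k) mpoly)" using that w(1) C1 Cm by metis
      then have "Y v j = - Const v * Var 3" using 2 by (simp add: Y_def z_def algebra_simps)
      then show ?thesis by (simp only: mord_mult_left mord_Var)
    next
      case 3
      then have "Y v j = Var j + - Const v * Var 3" using that by (simp add: Y_def z_def Cm algebra_simps)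
      then show ?thesis by (simp only: mord_add mord_mult_left mord_Var)
    qed
  qed
  have "mp_translate w (dehomogenize i (form d c)) =
     (\<Sum>(p, q)\<in>exps d d. Const (c (p, q)) * ((Const v1 * z 3 + Y v1 1) ^ p * (Const v2 * z 3 + Y v2 2) ^ q * z 3 ^ (d - p - q)))"
    unfolding translate_dehomogenize_form by (simp add: Y_def z_def)
  also have "\<dots> = (\<Sum>\<alpha>\<le>d. \<Sum>\<beta>\<le>d. Const (\<Sum>pq\<in>exps d d. c pq * tay v1 v2 \<alpha> \<beta> pq) * (z 3 ^ (d - \<alpha> - \<beta>) * Y v1 1 ^ \<alpha> * Y v2 2 ^ \<beta>))"
    by (rule form_expansion[OF ring_map_Const])
  also have "mord e \<dots>"
  proof (intro mord_sum)
    fix \<alpha> \<beta>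
    show "mord e (Const (\<Sum>pq\<in>exps d d. c pq * tay v1 v2 \<alpha> \<beta> pq) * (z 3 ^ (d - \<alpha> - \<beta>) * Y v1 1 ^ \<alpha> * Y v2 2 ^ \<beta>))"
    proof (cases "\<alpha> + \<beta> < e")
      case True
      then show ?thesis using assms(4) by (simp add: ring_mapD[OF ring_map_Const] mord_0)
    next
      case False
      have "mord (\<alpha> + \<beta>) (z 3 ^ (d - \<alpha> - \<beta>) * Y v1 1 ^ \<alpha> * Y v2 2 ^ \<beta>)"
        using w by (intro mord_mult mord_mult_left mord_power Y) auto
      then have "mord e (z 3 ^ (d - \<alpha> - \<beta>) * Y v1 1 ^ \<alpha> * Y v2 2 ^ \<beta>)" using False by (rule mord_mono[OF _ leI])
      then show ?thesis by (rule mord_mult_left)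
    qed
  qed
  finally show ?thesis by (simp add: vanishes_to_order_def mord_def)
qed

text \<open>In the third chart the expansion has \<open>U\<close> = 1 and lists the coefficients of
  the translated polynomial, so the order can be read off.\<close>

lemma chart_3_vanishing:
  fixes c :: "nat \<times> nat \<Rightarrow> 'k::field"
  assumes "vanishes_to_order e (dehomogenize 3 (form d c)) w" and \<alpha>\<beta>: "\<alpha> + \<beta> < e"
  shows "(\<Sum>pq\<in>exps d d. c pq * tay (w 1) (w 2) \<alpha> \<beta> pq) = 0"
proof -
  define z where "z \<alpha> \<beta> = (\<Sum>pq\<in>exps d d. c pq * tay (w 1) (w 2) \<alpha> \<beta> pq)" for \<alpha> \<beta>
  have "mp_translate w (dehomogenize 3 (form d c)) = (\<Sum>(p, q)\<in>exps d d. Const (c (p, q)) *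
      ((Const (w 1) * 1 + Var 1) ^ p * (Const (w 2) * 1 + Var 2) ^ q * 1 ^ (d - p - q)))"
    unfolding translate_dehomogenize_form by simp
  also have "\<dots> = (\<Sum>\<alpha>\<le>d. \<Sum>\<beta>\<le>d. Const (z \<alpha> \<beta>) * (1 ^ (d - \<alpha> - \<beta>) * Var 1 ^ \<alpha> * Var 2 ^ \<beta>))"
    unfolding z_def by (rule form_expansion[OF ring_map_Const])
  also have "\<dots> = (\<Sum>\<alpha>\<le>d. \<Sum>\<beta>\<le>d. Poly_Mapping.single (Poly_Mapping.single 1 \<alpha> + Poly_Mapping.single 2 \<beta>) (z \<alpha> \<beta>))"
  proof (intro sum.cong refl)
    have V: "Var v ^ n = (Poly_Mapping.single (Poly_Mapping.single v n) 1 :: (3, 'k) mpoly)" for v n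
      by (induction n) (auto simp: Var_def mult_single single_add[symmetric])
    fix \<alpha> \<beta>
    show "Const (z \<alpha> \<beta>) * (1 ^ (d - \<alpha> - \<beta>) * Var 1 ^ \<alpha> * Var 2 ^ \<beta>) =
        Poly_Mapping.single (Poly_Mapping.single (1 :: 3) \<alpha> + Poly_Mapping.single 2 \<beta>) (z \<alpha> \<beta>)"
      by (simp add: V Const_def mult_single)
  qed
  finally have T: "mp_translate w (dehomogenize 3 (form d c)) =
      (\<Sum>\<alpha>\<le>d. \<Sum>\<beta>\<le>d. Poly_Mapping.single (Poly_Mapping.single 1 \<alpha> + Poly_Mapping.single 2 \<beta>) (z \<alpha> \<beta>))" .
  show ?thesis
  proof (cases "\<alpha> \<le> d \<and> \<beta> \<le> d")
    case True
    define m :: "3 \<Rightarrow>\<^sub>0 nat" where "m = Poly_Mapping.single 1 \<alpha> + Poly_Mapping.single 2 \<beta>"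
    have eq: "Poly_Mapping.single 1 \<alpha>' + Poly_Mapping.single 2 \<beta>' = m \<longleftrightarrow> \<alpha>' = \<alpha> \<and> \<beta>' = \<beta>" for \<alpha>' \<beta>'
    proof
      assume a: "Poly_Mapping.single 1 \<alpha>' + Poly_Mapping.single 2 \<beta>' = m"
      show "\<alpha>' = \<alpha> \<and> \<beta>' = \<beta>"
        using arg_cong[OF a, of "\<lambda>m. Poly_Mapping.lookup m 1"] arg_cong[OF a, of "\<lambda>m. Poly_Mapping.lookup m 2"]
        by (auto simp: m_def lookup_add lookup_single when_def)
    qed (simp add: m_def)
    have "Poly_Mapping.lookup (mp_translate w (dehomogenize 3 (form d c))) m = (\<Sum>\<alpha>'\<le>d. \<Sum>\<beta>'\<le>d. if \<alpha>' = \<alpha> \<and> \<beta>' = \<beta> then z \<alpha>' \<beta>' else 0)"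
      unfolding T lookup_sum by (intro sum.cong refl) (simp add: lookup_single eq when_def)
    also have "\<dots> = (\<Sum>\<alpha>'\<le>d. if \<alpha>' = \<alpha> then z \<alpha> \<beta> else 0)"
    proof (rule sum.cong[OF refl])
      fix \<alpha>'
      show "(\<Sum>\<beta>'\<le>d. if \<alpha>' = \<alpha> \<and> \<beta>' = \<beta> then z \<alpha>' \<beta>' else 0) = (if \<alpha>' = \<alpha> then z \<alpha> \<beta> else 0)"
        using True by (cases "\<alpha>' = \<alpha>") (auto simp del: sum.atMost_Suc)
    qed
    also have "\<dots> = z \<alpha> \<beta>" using True by simp
    finally have "z \<alpha> \<beta> \<noteq> 0 \<Longrightarrow> m \<in> Poly_Mapping.keys (mp_translate w (dehomogenize 3 (form d c)))"
      by (simp add: in_keys_iff)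
    moreover have "mdeg m = \<alpha> + \<beta>" by (simp add: m_def mdeg_add)
    ultimately show ?thesis using assms unfolding vanishes_to_order_def z_def[symmetric] by force
  next
    case False
    have "tay (w 1) (w 2) \<alpha> \<beta> pq = 0" if "pq \<in> exps d d" for pq
      using False that by (auto simp: tay_def exps_def binomial_eq_0)
    then show ?thesis by simp
  qed
qed

lemma proj_plane_line:
  fixes w :: "'k::field ^ 3"
  assumes "p \<in> proj_plane" "w \<in> p" "w \<noteq> 0" "x \<in> p"
  shows "\<exists>l. x = l *s w"
proof -
  have "vec.dim p = 1" using assms(1) by (simp add: proj_plane_def vec.projectivization_def)
  moreover have "vec.independent {w}" using assms(3) by (simp add: vec.dependent_single)
  ultimately have "p \<subseteq> vec.span {w}" using assms(2) vec.card_eq_dim[of "{w}" p] by simp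
  then show ?thesis using assms(4) by (auto simp: vec.span_singleton)
qed

lemma span_in_proj_plane:
  fixes w :: "'k::field ^ 3"
  assumes "w \<noteq> 0"
  shows "vec.span {w} \<in> proj_plane"
proof -
  have "vec.independent {w}" using assms by (simp add: vec.dependent_single)
  then have "vec.dim {w} = 1" by (simp add: vec.dim_eq_card_independent)
  then show ?thesis by (simp add: proj_plane_def vec.projectivization_def)
qed

lemma vanishes_to_order_at_iff:
  fixes w :: "'k::field ^ 3"
  assumes p: "p \<in> proj_plane" and w: "w \<in> p" "w $ 3 = 1"
  shows "vanishes_to_order_at e (form d c) p \<longleftrightarrow>
    (\<forall>\<alpha> \<beta>. \<alpha> + \<beta> < e \<longrightarrow> (\<Sum>pq\<in>exps d d. c pq * tay (w $ 1) (w $ 2) \<alpha> \<beta> pq) = 0)"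
proof
  assume "vanishes_to_order_at e (form d c) p"
  then have "vanishes_to_order e (dehomogenize 3 (form d c)) (\<lambda>j. w $ j)"
    using w by (simp add: vanishes_to_order_at_def)
  from chart_3_vanishing[OF this]
  show "\<forall>\<alpha> \<beta>. \<alpha> + \<beta> < e \<longrightarrow> (\<Sum>pq\<in>exps d d. c pq * tay (w $ 1) (w $ 2) \<alpha> \<beta> pq) = 0" by simp
next
  assume z: "\<forall>\<alpha> \<beta>. \<alpha> + \<beta> < e \<longrightarrow> (\<Sum>pq\<in>exps d d. c pq * tay (w $ 1) (w $ 2) \<alpha> \<beta> pq) = 0"
  show "vanishes_to_order_at e (form d c) p"
    unfolding vanishes_to_order_at_def
  proof (intro allI ballI impI)
    fix i :: 3 and x :: "'k ^ 3" assume x: "x \<in> p" "x $ i = 1"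
    have "w \<noteq> 0" using w(2) by auto
    then obtain l where l: "x = l *s w" using proj_plane_line[OF p w(1) _ x(1)] by blast
    show "vanishes_to_order e (dehomogenize i (form d c)) (\<lambda>j. x $ j)"
    proof (rule chart_vanishing[where ?v1.0 = "w $ 1" and ?v2.0 = "w $ 2"])
      show "x $ i = 1" by (rule x(2))
      show "x $ 1 = x $ 3 * w $ 1" "x $ 2 = x $ 3 * w $ 2" using w(2) by (simp_all add: l)
      show "(\<Sum>pq\<in>exps d d. c pq * tay (w $ 1) (w $ 2) \<alpha> \<beta> pq) = 0" if "\<alpha> + \<beta> < e" for \<alpha> \<beta>
        using z that by simp
    qed
  qed
qed

section \<open>Linear forms and dimensions\<close>

definition linear_form :: "(('v, 'k::field) mpoly \<Rightarrow> 'k) \<Rightarrow> bool"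
  where "linear_form l \<longleftrightarrow> (\<forall>F G. l (F + G) = l F + l G) \<and> (\<forall>c F. l (mp_scale c F) = c * l F)"

lemma linear_formD: "linear_form l \<Longrightarrow> l (F + G) = l F + l G" "linear_form l \<Longrightarrow> l (mp_scale c F) = c * l F"
  by (auto simp: linear_form_def)

lemma linear_form_0: "linear_form l \<Longrightarrow> l 0 = 0"
  using linear_formD(2)[of l 0 0] by simp

lemma linear_form_sum: "linear_form l \<Longrightarrow> l (sum f A) = (\<Sum>x\<in>A. l (f x))"
  by (induction A rule: infinite_finite_induct) (auto simp: linear_formD linear_form_0)

lemma linear_form_span:
  assumes l: "linear_form l" and S: "\<And>s. s \<in> S \<Longrightarrow> l s = 0" and F: "F \<in> mp.span S"
  shows "l F = 0"
proof -
  have "mp.subspace {F. l F = 0}"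
    by (rule mp.subspaceI) (auto simp: linear_formD[OF l] linear_form_0[OF l])
  then have "mp.span S \<subseteq> {F. l F = 0}" using S by (intro mp.span_minimal) auto
  then show ?thesis using F by auto
qed

text \<open>\<open>l j\<close> vanishes on \<open>B\<close> and on the other \<open>G i\<close> but
  not on \<open>G j\<close>, so \<open>G j\<close> is outside their span.\<close>

lemma independent_dual:
  assumes l: "\<And>j. j \<in> J \<Longrightarrow> linear_form (l j)" and fin: "finite J"
    and dual: "\<And>i j. i \<in> J \<Longrightarrow> j \<in> J \<Longrightarrow> l i (G j) = of_bool (i = j)"
    and B: "mp.independent B" "\<And>b j. b \<in> B \<Longrightarrow> j \<in> J \<Longrightarrow> l j b = 0"
  shows "mp.independent (B \<union> G ` J)"
proof -
  have "finite J' \<Longrightarrow> J' \<subseteq> J \<Longrightarrow> mp.independent (B \<union> G ` J')" for J'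
  proof (induction J' rule: finite_induct)
    case empty
    then show ?case using B(1) by simp
  next
    case (insert j J')
    have j: "j \<in> J" using insert.prems by simp
    have "G j \<notin> mp.span (B \<union> G ` J')"
    proof
      assume 1: "G j \<in> mp.span (B \<union> G ` J')"
      have "l j s = 0" if "s \<in> B \<union> G ` J'" for s
        using that
      proof
        assume "s \<in> G ` J'"
        then obtain i where "i \<in> J'" "s = G i" by blast
        moreover from this have "i \<in> J" "i \<noteq> j" using insert.prems insert.hyps by auto
        ultimately show ?thesis using dual[OF j, of i] by simp
      qed (rule B(2)[OF _ j])
      then have "l j (G j) = 0" using 1 by (rule linear_form_span[OF l[OF j]])
      then show False using dual[OF j j] by simp
    qed
    moreover have "mp.independent (B \<union> G ` J')" using insert.IH insert.prems by simp
    ultimately have "mp.independent (insert (G j) (B \<union> G ` J'))" by (rule mp.independent_insertI)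
    then show ?case by simp
  qed
  from this[OF fin order_refl] show ?thesis .
qed

text \<open>Subtracting from F the sum of the l_j(F) G_j lands in \<open>K\<close>, so a basis of
  \<open>K\<close> together with the \<open>G j\<close> is a basis of \<open>V\<close>.\<close>

lemma dim_kernel:
  fixes M V :: "('v, 'k::field) mpoly set"
  assumes M: "finite M" "mp.independent M" "M \<subseteq> V" "V \<subseteq> mp.span M" "mp.subspace V"
    and l: "\<And>j. j \<in> J \<Longrightarrow> linear_form (l j)" and fin: "finite J"
    and GV: "\<And>j. j \<in> J \<Longrightarrow> G j \<in> V" and dual: "\<And>i j. i \<in> J \<Longrightarrow> j \<in> J \<Longrightarrow> l i (G j) = of_bool (i = j)"
    and K: "K = {F \<in> V. \<forall>j\<in>J. l j F = 0}"
  shows "mp.dim K + card J = card M"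
proof -
  obtain B where B: "B \<subseteq> K" "mp.independent B" "K \<subseteq> mp.span B" "card B = mp.dim K"
    using mp.basis_exists[of K] by blast
  have finB: "finite B" using mp.independent_span_bound[OF M(1) B(2)] B(1) K M(4) by auto
  have inj: "inj_on G J"
  proof (rule inj_onI)
    fix i j assume "i \<in> J" "j \<in> J" "G i = G j"
    then have "of_bool (i = j) = (of_bool (i = i) :: 'k)" using dual by metis
    then show "i = j" by (cases "i = j") auto
  qed
  have disj: "B \<inter> G ` J = {}"
  proof (rule ccontr)
    assume "B \<inter> G ` J \<noteq> {}"
    then obtain j where j: "j \<in> J" "G j \<in> B" by blast
    then have "l j (G j) = 0" using B(1) K by auto
    then show False using dual[OF j(1) j(1)] by simp
  qed
  have ind: "mp.independent (B \<union> G ` J)"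
  proof (rule independent_dual[OF l fin dual B(2)])
    show "l j b = 0" if "b \<in> B" "j \<in> J" for b j using that B(1) unfolding K by auto
  qed
  have span: "V \<subseteq> mp.span (B \<union> G ` J)"
  proof
    fix F assume F: "F \<in> V"
    define H where "H = (\<Sum>j\<in>J. mp_scale (l j F) (G j))"
    have HV: "H \<in> V" unfolding H_def using GV by (intro mp.subspace_sum mp.subspace_scale M(5)) auto
    have "l i (F - H) = 0" if "i \<in> J" for i
    proof -
      have "l i (mp_scale (l j F) (G j)) = (if i = j then l i F else 0)" if "j \<in> J" for j
        using that \<open>i \<in> J\<close> by (simp add: linear_formD[OF l] dual)
      then have "l i H = (\<Sum>j\<in>J. if i = j then l i F else 0)"
        unfolding H_def linear_form_sum[OF l[OF that]] by (intro sum.cong) auto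
      then have "l i H = l i F" using fin that by simp
      then show ?thesis using linear_formD(1)[OF l[OF that], of "F - H" H] by simp
    qed
    then have "F - H \<in> K" using F HV M(5) by (auto simp: K mp.subspace_diff)
    then have "F - H \<in> mp.span (B \<union> G ` J)" using B(3) mp.span_mono[of B "B \<union> G ` J"] by auto
    moreover have "H \<in> mp.span (B \<union> G ` J)"
      unfolding H_def by (intro mp.span_sum mp.span_scale mp.span_base) auto
    ultimately have "F - H + H \<in> mp.span (B \<union> G ` J)" by (rule mp.span_add)
    then show "F \<in> mp.span (B \<union> G ` J)" by simp
  qed
  have "mp.dim V = card M" using M by (intro mp.dim_unique) auto
  moreover have "mp.dim V = card (B \<union> G ` J)" using B(1) K GV by (intro mp.dim_unique[OF _ span ind]) auto
  ultimately show ?thesis using finB fin disj inj B(4) by (simp add: card_Un_disjoint card_image)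
qed

lemma lookup_mp_scale: "Poly_Mapping.lookup (mp_scale c F) m = c * Poly_Mapping.lookup F m"
proof -
  have "mp_scale c F = Poly_Mapping.single 0 c * (\<Sum>m\<in>Poly_Mapping.keys F. Poly_Mapping.single m (Poly_Mapping.lookup F m))"
    by (simp add: mp_scale_def Const_def flip: sum_singles)
  also have "\<dots> = (\<Sum>m\<in>Poly_Mapping.keys F. Poly_Mapping.single m (c * Poly_Mapping.lookup F m))"
    by (simp add: sum_distrib_left mult_single)
  finally have "Poly_Mapping.lookup (mp_scale c F) m = (\<Sum>m'\<in>Poly_Mapping.keys F. if m = m' then c * Poly_Mapping.lookup F m' else 0)"
    by (simp add: lookup_sum lookup_single when_def eq_commute)
  then show ?thesis by (simp add: in_keys_iff)
qed

lemma card_exps': "card (exps d d) = tri (d + 1)"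
  using card_exps[of 0 d] by simp

definition plane_monos :: "nat \<Rightarrow> (3, 'k::field) mpoly set"
  where "plane_monos d = (\<lambda>pq. Poly_Mapping.single (plane_mono d pq) 1) ` exps d d"

lemma plane_monos:
  "finite (plane_monos d :: (3, 'k::field) mpoly set)" "card (plane_monos d :: (3, 'k) mpoly set) = tri (d + 1)"
  "mp.independent (plane_monos d :: (3, 'k) mpoly set)" "plane_monos d \<subseteq> {F :: (3, 'k) mpoly. homogeneous d F}"
  "{F :: (3, 'k) mpoly. homogeneous d F} \<subseteq> mp.span (plane_monos d)" "mp.subspace {F :: (3, 'k) mpoly. homogeneous d F}"
proof -
  define G :: "nat \<times> nat \<Rightarrow> (3, 'k) mpoly" where "G pq = Poly_Mapping.single (plane_mono d pq) 1" for pq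
  have M: "plane_monos d = G ` exps d d" by (simp add: plane_monos_def G_def)
  have dual: "Poly_Mapping.lookup (G pq') (plane_mono d pq) = of_bool (pq = pq')" for pq pq'
    by (auto simp: G_def lookup_single when_def inj_eq[OF plane_mono_inj])
  show "finite (plane_monos d :: (3, 'k) mpoly set)" by (simp add: M)
  have "inj G"
  proof (rule injI)
    fix a b assume "G a = G b"
    then show "a = b" using dual[of a a] dual[of b a] by (cases "a = b") auto
  qed
  then show "card (plane_monos d :: (3, 'k) mpoly set) = tri (d + 1)"
    unfolding M by (subst card_image) (auto intro: inj_on_subset simp: card_exps')
  have "linear_form (\<lambda>F :: (3, 'k) mpoly. Poly_Mapping.lookup F m)" for m
    by (simp add: linear_form_def lookup_add lookup_mp_scale)
  from independent_dual[of "exps d d" "\<lambda>pq F. Poly_Mapping.lookup F (plane_mono d pq)" G "{}", OF this]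
  show "mp.independent (plane_monos d :: (3, 'k) mpoly set)" by (simp add: M dual mp.independent_empty)
  show "plane_monos d \<subseteq> {F :: (3, 'k) mpoly. homogeneous d F}"
    by (auto simp: M G_def homogeneous_def mdeg_plane_mono)
  show "{F :: (3, 'k) mpoly. homogeneous d F} \<subseteq> mp.span (plane_monos d)"
  proof clarify
    fix F :: "(3, 'k) mpoly" assume "homogeneous d F"
    then have "F = (\<Sum>pq\<in>exps d d. mp_scale (Poly_Mapping.lookup F (plane_mono d pq)) (G pq))"
      using homogeneous_is_form[of d F] by (simp add: form_def G_def mp_scale_def Const_def mult_single)
    also have "\<dots> \<in> mp.span (plane_monos d)"
      unfolding M by (intro mp.span_sum mp.span_scale mp.span_base) auto
    finally show "F \<in> mp.span (plane_monos d)" .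
  qed
  show "mp.subspace {F :: (3, 'k) mpoly. homogeneous d F}"
  proof (rule mp.subspaceI)
    fix F G :: "(3, 'k) mpoly" and c
    assume "F \<in> {F. homogeneous d F}"
    then show "mp_scale c F \<in> {F. homogeneous d F}"
      by (auto simp: homogeneous_def in_keys_iff lookup_mp_scale)
    assume "G \<in> {F. homogeneous d F}"
    with \<open>F \<in> {F. homogeneous d F}\<close> show "F + G \<in> {F. homogeneous d F}"
      by (auto simp: homogeneous_def dest!: subsetD[OF keys_add])
  qed (simp add: homogeneous_def)
qed

section \<open>Regularity in terms of Taylor coefficients\<close>

definition conditions :: "nat \<Rightarrow> nat \<Rightarrow> (nat \<times> nat \<times> nat) set"
  where "conditions n e = {(i, \<alpha>, \<beta>). i < n \<and> \<alpha> + \<beta> < e}"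

definition taylor_condition :: "nat \<Rightarrow> (nat \<Rightarrow> 'k::field ^ 3) \<Rightarrow> (nat \<times> nat \<Rightarrow> 'k) \<Rightarrow> nat \<times> nat \<times> nat \<Rightarrow> 'k"
  where "taylor_condition d w c j = (case j of (i, \<alpha>, \<beta>) \<Rightarrow> \<Sum>pq\<in>exps d d. c pq * tay (w i $ 1) (w i $ 2) \<alpha> \<beta> pq)"

lemma form_space_eq:
  fixes w :: "nat \<Rightarrow> 'k::field ^ 3"
  assumes "\<And>i. i < n \<Longrightarrow> p i \<in> proj_plane \<and> w i \<in> p i \<and> w i $ 3 = 1"
  shows "form_space n d e p =
    {F. homogeneous d F \<and> (\<forall>j\<in>conditions n e. taylor_condition d w (\<lambda>pq. Poly_Mapping.lookup F (plane_mono d pq)) j = 0)}"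
proof -
  have "(\<forall>i<n. vanishes_to_order_at e F (p i)) \<longleftrightarrow> (\<forall>i<n. \<forall>\<alpha> \<beta>. \<alpha> + \<beta> < e \<longrightarrow>
     (\<Sum>pq\<in>exps d d. Poly_Mapping.lookup F (plane_mono d pq) * tay (w i $ 1) (w i $ 2) \<alpha> \<beta> pq) = 0)"
    if "homogeneous d F" for F
  proof -
    have "vanishes_to_order_at e F (p i) \<longleftrightarrow> (\<forall>\<alpha> \<beta>. \<alpha> + \<beta> < e \<longrightarrow>
       (\<Sum>pq\<in>exps d d. Poly_Mapping.lookup F (plane_mono d pq) * tay (w i $ 1) (w i $ 2) \<alpha> \<beta> pq) = 0)" if "i < n" for i
      using vanishes_to_order_at_iff[of "p i" "w i" e d "\<lambda>pq. Poly_Mapping.lookup F (plane_mono d pq)"] assms[OF that]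
        homogeneous_is_form[OF \<open>homogeneous d F\<close>] by simp
    then show ?thesis by simp
  qed
  then show ?thesis unfolding form_space_def conditions_def taylor_condition_def by auto
qed

text \<open>Regularity through emptiness: only the zero form is left, and it spans no line.\<close>

lemma regular_of_injective:
  fixes w :: "nat \<Rightarrow> 'k::field ^ 3"
  assumes w: "\<And>i. i < n \<Longrightarrow> p i \<in> proj_plane \<and> w i \<in> p i \<and> w i $ 3 = 1"
    and inj: "\<And>c. (\<And>j. j \<in> conditions n e \<Longrightarrow> taylor_condition d w c j = 0) \<Longrightarrow> \<forall>pq\<in>exps d d. c pq = 0"
  shows "regular_system n d e p"
proof -
  have fs: "form_space n d e p =
    {F. homogeneous d F \<and> (\<forall>j\<in>conditions n e. taylor_condition d w (\<lambda>pq. Poly_Mapping.lookup F (plane_mono d pq)) j = 0)}"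
    by (rule form_space_eq) (rule w)
  have "F = 0" if "F \<in> form_space n d e p" for F
  proof -
    have F: "homogeneous d F" and "\<forall>pq\<in>exps d d. Poly_Mapping.lookup F (plane_mono d pq) = 0"
      using that inj[of "\<lambda>pq. Poly_Mapping.lookup F (plane_mono d pq)"] unfolding fs by auto
    then have "form d (\<lambda>pq. Poly_Mapping.lookup F (plane_mono d pq)) = 0" by (simp add: form_def)
    then show ?thesis using homogeneous_is_form[OF F] by simp
  qed
  then have sub: "form_space n d e p \<subseteq> {0}" by auto
  have "mp.dim L = 0" if "L \<subseteq> {0}" for L :: "(3, 'k) mpoly set"
    using that by (intro mp.dim_unique[of "{}"]) (auto simp: mp.independent_empty)
  then have "linear_system n d e p = {}"
    using sub unfolding linear_system_def mp.projectivization_def by fastforce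
  then show ?thesis by (simp add: regular_system_def)
qed

text \<open>Regularity through independence: coefficient vectors dual to the conditions make the
  dimension drop by exactly n tri e.\<close>

lemma regular_of_dual:
  fixes w :: "nat \<Rightarrow> 'k::field ^ 3"
  assumes e: "1 \<le> e" and w: "\<And>i. i < n \<Longrightarrow> p i \<in> proj_plane \<and> w i \<in> p i \<and> w i $ 3 = 1"
    and dual: "\<And>j. j \<in> conditions n e \<Longrightarrow> \<exists>c. \<forall>i\<in>conditions n e. taylor_condition d w c i = of_bool (i = j)"
  shows "regular_system n d e p"
proof -
  have fs: "form_space n d e p =
    {F. homogeneous d F \<and> (\<forall>j\<in>conditions n e. taylor_condition d w (\<lambda>pq. Poly_Mapping.lookup F (plane_mono d pq)) j = 0)}"
    by (rule form_space_eq) (rule w)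
  define J where "J = conditions n e"
  define l where "l j F = taylor_condition d w (\<lambda>pq. Poly_Mapping.lookup F (plane_mono d pq)) j"
    for j and F :: "(3, 'k) mpoly"
  have J: "J = {..<n} \<times> exps (e - 1) (e - 1)" using e by (auto simp: J_def conditions_def exps_def)
  have cardJ: "card J = n * tri e" using e by (simp add: J card_cartesian_product card_exps')
  have "\<forall>j. \<exists>c. j \<in> J \<longrightarrow> (\<forall>i\<in>J. taylor_condition d w c i = of_bool (i = j))"
    using dual unfolding J_def by blast
  from choice[OF this] obtain c where c: "\<forall>j. j \<in> J \<longrightarrow> (\<forall>i\<in>J. taylor_condition d w (c j) i = of_bool (i = j))" ..
  have "mp.dim (form_space n d e p) + card J = card (plane_monos d :: (3, 'k) mpoly set)"
  proof (rule dim_kernel[OF plane_monos(1,3,4,5,6), where l = l and G = "\<lambda>j. form d (c j)"])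
    show "linear_form (l j)" for j
      by (cases j) (simp add: linear_form_def l_def taylor_condition_def lookup_add lookup_mp_scale distrib_right sum.distrib sum_distrib_left mult.assoc)
    show "finite J" by (simp add: J)
    show "form d (c j) \<in> {F. homogeneous d F}" for j by (simp add: homogeneous_form)
    show "l i (form d (c j)) = of_bool (i = j)" if "i \<in> J" "j \<in> J" for i j
    proof -
      have "l i (form d (c j)) = taylor_condition d w (c j) i"
        unfolding l_def taylor_condition_def by (simp add: lookup_form_mono case_prod_beta)
      then show ?thesis using c that by simp
    qed
    show "form_space n d e p = {F \<in> {F. homogeneous d F}. \<forall>j\<in>J. l j F = 0}"
      unfolding fs J_def[symmetric] l_def by auto
  qed
  then have "int (mp.dim (form_space n d e p)) + int n * int (tri e) = int (tri (d + 1))"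
    unfolding cardJ plane_monos(2) by (metis of_nat_add of_nat_mult)
  moreover have "int d * (int d + 3) = 2 * (int (tri (d + 1)) - 1)" using int_tri[of "d + 1"] by (simp add: algebra_simps)
  moreover have "int e * (int e + 1) = 2 * int (tri e)" using int_tri[of e] by simp
  ultimately show ?thesis unfolding regular_system_def mp.pdim_def by simp
qed

section \<open>Open conditions on tuples of points\<close>

text \<open>If the field were finite, one plus the product of all x - a would have no root.\<close>

lemma infinite_alg_closed_field: "infinite (UNIV :: 'k::alg_closed_field set)"
proof
  assume fin: "finite (UNIV :: 'k set)"
  define p :: "'k poly" where "p = (\<Prod>a\<in>UNIV. [:- a, 1:])"
  have "degree p = (\<Sum>a\<in>(UNIV :: 'k set). degree [:- a, 1:])"
    unfolding p_def by (rule degree_prod_eq_sum_degree) auto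
  then have "degree p > 0" using fin by (simp add: card_gt_0_iff)
  then have "degree (p + 1) > 0" by (simp add: degree_add_eq_left)
  then obtain x where "poly (p + 1) x = 0" using alg_closed_imp_poly_has_root by blast
  moreover have "poly p x = 0" unfolding p_def poly_prod using fin by (intro prod_zero) auto
  ultimately show False by simp
qed

lemma ring_map_mp_eval: "ring_map (mp_eval a)"
  using ring_map_mp_subst[OF ring_map_id, of a] by (simp add: mp_eval_def[abs_def])

lemma ring_map_prod: "ring_map \<phi> \<Longrightarrow> \<phi> (prod f A) = (\<Prod>x\<in>A. \<phi> (f x))"
  by (induction A rule: infinite_finite_induct) (auto simp: ring_mapD)

section \<open>The matrix of conditions as a multihomogeneous object\<close>

text \<open>The degree is explicit because elimination takes differences, and
  \<open>multihomogeneous\<close>, which hides the degree, is not preserved by them.\<close>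

definition multidegree :: "nat \<Rightarrow> (nat \<Rightarrow> nat) \<Rightarrow> (nat \<times> 3, 'k::zero) mpoly \<Rightarrow> bool"
  where "multidegree n \<delta> P \<longleftrightarrow> (\<forall>m\<in>Poly_Mapping.keys P. (\<forall>(i, j)\<in>Poly_Mapping.keys m. i < n) \<and>
     (\<forall>i<n. (\<Sum>j\<in>UNIV. Poly_Mapping.lookup m (i, j)) = \<delta> i))"

lemma multihomogeneous_iff: "multihomogeneous n P \<longleftrightarrow> (\<exists>\<delta>. multidegree n \<delta> P)"
  by (simp add: multihomogeneous_def multidegree_def)

lemma multidegree_single:
  assumes "c \<noteq> 0 \<Longrightarrow> (\<forall>(i, j)\<in>Poly_Mapping.keys m. i < n) \<and> (\<forall>i<n. (\<Sum>j\<in>UNIV. Poly_Mapping.lookup m (i, j)) = \<delta> i)"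
  shows "multidegree n \<delta> (Poly_Mapping.single m c)"
  using assms by (cases "c = 0") (auto simp: multidegree_def)

lemma multidegree_1: "multidegree n (\<lambda>_. 0) (1 :: (nat \<times> 3, 'k::comm_ring_1) mpoly)"
  unfolding single_one[symmetric] by (rule multidegree_single) simp

lemma multidegree_mult:
  fixes P Q :: "(nat \<times> 3, 'k::comm_ring_1) mpoly"
  assumes "multidegree n \<delta> P" "multidegree n \<delta>' Q"
  shows "multidegree n (\<lambda>i. \<delta> i + \<delta>' i) (P * Q)"
  unfolding multidegree_def
proof
  fix m assume "m \<in> Poly_Mapping.keys (P * Q)"
  then obtain a b where m: "m = a + b" and a: "a \<in> Poly_Mapping.keys P" and b: "b \<in> Poly_Mapping.keys Q"
    using keys_mult[of P Q] by auto
  have "(\<forall>(i, j)\<in>Poly_Mapping.keys m. i < n)"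
    using assms a b keys_add[of a b] unfolding m multidegree_def by blast
  moreover have "(\<Sum>j\<in>UNIV. Poly_Mapping.lookup m (i, j)) = \<delta> i + \<delta>' i" if "i < n" for i
    using assms a b that unfolding m multidegree_def by (simp add: lookup_add sum.distrib)
  ultimately show "(\<forall>(i, j)\<in>Poly_Mapping.keys m. i < n) \<and> (\<forall>i<n. (\<Sum>j\<in>UNIV. Poly_Mapping.lookup m (i, j)) = \<delta> i + \<delta>' i)"
    by blast
qed

lemma multidegree_diff:
  fixes P Q :: "(nat \<times> 3, 'k::comm_ring_1) mpoly"
  assumes "multidegree n \<delta> P" "multidegree n \<delta> Q"
  shows "multidegree n \<delta> (P - Q)"
  unfolding multidegree_def
proof
  fix m assume "m \<in> Poly_Mapping.keys (P - Q)"
  then have "m \<in> Poly_Mapping.keys P \<or> m \<in> Poly_Mapping.keys Q"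
    by (auto simp: in_keys_iff lookup_minus)
  then show "(\<forall>(i, j)\<in>Poly_Mapping.keys m. i < n) \<and> (\<forall>i<n. (\<Sum>j\<in>UNIV. Poly_Mapping.lookup m (i, j)) = \<delta> i)"
    using assms unfolding multidegree_def by blast
qed

lemma multihomogeneous_prod_Var:
  "finite A \<Longrightarrow> A \<subseteq> {..<n} \<Longrightarrow> \<exists>\<delta>. multidegree n \<delta> (\<Prod>i\<in>A. Var (i, 3) :: (nat \<times> 3, 'k::comm_ring_1) mpoly)"
proof (induction A rule: finite_induct)
  case empty
  show ?case using multidegree_1[of n] by auto
next
  case (insert k A)
  have "multidegree n (\<lambda>i. of_bool (i = k)) (Var (k, 3) :: (nat \<times> 3, 'k) mpoly)"
    unfolding Var_def using insert.prems by (intro multidegree_single) (auto simp: lookup_single when_def sum_3)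
  then show ?case using insert multidegree_mult by (simp, blast)
qed

text \<open>The Hasse derivative homogenized by the third coordinate: its degree d - \<alpha> -
  \<beta> depends on the row and not on the monomial \<open>pq\<close>, as graded elimination
  requires.\<close>

definition taylor_entry :: "nat \<Rightarrow> nat \<times> nat \<times> nat \<Rightarrow> nat \<times> nat \<Rightarrow> (nat \<times> 3, 'k::field) mpoly"
  where "taylor_entry d j pq = (case j of (i, \<alpha>, \<beta>) \<Rightarrow> Poly_Mapping.single
     (Poly_Mapping.single (i, 1) (fst pq - \<alpha>) + Poly_Mapping.single (i, 2) (snd pq - \<beta>) + Poly_Mapping.single (i, 3) (d - fst pq - snd pq))
     (of_nat (fst pq choose \<alpha>) * of_nat (snd pq choose \<beta>)))"

lemma multidegree_taylor_entry:
  assumes "i < n" "pq \<in> exps d d"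
  shows "multidegree n (\<lambda>i'. if i' = i then d - \<alpha> - \<beta> else 0) (taylor_entry d (i, \<alpha>, \<beta>) pq :: (nat \<times> 3, 'k::field) mpoly)"
  unfolding taylor_entry_def prod.case
proof (rule multidegree_single)
  let ?m = "Poly_Mapping.single (i, 1) (fst pq - \<alpha>) + Poly_Mapping.single (i, 2) (snd pq - \<beta>) + Poly_Mapping.single (i, 3 :: 3) (d - fst pq - snd pq)"
  assume "of_nat (fst pq choose \<alpha>) * of_nat (snd pq choose \<beta>) \<noteq> (0 :: 'k)"
  then have "\<alpha> \<le> fst pq" "\<beta> \<le> snd pq" by (auto simp: binomial_eq_0 not_le[symmetric] intro: ccontr)
  moreover have "fst pq + snd pq \<le> d" using assms(2) by (auto simp: exps_def)
  ultimately have s: "fst pq - \<alpha> + (snd pq - \<beta>) + (d - fst pq - snd pq) = d - \<alpha> - \<beta>" by linarith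
  have l: "Poly_Mapping.lookup ?m (i', j) = (if i' = i then (if j = 1 then fst pq - \<alpha> else 0) + (if j = 2 then snd pq - \<beta> else 0) +
      (if j = 3 then d - fst pq - snd pq else 0) else 0)" for i' j
    by (auto simp: lookup_add lookup_single when_def)
  have "\<forall>(i', j)\<in>Poly_Mapping.keys ?m. i' < n"
    unfolding in_keys_iff Ball_def using assms(1) by (auto simp only: l split: if_splits prod.splits)
  moreover have "(\<Sum>j\<in>UNIV. Poly_Mapping.lookup ?m (i', j)) = (if i' = i then d - \<alpha> - \<beta> else 0)" for i'
    unfolding l sum_3 using s by simp
  ultimately show "(\<forall>(i', j)\<in>Poly_Mapping.keys ?m. i' < n) \<and>
      (\<forall>i'<n. (\<Sum>j\<in>UNIV. Poly_Mapping.lookup ?m (i', j)) = (if i' = i then d - \<alpha> - \<beta> else 0))" by blast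
qed

lemma eval_taylor_entry:
  fixes v w :: "nat \<Rightarrow> 'k::field ^ 3"
  assumes v: "v i = s *s w i" and w: "w i $ 3 = 1" and pq: "pq \<in> exps d d"
  shows "mp_eval (\<lambda>(i, j). v i $ j) (taylor_entry d (i, \<alpha>, \<beta>) pq) = s ^ (d - \<alpha> - \<beta>) * tay (w i $ 1) (w i $ 2) \<alpha> \<beta> pq"
proof -
  have "mp_eval (\<lambda>(i, j). v i $ j) (taylor_entry d (i, \<alpha>, \<beta>) pq) = of_nat (fst pq choose \<alpha>) * of_nat (snd pq choose \<beta>) *
      ((s * w i $ 1) ^ (fst pq - \<alpha>) * (s * w i $ 2) ^ (snd pq - \<beta>) * s ^ (d - fst pq - snd pq))"
    using v w by (simp add: mp_eval_def taylor_entry_def mp_subst_single mon_eval_add)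
  also have "\<dots> = s ^ (d - \<alpha> - \<beta>) * tay (w i $ 1) (w i $ 2) \<alpha> \<beta> pq"
  proof (cases "\<alpha> \<le> fst pq \<and> \<beta> \<le> snd pq")
    case True
    moreover have "fst pq + snd pq \<le> d" using pq by (auto simp: exps_def)
    ultimately have "fst pq - \<alpha> + (snd pq - \<beta>) + (d - fst pq - snd pq) = d - \<alpha> - \<beta>" by linarith
    then have "s ^ (d - \<alpha> - \<beta>) = s ^ (fst pq - \<alpha>) * s ^ (snd pq - \<beta>) * s ^ (d - fst pq - snd pq)" by (metis power_add)
    then show ?thesis by (simp add: tay_def power_mult_distrib mult_ac)
  qed (auto simp: tay_def binomial_eq_0 not_le)
  finally show ?thesis .
qed

text \<open>\<open>g\<close> consists of additional functionals that do not move with the points; in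
  the higher degree they fill the system up to a square one.\<close>

definition independent_conditions :: "nat \<Rightarrow> nat \<Rightarrow> nat \<Rightarrow> 'j set \<Rightarrow> ('j \<Rightarrow> nat \<times> nat \<Rightarrow> 'k::field) \<Rightarrow> (nat \<Rightarrow> 'k ^ 3) \<Rightarrow> bool"
  where "independent_conditions d n e J g w \<longleftrightarrow> (\<forall>c. (\<forall>j\<in>conditions n e. taylor_condition d w c j = 0) \<longrightarrow>
     (\<forall>j\<in>J. (\<Sum>pq\<in>exps d d. g j pq * c pq) = 0) \<longrightarrow> (\<forall>pq\<in>exps d d. c pq = 0))"

text \<open>Graded elimination is applied to the matrix of conditions. At representatives v_i = s_i
  w_i its rows are those at w multiplied by powers of s_i, so a nonzero value of
  \<open>\<Delta>\<close> at any representatives suffices.\<close>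

lemma generic_conditions:
  fixes w0 :: "nat \<Rightarrow> 'k::field ^ 3"
  assumes inj: "independent_conditions d n e J g w0" and w0: "\<And>i. w0 i $ 3 = 1"
  shows "\<exists>\<Delta> \<delta>. multidegree n \<delta> \<Delta> \<and> mp_eval (\<lambda>(i, j). w0 i $ j) \<Delta> \<noteq> 0 \<and>
     (\<forall>v w s. (\<forall>i<n. v i = s i *s w i \<and> w i $ 3 = 1) \<longrightarrow> mp_eval (\<lambda>(i, j). v i $ j) \<Delta> \<noteq> 0 \<longrightarrow> independent_conditions d n e J g w)"
proof -
  define m where "m j pq = (case j of Inl j \<Rightarrow> taylor_entry d j pq | Inr j \<Rightarrow> Const (g j pq))"
    for j :: "(nat \<times> nat \<times> nat) + 'a" and pq
  define JJ where "JJ = Inl ` conditions n e \<union> Inr ` J"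
  define \<rho> where "\<rho> j = (case j of Inl (i, \<alpha>, \<beta>) \<Rightarrow> (\<lambda>i'. if i' = i then d - \<alpha> - \<beta> else 0) | Inr j \<Rightarrow> (\<lambda>_. 0))"
    for j :: "(nat \<times> nat \<times> nat) + 'a"
  define ev where "ev v = mp_eval (\<lambda>(i, j). v i $ j)" for v :: "nat \<Rightarrow> 'k ^ 3"
  have ev: "ring_map (ev v)" for v unfolding ev_def by (rule ring_map_mp_eval)
  have row: "(\<Sum>pq\<in>exps d d. ev v (m (Inl (i, \<alpha>, \<beta>)) pq) * c pq) = s ^ (d - \<alpha> - \<beta>) * taylor_condition d w c (i, \<alpha>, \<beta>)"
    if "v i = s *s w i" "w i $ 3 = 1" for v w :: "nat \<Rightarrow> 'k ^ 3" and i \<alpha> \<beta> c s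
    unfolding taylor_condition_def prod.case sum_distrib_left
    by (intro sum.cong refl) (simp add: m_def ev_def eval_taylor_entry[of v i s w, OF that] mult_ac)
  have const: "ev v (m (Inr j) pq) = g j pq" for v j pq
    by (simp add: m_def ev_def mp_eval_def mp_subst_Const[OF ring_map_id])
  have "\<exists>\<Delta> \<delta>. multidegree n \<delta> \<Delta> \<and> ev w0 \<Delta> \<noteq> 0 \<and> (\<forall>\<phi> :: (nat \<times> 3, 'k) mpoly \<Rightarrow> 'k. (\<forall>x y. \<phi> (x * y) = \<phi> x * \<phi> y) \<longrightarrow>
      (\<forall>x y. \<phi> (x - y) = \<phi> x - \<phi> y) \<longrightarrow> \<phi> \<Delta> \<noteq> 0 \<longrightarrow>
      (\<forall>c. (\<forall>j\<in>JJ. (\<Sum>pq\<in>exps d d. \<phi> (m j pq) * c pq) = 0) \<longrightarrow> (\<forall>pq\<in>exps d d. c pq = 0)))"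
  proof (rule fraction_free_elimination[where z = "\<lambda>_. 0" and pl = "\<lambda>\<delta> \<delta>' i. \<delta> i + \<delta>' i" and \<rho> = \<rho>])
    show "multidegree n (\<rho> j) (m j pq)" if "j \<in> JJ" "pq \<in> exps d d" for j pq
    proof (cases j)
      case (Inl j')
      then show ?thesis using that multidegree_taylor_entry[where pq = pq]
        by (auto simp: JJ_def conditions_def m_def \<rho>_def)
    next
      case (Inr j')
      then show ?thesis unfolding m_def \<rho>_def Const_def by (auto intro!: multidegree_single)
    qed
    show "\<forall>pq\<in>exps d d. c pq = 0" if c: "\<And>j. j \<in> JJ \<Longrightarrow> (\<Sum>pq\<in>exps d d. ev w0 (m j pq) * c pq) = 0" for c
    proof (rule inj[unfolded independent_conditions_def, THEN spec, THEN mp, THEN mp])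
      show "\<forall>j\<in>conditions n e. taylor_condition d w0 c j = 0"
      proof clarify
        fix i \<alpha> \<beta> assume j: "(i, \<alpha>, \<beta>) \<in> conditions n e"
        have "1 ^ (d - \<alpha> - \<beta>) * taylor_condition d w0 c (i, \<alpha>, \<beta>) = 0"
          using c[of "Inl (i, \<alpha>, \<beta>)"] j row[of w0 i 1 w0 \<alpha> \<beta> c] w0 by (simp add: JJ_def)
        then show "taylor_condition d w0 c (i, \<alpha>, \<beta>) = 0" by simp
      qed
      show "\<forall>j\<in>J. (\<Sum>pq\<in>exps d d. g j pq * c pq) = 0"
      proof
        fix j assume "j \<in> J"
        then show "(\<Sum>pq\<in>exps d d. g j pq * c pq) = 0" using c[of "Inr j"] by (simp add: JJ_def const)
      qed
    qed
  qed (auto simp: multidegree_1 multidegree_mult multidegree_diff ring_mapD[OF ev] ring_map_diff[OF ev] add.commute)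
  then obtain \<Delta> \<delta> where \<Delta>: "multidegree n \<delta> \<Delta>" "ev w0 \<Delta> \<noteq> 0" and all: "\<And>\<phi> :: (nat \<times> 3, 'k) mpoly \<Rightarrow> 'k. \<And>c. (\<forall>x y. \<phi> (x * y) = \<phi> x * \<phi> y) \<Longrightarrow>
      (\<forall>x y. \<phi> (x - y) = \<phi> x - \<phi> y) \<Longrightarrow> \<phi> \<Delta> \<noteq> 0 \<Longrightarrow>
      (\<forall>j\<in>JJ. (\<Sum>pq\<in>exps d d. \<phi> (m j pq) * c pq) = 0) \<Longrightarrow> (\<forall>pq\<in>exps d d. c pq = 0)" by blast
  have "independent_conditions d n e J g w" if vw: "\<forall>i<n. v i = s i *s w i \<and> w i $ 3 = 1" and v: "ev v \<Delta> \<noteq> 0"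
    for v w :: "nat \<Rightarrow> 'k ^ 3" and s
    unfolding independent_conditions_def
  proof (intro allI impI)
    fix c assume c1: "\<forall>j\<in>conditions n e. taylor_condition d w c j = 0" and c2: "\<forall>j\<in>J. (\<Sum>pq\<in>exps d d. g j pq * c pq) = 0"
    show "\<forall>pq\<in>exps d d. c pq = 0"
    proof (rule all[of "ev v", OF _ _ v])
      show "\<forall>x y. ev v (x * y) = ev v x * ev v y" by (simp add: ring_mapD[OF ev])
      show "\<forall>x y. ev v (x - y) = ev v x - ev v y" by (simp add: ring_map_diff[OF ev])
      show "\<forall>j\<in>JJ. (\<Sum>pq\<in>exps d d. ev v (m j pq) * c pq) = 0"
      proof
        fix j assume j: "j \<in> JJ"
        show "(\<Sum>pq\<in>exps d d. ev v (m j pq) * c pq) = 0"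
        proof (cases j)
          case (Inl j')
          obtain i \<alpha> \<beta> where ij: "j' = (i, \<alpha>, \<beta>)" by (cases j')
          then have cj: "(i, \<alpha>, \<beta>) \<in> conditions n e" using j Inl by (auto simp: JJ_def)
          then have "v i = s i *s w i" "w i $ 3 = 1" using vw by (auto simp: conditions_def)
          then show ?thesis using c1 cj unfolding Inl ij by (simp add: row)
        qed (use j c2 in \<open>auto simp: JJ_def const\<close>)
      qed
    qed
  qed
  then show ?thesis using \<Delta> unfolding ev_def by blast
qed

section \<open>Passage from one degree to lower and higher degrees\<close>

lemma exps_mono: "d \<le> d' \<Longrightarrow> exps d d \<subseteq> exps d' d'"
  by (auto simp: exps_def)

lemma taylor_condition_extend:
  assumes "d \<le> d'" and "\<And>pq. pq \<notin> exps d d \<Longrightarrow> c pq = 0"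
  shows "taylor_condition d' w c j = taylor_condition d w c j"
proof -
  have "(\<Sum>pq\<in>exps d' d'. c pq * f pq) = (\<Sum>pq\<in>exps d d. c pq * f pq)" for f
    using assms exps_mono by (intro sum.mono_neutral_right) auto
  then show ?thesis by (cases j) (simp add: taylor_condition_def)
qed

lemma taylor_condition_cong:
  "(\<And>pq. pq \<in> exps d d \<Longrightarrow> c pq = c' pq) \<Longrightarrow> taylor_condition d w c j = taylor_condition d w c' j"
  by (cases j) (simp add: taylor_condition_def)

text \<open>Multiplication by a power of the third coordinate keeps the affine equation of a curve
  and raises its degree; on coefficients it is extension by zero.\<close>

lemma regular_below:
  fixes w :: "nat \<Rightarrow> 'k::field ^ 3"
  assumes w: "\<And>i. i < n \<Longrightarrow> p i \<in> proj_plane \<and> w i \<in> p i \<and> w i $ 3 = 1"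
    and ind: "independent_conditions d0 n e {} g w" and d: "d \<le> d0"
  shows "regular_system n d e p"
proof (rule regular_of_injective[OF w])
  fix c assume c: "\<And>j. j \<in> conditions n e \<Longrightarrow> taylor_condition d w c j = 0"
  define c' where "c' pq = (if pq \<in> exps d d then c pq else 0)" for pq
  have "taylor_condition d0 w c' j = taylor_condition d w c j" for j
  proof -
    have "taylor_condition d0 w c' j = taylor_condition d w c' j" by (rule taylor_condition_extend[OF d]) (simp add: c'_def)
    also have "\<dots> = taylor_condition d w c j" by (rule taylor_condition_cong) (simp add: c'_def)
    finally show ?thesis .
  qed
  then have "\<forall>pq\<in>exps d0 d0. c' pq = 0" using ind c unfolding independent_conditions_def by simp
  then show "\<forall>pq\<in>exps d d. c pq = 0" using exps_mono[OF d] by (auto simp: c'_def split: if_splits)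
qed

lemma card_conditions:
  assumes "1 \<le> e"
  shows "finite (conditions n e)" "card (conditions n e) = n * tri e"
proof -
  have "conditions n e = {..<n} \<times> exps (e - 1) (e - 1)" using assms by (auto simp: conditions_def exps_def)
  then show "finite (conditions n e)" "card (conditions n e) = n * tri e"
    using assms by (simp_all add: card_cartesian_product card_exps')
qed

text \<open>In degree \<open>d1\<close> there are no more functionals than coefficients, so
  injectivity makes the system solvable for every right side, in particular for dual vectors.
  Extension by zero carries these to degree \<open>d\<close>.\<close>

lemma regular_above:
  fixes w :: "nat \<Rightarrow> 'k::field ^ 3"
  assumes e: "1 \<le> e" and w: "\<And>i. i < n \<Longrightarrow> p i \<in> proj_plane \<and> w i \<in> p i \<and> w i $ 3 = 1"
    and ind: "independent_conditions d1 n e J g w" and J: "finite J" "n * tri e + card J \<le> tri (d1 + 1)" and d: "d1 \<le> d"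
  shows "regular_system n d e p"
proof (rule regular_of_dual[OF e w])
  fix j0 assume j0: "j0 \<in> conditions n e"
  define m where "m j pq = (case j of Inl (i, \<alpha>, \<beta>) \<Rightarrow> tay (w i $ 1) (w i $ 2) \<alpha> \<beta> pq | Inr j \<Rightarrow> g j pq)"
    for j :: "(nat \<times> nat \<times> nat) + 'a" and pq
  have row: "(\<Sum>pq\<in>exps d1 d1. m (Inl j) pq * c pq) = taylor_condition d1 w c j" for j c
    by (cases j) (simp add: m_def taylor_condition_def mult.commute)
  have "\<exists>c. \<forall>j\<in>Inl ` conditions n e \<union> Inr ` J. (\<Sum>pq\<in>exps d1 d1. m j pq * c pq) = of_bool (j = Inl j0)"
  proof (rule square_system_solvable)
    have "card (Inl ` conditions n e \<union> Inr ` J :: ((nat \<times> nat \<times> nat) + 'a) set) = card (conditions n e) + card J"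
      using J card_conditions[OF e] by (subst card_Un_disjoint) (auto simp: card_image)
    then show "card (Inl ` conditions n e \<union> Inr ` J :: ((nat \<times> nat \<times> nat) + 'a) set) \<le> card (exps d1 d1)"
      using J(2) by (simp add: card_conditions[OF e] card_exps')
    fix c assume c: "\<And>j. j \<in> Inl ` conditions n e \<union> Inr ` J \<Longrightarrow> (\<Sum>pq\<in>exps d1 d1. m j pq * c pq) = 0"
    have "taylor_condition d1 w c j = 0" if "j \<in> conditions n e" for j using c[of "Inl j"] that by (simp add: row)
    moreover have "(\<Sum>pq\<in>exps d1 d1. g j pq * c pq) = 0" if "j \<in> J" for j using c[of "Inr j"] that by (simp add: m_def)
    ultimately show "\<forall>pq\<in>exps d1 d1. c pq = 0" using ind unfolding independent_conditions_def by blast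
  qed (use J card_conditions[OF e] in auto)
  then obtain c where c0: "\<forall>j\<in>Inl ` conditions n e \<union> Inr ` J. (\<Sum>pq\<in>exps d1 d1. m j pq * c pq) = of_bool (j = Inl j0)" ..
  have c: "taylor_condition d1 w c j = of_bool (j = j0)" if "j \<in> conditions n e" for j
    using c0[rule_format, of "Inl j"] that row[of j c] by simp
  define c' where "c' pq = (if pq \<in> exps d1 d1 then c pq else 0)" for pq
  have "taylor_condition d w c' j = of_bool (j = j0)" if "j \<in> conditions n e" for j
  proof -
    have "taylor_condition d w c' j = taylor_condition d1 w c' j" by (rule taylor_condition_extend[OF d]) (simp add: c'_def)
    also have "\<dots> = taylor_condition d1 w c j" by (rule taylor_condition_cong) (simp add: c'_def)
    finally show ?thesis using c[OF that] by simp
  qed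
  then show "\<exists>c. \<forall>i\<in>conditions n e. taylor_condition d w c i = of_bool (i = j0)" by blast
qed

lemma poly_mp_subst:
  "poly (mp_subst (\<lambda>c. [:c:]) f F) t = mp_eval (\<lambda>v. poly (f v) t) (F :: ('v, 'k::field) mpoly)"
  by (simp add: mp_eval_def mp_subst_def poly_sum poly_prod)

text \<open>Two nonempty open sets meet, since the line through a point of each meets both in cofinite sets.\<close>

lemma common_nonvanishing:
  fixes w1 w2 :: "nat \<Rightarrow> 'k::field ^ 3"
  assumes inf: "infinite (UNIV :: 'k set)" and w: "\<And>i. w1 i $ 3 = 1" "\<And>i. w2 i $ 3 = 1"
    and D1: "mp_eval (\<lambda>(i, j). w1 i $ j) \<Delta>1 \<noteq> 0" and D2: "mp_eval (\<lambda>(i, j). w2 i $ j) \<Delta>2 \<noteq> 0"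
  shows "\<exists>v :: nat \<Rightarrow> 'k ^ 3. (\<forall>i. v i $ 3 = 1) \<and> mp_eval (\<lambda>(i, j). v i $ j) \<Delta>1 \<noteq> 0 \<and> mp_eval (\<lambda>(i, j). v i $ j) \<Delta>2 \<noteq> 0"
proof -
  define f where "f ij = (case ij of (i, j) \<Rightarrow> [:w1 i $ j, w2 i $ j - w1 i $ j:])" for ij
  define Q where "Q F = mp_subst (\<lambda>c. [:c:]) f F" for F
  define v :: "'k \<Rightarrow> nat \<Rightarrow> 'k ^ 3" where "v t i = (\<chi> j. w1 i $ j + t * (w2 i $ j - w1 i $ j))" for t i
  have Q: "poly (Q F) t = mp_eval (\<lambda>(i, j). v t i $ j) F" for F t
  proof -
    have "(\<lambda>ij. poly (f ij) t) = (\<lambda>(i, j). v t i $ j)" by (auto simp: f_def v_def)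
    then show ?thesis by (simp add: Q_def poly_mp_subst)
  qed
  have "v 0 = w1" "v 1 = w2" by (auto simp: v_def fun_eq_iff vec_eq_iff)
  then have "poly (Q \<Delta>1) 0 \<noteq> 0" "poly (Q \<Delta>2) 1 \<noteq> 0" using D1 D2 by (simp_all add: Q)
  then have "Q \<Delta>1 * Q \<Delta>2 \<noteq> 0" by auto
  from ex_new_if_finite[OF inf poly_roots_finite[OF this]]
  obtain t where "poly (Q \<Delta>1 * Q \<Delta>2) t \<noteq> 0" by auto
  then have "mp_eval (\<lambda>(i, j). v t i $ j) \<Delta>1 \<noteq> 0" "mp_eval (\<lambda>(i, j). v t i $ j) \<Delta>2 \<noteq> 0"
    using Q[of \<Delta>1 t] Q[of \<Delta>2 t] by auto
  moreover have "\<forall>i. v t i $ 3 = 1" using w by (simp add: v_def)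
  ultimately show ?thesis by blast
qed

lemma vector_of_points: "\<exists>w :: nat \<Rightarrow> 'k::field ^ 3. \<forall>i. w i $ 1 = x i \<and> w i $ 2 = y i \<and> w i $ 3 = 1"
  by (rule exI[of _ "\<lambda>i. vector [x i, y i, 1]"]) simp

lemma taylor_condition_points:
  fixes w :: "nat \<Rightarrow> 'k::field ^ 3"
  assumes w: "\<forall>i. w i $ 1 = x i \<and> w i $ 2 = y i \<and> w i $ 3 = 1"
  shows "taylor_condition d w c (i, \<alpha>, \<beta>) = (\<Sum>pq\<in>exps d d. c pq * tay (x i) (y i) \<alpha> \<beta> pq)"
  using w by (simp add: taylor_condition_def)

lemma tri_ge: "n \<le> tri n"
  by (induction n) (auto simp: tri_Suc)

theorem theorem1p1:
  fixes e n :: nat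
  assumes "e > 0" and "n > 0" and "n \<ge> 4 * e ^ 2"
  shows "\<exists>U :: (nat \<Rightarrow> ('k::alg_closed_field ^ 3) set) set.
           zariski_open n U \<and> U \<noteq> {} \<and>
           (\<forall>p\<in>U. \<forall>d. regular_system n d e p)"
proof -
  have e: "1 \<le> e" using assms by simp
  note inf = infinite_alg_closed_field[where 'k = 'k]
  define S where "S = tri e"
  have S1: "1 \<le> S" using tri_ge[of e] e by (simp add: S_def)
  \<comment> \<open>The last degree with at least as many conditions as coefficients: injectivity is
    needed up to \<open>d0\<close> and independence from d0 + 1 on.\<close>
  define d0 where "d0 = (GREATEST d. tri (d + 1) \<le> n * S)"
  \<comment> \<open>The smallest degree that \<open>affine_points\<close> admits. Here (dm + 1)(dm +
    2) = (4 e^2 - 1) e (e + 1), so n \<ge> 4 e^2 gives \<open>dm\<close> \<le>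
    \<open>d0\<close>.\<close>
  define dm where "dm = (2 * e - 1) * (e + 1) - 1"
  have dm: "dm + 1 = (2 * e - 1) * (e + 1)" using e by (simp add: dm_def)
  have low: "tri (dm + 1) \<le> n * S"
  proof -
    obtain f where f: "e = Suc f" using e by (cases e) auto
    have "2 * tri (dm + 1) = (dm + 1) * Suc (dm + 1)" by (rule tri_double)
    also have "\<dots> \<le> 4 * e\<^sup>2 * (e * Suc e)" unfolding dm f by (simp add: power2_eq_square algebra_simps)
    also have "\<dots> \<le> n * (e * Suc e)" using assms(3) by (intro mult_le_mono1) simp
    also have "\<dots> = 2 * (n * S)" unfolding S_def tri_double[symmetric] by simp
    finally show ?thesis by simp
  qed
  have bound: "\<forall>d. tri (d + 1) \<le> n * S \<longrightarrow> d \<le> n * S"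
  proof (intro allI impI)
    fix d assume "tri (d + 1) \<le> n * S"
    then show "d \<le> n * S" using tri_ge[of "d + 1"] by linarith
  qed
  have d0: "tri (d0 + 1) \<le> n * S"
    unfolding d0_def by (rule GreatestI_nat[of "\<lambda>d. tri (d + 1) \<le> n * S", OF low bound[rule_format]])
  have "dm \<le> d0"
    unfolding d0_def by (rule Greatest_le_nat[of "\<lambda>d. tri (d + 1) \<le> n * S", OF low bound[rule_format]])
  then have d0m: "(2 * e - 1) * (e + 1) \<le> d0 + 1" "(2 * e - 1) * (e + 1) \<le> d0 + 1 + 1" unfolding dm[symmetric] by simp_all
  have d1: "n * S < tri (d0 + 1 + 1)"
  proof (rule ccontr)
    assume "\<not> ?thesis"
    then have "d0 + 1 \<le> d0"
      unfolding d0_def by (intro Greatest_le_nat[of "\<lambda>d. tri (d + 1) \<le> n * S", OF _ bound[rule_format]]) simp_all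
    then show False by simp
  qed
  define T where "T = tri (d0 + 1)"
  \<comment> \<open>The least number of points whose conditions are as many as the coefficients in
    degree \<open>d0\<close>, with surplus \<open>E\<close>. The remaining n - n1 points only add
    conditions.\<close>
  define n1 where "n1 = (T + S - 1) div S"
  define E where "E = n1 * S - T"
  have nS: "n1 * S + (T + S - 1) mod S = T + S - 1" "(T + S - 1) mod S < S"
    unfolding n1_def using S1 by (auto simp: div_mult_mod_eq)
  then have E: "tri (d0 + 1) + E = n1 * tri e + 0" "E < tri e" unfolding E_def T_def[symmetric] S_def[symmetric] by linarith+
  have n1: "n1 \<le> n"
  proof -
    have "n1 * S < (n + 1) * S" using nS d0 S1 unfolding T_def[symmetric] by (simp add: algebra_simps)
    then have "n1 < n + 1" unfolding mult_less_cancel2 by blast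
    then show ?thesis by simp
  qed
  obtain x1 y1 :: "nat \<Rightarrow> 'k" and g1 :: "nat \<Rightarrow> nat \<times> nat \<Rightarrow> 'k" where p1: "\<And>c.
      (\<forall>i<n1. \<forall>\<alpha> \<beta>. \<alpha> + \<beta> < e \<longrightarrow> (\<Sum>pq\<in>exps d0 d0. c pq * tay (x1 i) (y1 i) \<alpha> \<beta> pq) = 0) \<Longrightarrow>
      (\<forall>i<0. (\<Sum>pq\<in>exps d0 d0. c pq * g1 i pq) = 0) \<Longrightarrow> (\<forall>pq\<in>exps d0 d0. c pq = 0)"
    using affine_points[OF inf e d0m(1) E(1,2)] S1 unfolding S_def by (auto simp del: less_nat_zero_code)
  obtain w1 :: "nat \<Rightarrow> 'k ^ 3" where w1: "\<forall>i. w1 i $ 1 = x1 i \<and> w1 i $ 2 = y1 i \<and> w1 i $ 3 = 1"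
    using vector_of_points by blast
  have ind1: "independent_conditions d0 n e {} (\<lambda>_ :: nat. \<lambda>_. 0) w1"
    unfolding independent_conditions_def
  proof (intro allI impI)
    fix c assume c: "\<forall>j\<in>conditions n e. taylor_condition d0 w1 c j = 0"
    show "\<forall>pq\<in>exps d0 d0. c pq = 0"
    proof (rule p1)
      show "\<forall>i<n1. \<forall>\<alpha> \<beta>. \<alpha> + \<beta> < e \<longrightarrow> (\<Sum>pq\<in>exps d0 d0. c pq * tay (x1 i) (y1 i) \<alpha> \<beta> pq) = 0"
        using c n1 by (auto simp: conditions_def taylor_condition_points[OF w1])
    qed simp
  qed
  define T1 where "T1 = tri (d0 + 1 + 1)"
  \<comment> \<open>In degree d0 + 1 the configuration has n2 \<ge> n points and \<open>D\<close>
    simple conditions; all that exceeds the first n points becomes the set \<open>J\<close> of fixed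
    functionals.\<close>
  define n2 where "n2 = T1 div S"
  define D where "D = T1 mod S"
  have D: "tri (d0 + 1 + 1) + 0 = n2 * tri e + D" "0 < tri e" "D < tri e"
    using S1 unfolding n2_def D_def T1_def[symmetric] S_def[symmetric] by (auto simp: div_mult_mod_eq)
  have n2: "n \<le> n2"
    using d1 S1 unfolding n2_def T1_def[symmetric] by (simp add: less_eq_div_iff_mult_less_eq)
  obtain x2 y2 :: "nat \<Rightarrow> 'k" and g2 :: "nat \<Rightarrow> nat \<times> nat \<Rightarrow> 'k" where p2: "\<And>c.
      (\<forall>i<n2. \<forall>\<alpha> \<beta>. \<alpha> + \<beta> < e \<longrightarrow> (\<Sum>pq\<in>exps (d0 + 1) (d0 + 1). c pq * tay (x2 i) (y2 i) \<alpha> \<beta> pq) = 0) \<Longrightarrow>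
      (\<forall>i<D. (\<Sum>pq\<in>exps (d0 + 1) (d0 + 1). c pq * g2 i pq) = 0) \<Longrightarrow> (\<forall>pq\<in>exps (d0 + 1) (d0 + 1). c pq = 0)"
    using affine_points[OF inf e d0m(2) D] by blast
  obtain w2 :: "nat \<Rightarrow> 'k ^ 3" where w2: "\<forall>i. w2 i $ 1 = x2 i \<and> w2 i $ 2 = y2 i \<and> w2 i $ 3 = 1"
    using vector_of_points by blast
  define J where "J = Inl ` (conditions n2 e - conditions n e) \<union> Inr ` {..<D}"
  define g where "g j = (case j of Inl (i, \<alpha>, \<beta>) \<Rightarrow> tay (x2 i) (y2 i) \<alpha> \<beta> | Inr i \<Rightarrow> g2 i)" for j :: "nat \<times> nat \<times> nat + nat"
  have finJ: "finite J" using card_conditions[OF e] by (simp add: J_def)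
  have cardJ: "n * tri e + card J \<le> tri (d0 + 1 + 1)"
  proof -
    have sub: "conditions n e \<subseteq> conditions n2 e" using n2 by (auto simp: conditions_def)
    have "card J = card (conditions n2 e - conditions n e) + D"
      unfolding J_def using card_conditions[OF e] by (subst card_Un_disjoint) (auto simp: card_image)
    also have "card (conditions n2 e - conditions n e) = n2 * tri e - n * tri e"
      using sub card_conditions[OF e] by (subst card_Diff_subset) auto
    finally show ?thesis using D(1) mult_le_mono1[OF n2, of "tri e"] by linarith
  qed
  have ind2: "independent_conditions (d0 + 1) n e J g w2"
    unfolding independent_conditions_def
  proof (intro allI impI)
    fix c assume c: "\<forall>j\<in>conditions n e. taylor_condition (d0 + 1) w2 c j = 0"
      and cJ: "\<forall>j\<in>J. (\<Sum>pq\<in>exps (d0 + 1) (d0 + 1). g j pq * c pq) = 0"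
    show "\<forall>pq\<in>exps (d0 + 1) (d0 + 1). c pq = 0"
    proof (rule p2; intro allI impI)
      fix i \<alpha> \<beta> assume i: "i < n2" "\<alpha> + \<beta> < e"
      show "(\<Sum>pq\<in>exps (d0 + 1) (d0 + 1). c pq * tay (x2 i) (y2 i) \<alpha> \<beta> pq) = 0"
      proof (cases "i < n")
        case True
        then have "taylor_condition (d0 + 1) w2 c (i, \<alpha>, \<beta>) = 0" using c i by (simp add: conditions_def)
        then show ?thesis by (simp add: taylor_condition_points[OF w2])
      next
        case False
        then have "Inl (i, \<alpha>, \<beta>) \<in> J" using i by (simp add: J_def conditions_def)
        from cJ[rule_format, OF this] show ?thesis by (simp add: g_def mult.commute)
      qed
    next
      fix i assume "i < D"
      then have "Inr i \<in> J" by (simp add: J_def)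
      from cJ[rule_format, OF this] show "(\<Sum>pq\<in>exps (d0 + 1) (d0 + 1). c pq * g2 i pq) = 0" by (simp add: g_def mult.commute)
    qed
  qed
  have w13: "w1 i $ 3 = 1" and w23: "w2 i $ 3 = 1" for i using w1 w2 by auto
  obtain \<Delta>1 \<delta>1 where \<Delta>1: "multidegree n \<delta>1 \<Delta>1" "mp_eval (\<lambda>(i, j). w1 i $ j) \<Delta>1 \<noteq> 0" and
    good1: "\<forall>v w s. (\<forall>i<n. v i = s i *s w i \<and> w i $ 3 = 1) \<longrightarrow> mp_eval (\<lambda>(i, j). v i $ j) \<Delta>1 \<noteq> 0 \<longrightarrow>
       independent_conditions d0 n e {} (\<lambda>_ :: nat. \<lambda>_. 0) w"
    using generic_conditions[OF ind1 w13] by (elim exE conjE) (rule that)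
  obtain \<Delta>2 \<delta>2 where \<Delta>2: "multidegree n \<delta>2 \<Delta>2" "mp_eval (\<lambda>(i, j). w2 i $ j) \<Delta>2 \<noteq> 0" and
    good2: "\<forall>v w s. (\<forall>i<n. v i = s i *s w i \<and> w i $ 3 = 1) \<longrightarrow> mp_eval (\<lambda>(i, j). v i $ j) \<Delta>2 \<noteq> 0 \<longrightarrow>
       independent_conditions (d0 + 1) n e J g w"
    using generic_conditions[OF ind2 w23] by (elim exE conjE) (rule that)
  \<comment> \<open>This factor keeps all points in the chart where the third coordinate is nonzero,
    in which the conditions are written.\<close>
  define \<Theta> :: "(nat \<times> 3, 'k) mpoly" where "\<Theta> = (\<Prod>i<n. Var (i, 3))"
  define \<Delta> where "\<Delta> = \<Delta>1 * \<Delta>2 * \<Theta>"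
  obtain \<delta>3 where "multidegree n \<delta>3 \<Theta>" using multihomogeneous_prod_Var[of "{..<n}" n] unfolding \<Theta>_def by auto
  then have hom: "multihomogeneous n \<Delta>"
    unfolding \<Delta>_def multihomogeneous_iff using multidegree_mult \<Delta>1(1) \<Delta>2(1) by blast
  have ev: "mp_eval (\<lambda>(i, j). v i $ j) \<Delta> = mp_eval (\<lambda>(i, j). v i $ j) \<Delta>1 * mp_eval (\<lambda>(i, j). v i $ j) \<Delta>2 * (\<Prod>i<n. v i $ 3)"
    for v :: "nat \<Rightarrow> 'k ^ 3"
    unfolding \<Delta>_def \<Theta>_def ring_mapD(4)[OF ring_map_mp_eval] ring_map_prod[OF ring_map_mp_eval]
    by (simp add: mp_eval_def mp_subst_Var[OF ring_map_id])
  define U where "U = {p \<in> plane_tuples n. \<not> vanishes_on_tuple n \<Delta> p}"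
  have "zariski_closed n (plane_tuples n - U)"
    unfolding zariski_closed_def using hom by (intro exI[of _ "{\<Delta>}"]) (auto simp: U_def)
  then have "zariski_open n U" unfolding zariski_open_def by (auto simp: U_def)
  moreover have "U \<noteq> {}"
  proof -
    obtain v :: "nat \<Rightarrow> 'k ^ 3" where v: "\<forall>i. v i $ 3 = 1" "mp_eval (\<lambda>(i, j). v i $ j) \<Delta>1 \<noteq> 0" "mp_eval (\<lambda>(i, j). v i $ j) \<Delta>2 \<noteq> 0"
      using common_nonvanishing[OF inf w13 w23 \<Delta>1(2) \<Delta>2(2)] by blast
    have v0: "v i \<noteq> 0" for i using v(1) by (metis zero_index zero_neq_one)
    define p where "p = restrict (\<lambda>i. vec.span {v i}) {..<n}"
    have "p \<in> plane_tuples n" unfolding p_def using span_in_proj_plane[OF v0] by simp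
    moreover have "\<not> vanishes_on_tuple n \<Delta> p"
    proof
      assume "vanishes_on_tuple n \<Delta> p"
      moreover have "\<forall>i<n. v i \<in> p i - {0}" using v0 by (auto simp: p_def intro: vec.span_base)
      ultimately have "mp_eval (\<lambda>(i, j). v i $ j) \<Delta> = 0" unfolding vanishes_on_tuple_def by blast
      then show False using v by (simp add: ev)
    qed
    ultimately show ?thesis by (auto simp: U_def)
  qed
  moreover have "regular_system n d e p" if p: "p \<in> U" for p d
  proof -
    obtain v :: "nat \<Rightarrow> 'k ^ 3" where v: "\<forall>i<n. v i \<in> p i - {0}" and nz: "mp_eval (\<lambda>(i, j). v i $ j) \<Delta> \<noteq> 0"
      using p unfolding U_def vanishes_on_tuple_def by auto
    have v3: "v i $ 3 \<noteq> 0" if "i < n" for i using nz that unfolding ev by auto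
    define w where "w i = (1 / v i $ 3) *s v i" for i
    have pw: "p i \<in> proj_plane \<and> w i \<in> p i \<and> w i $ 3 = 1" if i: "i < n" for i
    proof -
      have pp: "p i \<in> proj_plane" using p i by (auto simp: U_def)
      then have "vec.subspace (p i)" by (simp add: proj_plane_def vec.projectivization_def)
      then have "w i \<in> p i" unfolding w_def using v i by (intro vec.subspace_scale) auto
      then show ?thesis using pp v3[OF i] by (simp add: w_def)
    qed
    have vw: "\<forall>i<n. v i = v i $ 3 *s w i \<and> w i $ 3 = 1"
      using v3 by (auto simp: w_def vec_eq_iff)
    have "mp_eval (\<lambda>(i, j). v i $ j) \<Delta>1 \<noteq> 0" "mp_eval (\<lambda>(i, j). v i $ j) \<Delta>2 \<noteq> 0" using nz unfolding ev by auto
    then have i1: "independent_conditions d0 n e {} (\<lambda>_ :: nat. \<lambda>_. 0) w" and i2: "independent_conditions (d0 + 1) n e J g w"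
      using good1[THEN spec[of _ v], THEN spec[of _ w], THEN spec[of _ "\<lambda>i. v i $ 3"]]
        good2[THEN spec[of _ v], THEN spec[of _ w], THEN spec[of _ "\<lambda>i. v i $ 3"]] vw by simp_all
    show ?thesis
    proof (cases "d \<le> d0")
      case True
      show ?thesis by (rule regular_below[OF pw i1 True])
    next
      case False
      then show ?thesis by (intro regular_above[OF e pw i2 finJ cardJ]) simp_all
    qed
  qed
  ultimately show ?thesis by blast
qed

end
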